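(* Let $N$ be a closed and embedded submanifold of a smooth manifold $M$, let $B=\mathrm{Blup}(M,N)$ be the real projective blowup of $M$ along $N$ with blowdown map $p\colon B\to M$. Let $A$ be a Lie algebroid over $M$ with anchor $\rho$, and let $C\subset A$ be a Lie subalgebroid supported on $N$. Suppose $\ker(\rho|_N)\subset C$. Then the singular foliation $\mathcal{F}_{\mathrm{Blup}}$ of the Lie algebroid $\mathrm{Blup}(A,C)$ over $B$ is $$\mathcal{F}_{\mathrm{Blup}}=\mathrm{Span}_{C^\infty_c(B)}\{\widetilde{Y}: Y\in\mathcal{F}_A\text{ such that }Y|_N\in\rho(\Gamma(C))\},$$ where $\widetilde{Y}$ denotes the unique lift of $Y$ to a vector field on $B$ which is $p$-related to $Y$.
   Context: Subscript $c$ means "compactly supported". **Blowup of manifolds.** As a set, $B=\mathrm{Blup}(M,N)$ is the disjoint union of $M\setminus N$ and the projectivization $\mathbb{P}$ of the normal bundle $TM|_N/TN$; it is a smooth manifold with a smooth proper blowdown map $p\colon B\to M$ restricting to a diffeomorphism $B\setminus\mathbb{P}\to M\setminus N$, and $\mathbb{P}=p^{-1}(N)$ is a codimension $1$ submanifold. Every vector field $Y$ on $M$ tangent to $N$ has a unique lift to a vector field $\widetilde{Y}$ on $B$ that is $p$-related to $Y$. **Lie subalgebroids.** A Lie subalgebroid $C\subset A$ supported on $N$ is a vector subbundle $C\to N$ of $A|_N$ with $\rho(C)\subset TN$ such that $\Gamma(A,C):=\{s\in\Gamma(A):s|_N\in\Gamma(C)\}$ is closed under the bracket of $A$. The hypothesis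 $\ker(\rho|_N)\subset C$ means $\ker(\rho_y)\subset C_y$ for all $y\in N$. **Blowup of Lie algebroids.** $\mathrm{Blup}(A,C)$ is a Lie algebroid over $B$. Its total space is obtained from $A$ by replacing $A|_N$ by the projectivization of $((TA)|_C\setminus\ker\pi_*|_C)/TC$, where $\pi\colon A\to M$ is the projection. Every $s\in\Gamma(A,C)$ canonically induces a section $\mathrm{Blup}(s)$ of $\mathrm{Blup}(A,C)$, and $\Gamma(\mathrm{Blup}(A,C))=\mathrm{Span}_{C^\infty(B)}\{\mathrm{Blup}(s):s\in\Gamma(A,C)\}$. The anchor $\widetilde\rho$ and the bracket are uniquely determined by $\widetilde\rho(\mathrm{Blup}(s))=\widetilde{\rho(s)}$ and $[\mathrm{Blup}(s),\mathrm{Blup}(s')]=\mathrm{Blup}([s,s'])$ for $s,s'\in\Gamma(A,C)$. Concretely, $\mathrm{Blup}(A,C)$ may be modelled as the vector bundle over $B$ whose module of sections is the $C^\infty(B)$-module of sections of $p^*A$ whose restriction to $\mathbb{P}$ takes values in $(p|_{\mathbb{P}})^*C$, with $\mathrm{Blup}(s)$ corresponding to $p^*s=s\circ p$. **Singular foliations.** $\mathcal{F}_A:=\rho(\Gamma_c(A))$ and $\mathcal{F}_{\mathrm{Blup}}:=\widetilde\rho(\Gamma_c(\mathrm{Blup}(A,C)))\subset\mathfrak{X}_c(B)$. $\mathrm{Span}_{C^\infty_c(B)}$ denotes finite linear combinations with coefficients in $C^\infty_c(B)$. *)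

theory Defs
  imports "HOL-Analysis.Analysis"
begin

section \<open>Smooth functions and smooth manifolds\<close>

primrec Ck_on :: "nat \<Rightarrow> 'e::real_normed_vector set \<Rightarrow> ('e \<Rightarrow> 'f::real_normed_vector) \<Rightarrow> bool" where
  "Ck_on 0 S f \<longleftrightarrow> continuous_on S f"
| "Ck_on (Suc k) S f \<longleftrightarrow>
     (\<forall>x\<in>S. f differentiable (at x)) \<and> (\<forall>v. Ck_on k S (\<lambda>x. frechet_derivative f (at x) v))"

text \<open>Only used for open sets \<open>S\<close>.\<close>

definition smooth_on :: "'e::real_normed_vector set \<Rightarrow> ('e \<Rightarrow> 'f::real_normed_vector) \<Rightarrow> bool" where
  "smooth_on S f \<longleftrightarrow> (\<forall>k. Ck_on k S f)"

text \<open>A chart is a pair of a domain and a coordinate map. A manifold is given by an atlas; its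
  points are those covered by the atlas, and its topology is the one that makes all charts
  homeomorphisms onto open subsets of the model space. Its dimension is \<open>DIM('e)\<close>.\<close>

type_synonym ('m, 'e) chart = "'m set \<times> ('m \<Rightarrow> 'e)"

definition is_chart :: "('m, 'e::euclidean_space) chart \<Rightarrow> bool" where
  "is_chart = (\<lambda>(U, \<phi>). inj_on \<phi> U \<and> open (\<phi> ` U))"

definition compatible :: "('m, 'e::euclidean_space) chart \<Rightarrow> ('m, 'e) chart \<Rightarrow> bool" where
  "compatible = (\<lambda>(U, \<phi>) (V, \<psi>).
     open (\<phi> ` (U \<inter> V)) \<and> open (\<psi> ` (U \<inter> V)) \<and>
     smooth_on (\<phi> ` (U \<inter> V)) (\<psi> \<circ> inv_into U \<phi>) \<and>
     smooth_on (\<psi> ` (U \<inter> V)) (\<phi> \<circ> inv_into V \<psi>))"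

definition points :: "('m, 'e) chart set \<Rightarrow> 'm set" where
  "points \<A> = (\<Union>(U, \<phi>)\<in>\<A>. U)"

definition mtop :: "('m, 'e::euclidean_space) chart set \<Rightarrow> 'm topology" where
  "mtop \<A> = topology_generated_by {U \<inter> \<phi> -` W |U \<phi> W. (U, \<phi>) \<in> \<A> \<and> open W}"

definition smooth_manifold :: "('m, 'e::euclidean_space) chart set \<Rightarrow> bool" where
  "smooth_manifold \<A> \<longleftrightarrow>
     (\<forall>c\<in>\<A>. is_chart c) \<and> (\<forall>c\<in>\<A>. \<forall>c'\<in>\<A>. compatible c c') \<and>
     Hausdorff_space (mtop \<A>) \<and> second_countable (mtop \<A>)"

definition max_atlas :: "('m, 'e::euclidean_space) chart set \<Rightarrow> ('m, 'e) chart set" where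
  "max_atlas \<A> = {c. is_chart c \<and> fst c \<subseteq> points \<A> \<and> (\<forall>c'\<in>\<A>. compatible c c')}"

text \<open>Smoothness on an open set \<open>W\<close> of points; the values outside \<open>W\<close> are irrelevant.\<close>

definition smooth_funs_on :: "('m, 'e::euclidean_space) chart set \<Rightarrow> 'm set \<Rightarrow> ('m \<Rightarrow> real) set" where
  "smooth_funs_on \<A> W = {f. \<forall>(U, \<phi>)\<in>\<A>. smooth_on (\<phi> ` (U \<inter> W)) (f \<circ> inv_into U \<phi>)}"

abbreviation smooth_funs :: "('m, 'e::euclidean_space) chart set \<Rightarrow> ('m \<Rightarrow> real) set" where
  "smooth_funs \<A> \<equiv> smooth_funs_on \<A> (points \<A>)"

definition compact_support :: "('m, 'e::euclidean_space) chart set \<Rightarrow> ('m \<Rightarrow> 'a::zero) \<Rightarrow> bool" where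
  "compact_support \<A> s \<longleftrightarrow> compactin (mtop \<A>) (mtop \<A> closure_of {x \<in> points \<A>. s x \<noteq> 0})"

definition compact_smooth_funs :: "('m, 'e::euclidean_space) chart set \<Rightarrow> ('m \<Rightarrow> real) set" where
  "compact_smooth_funs \<A> = {f \<in> smooth_funs \<A>. compact_support \<A> f}"

section \<open>Tangent vectors and vector fields\<close>

text \<open>Tangent vectors are derivations on smooth functions, extended by zero to all functions.\<close>

type_synonym 'm tangent = "('m \<Rightarrow> real) \<Rightarrow> real"

definition tangent_space :: "('m, 'e::euclidean_space) chart set \<Rightarrow> 'm \<Rightarrow> 'm tangent set" where
  "tangent_space \<A> x = {v.
     (\<forall>f. f \<notin> smooth_funs \<A> \<longrightarrow> v f = 0) \<and>
     (\<forall>f\<in>smooth_funs \<A>. \<forall>g\<in>smooth_funs \<A>. \<forall>c.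
        v (\<lambda>z. c * f z + g z) = c * v f + v g \<and>
        v (\<lambda>z. f z * g z) = f x * v g + g x * v f)}"

text \<open>Vector fields vanish, by convention, outside the manifold.\<close>

definition vector_fields :: "('m, 'e::euclidean_space) chart set \<Rightarrow> ('m \<Rightarrow> 'm tangent) set" where
  "vector_fields \<A> = {X.
     (\<forall>x\<in>points \<A>. X x \<in> tangent_space \<A> x) \<and>
     (\<forall>x. x \<notin> points \<A> \<longrightarrow> X x = (\<lambda>_. 0)) \<and>
     (\<forall>f\<in>smooth_funs \<A>. (\<lambda>x. X x f) \<in> smooth_funs \<A>)}"

definition vf_bracket :: "('m \<Rightarrow> 'm tangent) \<Rightarrow> ('m \<Rightarrow> 'm tangent) \<Rightarrow> ('m \<Rightarrow> 'm tangent)" where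
  "vf_bracket X Y = (\<lambda>x f. X x (\<lambda>z. Y z f) - Y x (\<lambda>z. X z f))"

definition span_over :: "('m \<Rightarrow> real) set \<Rightarrow> ('m \<Rightarrow> 'm tangent) set \<Rightarrow> ('m \<Rightarrow> 'm tangent) set" where
  "span_over K S = {(\<lambda>x g. \<Sum>k<n. f k x * X k x g) |(n::nat) f X. \<forall>k<n. f k \<in> K \<and> X k \<in> S}"

text \<open>The coordinate vector in the model space of a tangent vector \<open>v\<close> at \<open>y\<close>, in the chart \<open>c\<close>.\<close>

definition coords :: "('m, 'e::euclidean_space) chart set \<Rightarrow> ('m, 'e) chart \<Rightarrow> 'm \<Rightarrow> 'm tangent \<Rightarrow> 'e" where
  "coords \<A> = (\<lambda>(U, \<phi>) y v. THE w. \<forall>f\<in>smooth_funs \<A>.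
     v f = frechet_derivative (f \<circ> inv_into U \<phi>) (at (\<phi> y)) w)"

section \<open>Submanifolds\<close>

text \<open>A slice chart for \<open>N\<close>: within its domain, \<open>N\<close> is the zero set of the coordinates
  \<open>i \<in> Basis - D\<close>.\<close>

definition slice_chart ::
    "('m, 'e::euclidean_space) chart set \<Rightarrow> 'm set \<Rightarrow> 'm set \<Rightarrow> ('m \<Rightarrow> 'e) \<Rightarrow> 'e set \<Rightarrow> bool" where
  "slice_chart \<A> N U \<phi> D \<longleftrightarrow> (U, \<phi>) \<in> max_atlas \<A> \<and> D \<subseteq> Basis \<and>
     U \<inter> N = {x \<in> U. \<forall>i\<in>Basis - D. \<phi> x \<bullet> i = 0}"

definition closed_embedded_submanifold :: "('m, 'e::euclidean_space) chart set \<Rightarrow> 'm set \<Rightarrow> bool" where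
  "closed_embedded_submanifold \<A> N \<longleftrightarrow> closedin (mtop \<A>) N \<and>
     (\<exists>d. \<forall>y\<in>N. \<exists>U \<phi> D. y \<in> U \<and> card D = d \<and> slice_chart \<A> N U \<phi> D)"

text \<open>The tangent space of \<open>N\<close> as a subspace of that of the ambient manifold: those derivations
  that descend to functions on \<open>N\<close>.\<close>

definition sub_tangent_space :: "('m, 'e::euclidean_space) chart set \<Rightarrow> 'm set \<Rightarrow> 'm \<Rightarrow> 'm tangent set" where
  "sub_tangent_space \<A> N y =
     {v \<in> tangent_space \<A> y. \<forall>f\<in>smooth_funs \<A>. (\<forall>z\<in>N. f z = 0) \<longrightarrow> v f = 0}"

section \<open>The real projective blowup of a manifold along a submanifold\<close>

text \<open>The projectivised normal space at \<open>y\<close>, as the quotient of \<open>T\<^sub>yM - T\<^sub>yN\<close> by the relation that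
  identifies \<open>v\<close> and \<open>w\<close> if their classes modulo \<open>T\<^sub>yN\<close> are nonzero multiples of each other.\<close>

definition normal_line ::
    "('m, 'e::euclidean_space) chart set \<Rightarrow> 'm set \<Rightarrow> 'm \<Rightarrow> 'm tangent \<Rightarrow> 'm tangent set" where
  "normal_line \<A> N y v =
     {w \<in> tangent_space \<A> y. \<exists>c::real. c \<noteq> 0 \<and> (\<lambda>f. w f - c * v f) \<in> sub_tangent_space \<A> N y}"

definition proj_normal :: "('m, 'e::euclidean_space) chart set \<Rightarrow> 'm set \<Rightarrow> 'm \<Rightarrow> 'm tangent set set" where
  "proj_normal \<A> N y = normal_line \<A> N y ` (tangent_space \<A> y - sub_tangent_space \<A> N y)"

type_synonym 'm blup = "'m + 'm \<times> 'm tangent set"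

definition exceptional :: "('m, 'e::euclidean_space) chart set \<Rightarrow> 'm set \<Rightarrow> 'm blup set" where
  "exceptional \<A> N = {Inr (y, l) |y l. y \<in> N \<and> l \<in> proj_normal \<A> N y}"

definition blup_points :: "('m, 'e::euclidean_space) chart set \<Rightarrow> 'm set \<Rightarrow> 'm blup set" where
  "blup_points \<A> N = Inl ` (points \<A> - N) \<union> exceptional \<A> N"

definition blowdown :: "'m blup \<Rightarrow> 'm" where
  "blowdown b = (case b of Inl x \<Rightarrow> x | Inr (y, l) \<Rightarrow> y)"

text \<open>Homogeneous normal coordinates of a point of the blowup, in a slice chart: only the
  components along \<open>Basis - D\<close> are used, up to a common nonzero factor.\<close>

definition normal_coords ::
    "('m, 'e::euclidean_space) chart set \<Rightarrow> ('m, 'e) chart \<Rightarrow> 'm blup \<Rightarrow> 'e" where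
  "normal_coords \<A> c b =
     (case b of Inl x \<Rightarrow> snd c x | Inr (y, l) \<Rightarrow> coords \<A> c y (SOME v. v \<in> l))"

text \<open>The affine chart of the blowup associated with a slice chart and a normal coordinate \<open>i\<close>. In
  terms of the coordinates \<open>x\<^sub>j\<close> of the slice chart, its coordinates are \<open>x\<^sub>j\<close> for \<open>j \<in> D\<close> and
  \<open>j = i\<close>, and \<open>x\<^sub>j / x\<^sub>i\<close> for the other normal coordinates \<open>j\<close>.\<close>

definition blup_chart ::
    "('m, 'e::euclidean_space) chart set \<Rightarrow> 'm set \<Rightarrow> 'm set \<Rightarrow> ('m \<Rightarrow> 'e) \<Rightarrow> 'e set \<Rightarrow> 'e \<Rightarrow>
     ('m blup, 'e) chart" where
  "blup_chart \<A> N U \<phi> D i =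
     ({b \<in> blup_points \<A> N. blowdown b \<in> U \<and> normal_coords \<A> (U, \<phi>) b \<bullet> i \<noteq> 0},
      \<lambda>b. \<Sum>j\<in>Basis. (if j \<in> D \<or> j = i then \<phi> (blowdown b) \<bullet> j
                     else (normal_coords \<A> (U, \<phi>) b \<bullet> j) / (normal_coords \<A> (U, \<phi>) b \<bullet> i)) *\<^sub>R j)"

definition blup_atlas :: "('m, 'e::euclidean_space) chart set \<Rightarrow> 'm set \<Rightarrow> ('m blup, 'e) chart set" where
  "blup_atlas \<A> N =
     {(Inl ` (U - N), \<phi> \<circ> blowdown) |U \<phi>. (U, \<phi>) \<in> \<A>} \<union>
     {blup_chart \<A> N U \<phi> D i |U \<phi> D i. slice_chart \<A> N U \<phi> D \<and> i \<in> Basis - D}"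

definition blowdown_related ::
    "('m, 'e::euclidean_space) chart set \<Rightarrow> 'm set \<Rightarrow> ('m blup \<Rightarrow> 'm blup tangent) \<Rightarrow> ('m \<Rightarrow> 'm tangent) \<Rightarrow> bool" where
  "blowdown_related \<A> N X Y \<longleftrightarrow>
     (\<forall>b\<in>blup_points \<A> N. \<forall>f\<in>smooth_funs \<A>. X b (f \<circ> blowdown) = Y (blowdown b) f)"

definition lift_vf ::
    "('m, 'e::euclidean_space) chart set \<Rightarrow> 'm set \<Rightarrow> ('m \<Rightarrow> 'm tangent) \<Rightarrow> ('m blup \<Rightarrow> 'm blup tangent)" where
  "lift_vf \<A> N Y = (THE X. X \<in> vector_fields (blup_atlas \<A> N) \<and> blowdown_related \<A> N X Y)"

section \<open>Vector bundles\<close>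

text \<open>The fibres of a vector bundle are linear subspaces of a common real vector space without
  topology (e.g. the direct sum of all fibres), so that sections can be added and scaled pointwise.
  The local trivialisations are given by local frames
  \<open>e\<^sub>0, \<dots>, e\<^sub>r\<^sub>-\<^sub>1\<close> over open sets, whose transition functions have to be smooth.\<close>

record ('m, 'a) vbundle =
  vrank :: nat
  fibre :: "'m \<Rightarrow> 'a set"
  frames :: "('m set \<times> (nat \<Rightarrow> 'm \<Rightarrow> 'a)) set"

definition is_basis :: "nat \<Rightarrow> (nat \<Rightarrow> 'a::real_vector) \<Rightarrow> 'a set \<Rightarrow> bool" where
  "is_basis r e V \<longleftrightarrow> inj_on e {..<r} \<and> independent (e ` {..<r}) \<and> span (e ` {..<r}) = V"

definition vector_bundle ::
    "('m, 'e::euclidean_space) chart set \<Rightarrow> ('m, 'a::real_vector, 'z) vbundle_scheme \<Rightarrow> bool" where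
  "vector_bundle \<A> E \<longleftrightarrow>
     (\<Union>(U, e)\<in>frames E. U) = points \<A> \<and>
     (\<forall>(U, e)\<in>frames E. openin (mtop \<A>) U \<and>
        (\<forall>x\<in>U. is_basis (vrank E) (\<lambda>k. e k x) (fibre E x))) \<and>
     (\<forall>(U, e)\<in>frames E. \<forall>(U', e')\<in>frames E. \<exists>g.
        (\<forall>k<vrank E. \<forall>l<vrank E. g k l \<in> smooth_funs_on \<A> (U \<inter> U')) \<and>
        (\<forall>l<vrank E. \<forall>x\<in>U \<inter> U'. e' l x = (\<Sum>k<vrank E. g k l x *\<^sub>R e k x)))"

definition local_sections ::
    "('m, 'e::euclidean_space) chart set \<Rightarrow> ('m, 'a::real_vector, 'z) vbundle_scheme \<Rightarrow> 'm set \<Rightarrow> ('m \<Rightarrow> 'a) set" where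
  "local_sections \<A> E W = {s.
     (\<forall>x\<in>W. s x \<in> fibre E x) \<and>
     (\<forall>(U, e)\<in>frames E. \<exists>a. (\<forall>k<vrank E. a k \<in> smooth_funs_on \<A> (U \<inter> W)) \<and>
        (\<forall>x\<in>U \<inter> W. s x = (\<Sum>k<vrank E. a k x *\<^sub>R e k x)))}"

definition sections ::
    "('m, 'e::euclidean_space) chart set \<Rightarrow> ('m, 'a::real_vector, 'z) vbundle_scheme \<Rightarrow> ('m \<Rightarrow> 'a) set" where
  "sections \<A> E = {s \<in> local_sections \<A> E (points \<A>). \<forall>x. x \<notin> points \<A> \<longrightarrow> s x = 0}"

text \<open>Subbundles of the restriction of \<open>E\<close> to a submanifold \<open>N\<close>. Smoothness along \<open>N\<close> means that
  local smooth extensions to the ambient manifold exist.\<close>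

definition vector_subbundle ::
    "('m, 'e::euclidean_space) chart set \<Rightarrow> ('m, 'a::real_vector, 'z) vbundle_scheme \<Rightarrow> 'm set \<Rightarrow>
     ('m \<Rightarrow> 'a set) \<Rightarrow> bool" where
  "vector_subbundle \<A> E N C \<longleftrightarrow> (\<exists>q. \<forall>y\<in>N. \<exists>W c. openin (mtop \<A>) W \<and> y \<in> W \<and>
     (\<forall>k<q. c k \<in> local_sections \<A> E W) \<and> (\<forall>x\<in>W \<inter> N. is_basis q (\<lambda>k. c k x) (C x)))"

definition sub_sections ::
    "('m, 'e::euclidean_space) chart set \<Rightarrow> ('m, 'a::real_vector, 'z) vbundle_scheme \<Rightarrow> 'm set \<Rightarrow>
     ('m \<Rightarrow> 'a set) \<Rightarrow> ('m \<Rightarrow> 'a) set" where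
  "sub_sections \<A> E N C = {c.
     (\<forall>y\<in>N. c y \<in> C y) \<and> (\<forall>x. x \<notin> N \<longrightarrow> c x = 0) \<and>
     (\<forall>y\<in>N. \<exists>W. openin (mtop \<A>) W \<and> y \<in> W \<and>
        (\<exists>s\<in>local_sections \<A> E W. \<forall>x\<in>W \<inter> N. c x = s x))}"

text \<open>The sections of \<open>E\<close> whose restriction to \<open>N\<close> is a section of \<open>C\<close>.\<close>

definition rel_sections ::
    "('m, 'e::euclidean_space) chart set \<Rightarrow> ('m, 'a::real_vector, 'z) vbundle_scheme \<Rightarrow> 'm set \<Rightarrow>
     ('m \<Rightarrow> 'a set) \<Rightarrow> ('m \<Rightarrow> 'a) set" where
  "rel_sections \<A> E N C =
     {s \<in> sections \<A> E. (\<lambda>x. if x \<in> N then s x else 0) \<in> sub_sections \<A> E N C}"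

section \<open>Lie algebroids\<close>

record ('m, 'a) lie_algebroid = "('m, 'a) vbundle" +
  anchor :: "'m \<Rightarrow> 'a \<Rightarrow> 'm tangent"
  bracket :: "('m \<Rightarrow> 'a) \<Rightarrow> ('m \<Rightarrow> 'a) \<Rightarrow> ('m \<Rightarrow> 'a)"

text \<open>The map induced by the anchor from sections to vector fields.\<close>

definition anchor_vf ::
    "('m, 'e::euclidean_space) chart set \<Rightarrow> ('m, 'a::real_vector) lie_algebroid \<Rightarrow> ('m \<Rightarrow> 'a) \<Rightarrow> ('m \<Rightarrow> 'm tangent)" where
  "anchor_vf \<A> A s = (\<lambda>x. if x \<in> points \<A> then anchor A x (s x) else (\<lambda>_. 0))"

definition is_lie_algebroid ::
    "('m, 'e::euclidean_space) chart set \<Rightarrow> ('m, 'a::real_vector) lie_algebroid \<Rightarrow> bool" where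
  "is_lie_algebroid \<A> A \<longleftrightarrow>
     vector_bundle \<A> A \<and>
     (\<forall>x\<in>points \<A>. \<forall>u\<in>fibre A x. anchor A x u \<in> tangent_space \<A> x \<and>
        (\<forall>v\<in>fibre A x. \<forall>c. anchor A x (c *\<^sub>R u + v) = (\<lambda>f. c * anchor A x u f + anchor A x v f))) \<and>
     (\<forall>s\<in>sections \<A> A. anchor_vf \<A> A s \<in> vector_fields \<A>) \<and>
     (\<forall>s\<in>sections \<A> A. \<forall>t\<in>sections \<A> A.
        bracket A s t \<in> sections \<A> A \<and>
        bracket A t s = (\<lambda>x. - bracket A s t x) \<and>
        anchor_vf \<A> A (bracket A s t) = vf_bracket (anchor_vf \<A> A s) (anchor_vf \<A> A t) \<and>
        (\<forall>f\<in>smooth_funs \<A>. bracket A s (\<lambda>x. f x *\<^sub>R t x) =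
           (\<lambda>x. f x *\<^sub>R bracket A s t x + anchor_vf \<A> A s x f *\<^sub>R t x)) \<and>
        (\<forall>u\<in>sections \<A> A.
           (\<forall>c. bracket A s (\<lambda>x. c *\<^sub>R t x + u x) = (\<lambda>x. c *\<^sub>R bracket A s t x + bracket A s u x)) \<and>
           bracket A s (bracket A t u) =
             (\<lambda>x. bracket A (bracket A s t) u x + bracket A t (bracket A s u) x)))"

definition lie_subalgebroid ::
    "('m, 'e::euclidean_space) chart set \<Rightarrow> ('m, 'a::real_vector) lie_algebroid \<Rightarrow> 'm set \<Rightarrow>
     ('m \<Rightarrow> 'a set) \<Rightarrow> bool" where
  "lie_subalgebroid \<A> A N C \<longleftrightarrow>
     vector_subbundle \<A> A N C \<and>
     (\<forall>y\<in>N. anchor A y ` C y \<subseteq> sub_tangent_space \<A> N y) \<and>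
     (\<forall>s\<in>rel_sections \<A> A N C. \<forall>t\<in>rel_sections \<A> A N C. bracket A s t \<in> rel_sections \<A> A N C)"

definition foliation ::
    "('m, 'e::euclidean_space) chart set \<Rightarrow> ('m, 'a::real_vector) lie_algebroid \<Rightarrow> ('m \<Rightarrow> 'm tangent) set" where
  "foliation \<A> A = anchor_vf \<A> A ` {s \<in> sections \<A> A. compact_support \<A> s}"

section \<open>The blowup of a Lie algebroid along a Lie subalgebroid\<close>

definition pullback_bundle ::
    "('m, 'e::euclidean_space) chart set \<Rightarrow> 'm set \<Rightarrow> ('m, 'a::real_vector, 'z) vbundle_scheme \<Rightarrow>
     ('m blup, 'a) vbundle" where
  "pullback_bundle \<A> N E =
     \<lparr>vrank = vrank E, fibre = fibre E \<circ> blowdown,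
      frames = {({b \<in> blup_points \<A> N. blowdown b \<in> U}, \<lambda>k. e k \<circ> blowdown) |U e. (U, e) \<in> frames E}\<rparr>"

text \<open>The blowup of \<open>A\<close> along \<open>C\<close> is represented by its module of sections. The
  section induced by a section \<open>s\<close> of \<open>A\<close> that restricts to a section of \<open>C\<close> is the
  pullback \<open>blup_section \<A> N s\<close> of \<open>s\<close>.\<close>

definition blup_sections ::
    "('m, 'e::euclidean_space) chart set \<Rightarrow> 'm set \<Rightarrow> ('m, 'a::real_vector) lie_algebroid \<Rightarrow>
     ('m \<Rightarrow> 'a set) \<Rightarrow> ('m blup \<Rightarrow> 'a) set" where
  "blup_sections \<A> N A C =
     {\<sigma> \<in> sections (blup_atlas \<A> N) (pullback_bundle \<A> N A).
        \<forall>b\<in>exceptional \<A> N. \<sigma> b \<in> C (blowdown b)}"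

definition blup_section ::
    "('m, 'e::euclidean_space) chart set \<Rightarrow> 'm set \<Rightarrow> ('m \<Rightarrow> 'a::real_vector) \<Rightarrow> ('m blup \<Rightarrow> 'a)" where
  "blup_section \<A> N s = (\<lambda>b. if b \<in> blup_points \<A> N then s (blowdown b) else 0)"

text \<open>The anchor of the blowup, as a map from sections to vector fields: the unique map that is linear
  over the smooth functions and takes the prescribed values on the induced sections. It is the only part of the
  Lie algebroid structure of the blowup that its singular foliation depends on.\<close>

definition is_blup_anchor ::
    "('m, 'e::euclidean_space) chart set \<Rightarrow> 'm set \<Rightarrow> ('m, 'a::real_vector) lie_algebroid \<Rightarrow>
     ('m \<Rightarrow> 'a set) \<Rightarrow> (('m blup \<Rightarrow> 'a) \<Rightarrow> ('m blup \<Rightarrow> 'm blup tangent)) \<Rightarrow> bool" where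
  "is_blup_anchor \<A> N A C R \<longleftrightarrow>
     R \<in> blup_sections \<A> N A C \<rightarrow>\<^sub>E vector_fields (blup_atlas \<A> N) \<and>
     (\<forall>\<sigma>\<in>blup_sections \<A> N A C. \<forall>\<tau>\<in>blup_sections \<A> N A C. \<forall>f\<in>smooth_funs (blup_atlas \<A> N).
        R (\<lambda>b. f b *\<^sub>R \<sigma> b + \<tau> b) = (\<lambda>b g. f b * R \<sigma> b g + R \<tau> b g)) \<and>
     (\<forall>s\<in>rel_sections \<A> A N C. R (blup_section \<A> N s) = lift_vf \<A> N (anchor_vf \<A> A s))"

definition blup_anchor ::
    "('m, 'e::euclidean_space) chart set \<Rightarrow> 'm set \<Rightarrow> ('m, 'a::real_vector) lie_algebroid \<Rightarrow>
     ('m \<Rightarrow> 'a set) \<Rightarrow> ('m blup \<Rightarrow> 'a) \<Rightarrow> ('m blup \<Rightarrow> 'm blup tangent)" where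
  "blup_anchor \<A> N A C = (THE R. is_blup_anchor \<A> N A C R)"

definition blup_foliation ::
    "('m, 'e::euclidean_space) chart set \<Rightarrow> 'm set \<Rightarrow> ('m, 'a::real_vector) lie_algebroid \<Rightarrow>
     ('m \<Rightarrow> 'a set) \<Rightarrow> ('m blup \<Rightarrow> 'm blup tangent) set" where
  "blup_foliation \<A> N A C =
     blup_anchor \<A> N A C ` {\<sigma> \<in> blup_sections \<A> N A C. compact_support (blup_atlas \<A> N) \<sigma>}"

end

(* The anchor of the blowup is characterised by being p-related to rho: R sigma is the unique vector
   field on B with R sigma (f o p) = rho(sigma) f for all smooth f on M. Uniqueness holds because
   B - P is dense. Existence is local: along the exceptional divisor u_i = 0 of an affine chart, the
   normal components of rho(sigma) vanish, hence are divisible by u_i with smooth quotient. The same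
   one-variable Hadamard lemma shows that the transition maps of the blowup are smooth.
   For the inclusion of the foliation in the span, extend a frame of C near a point of N to a frame
   of A. The coefficients b of sigma along the complementary frame elements e vanish on the
   exceptional divisor, so that
     b e = sum_i (b x_i / |x|^2) (x_i e)
   with x_i the normal coordinates: here b x_i / |x|^2 is smooth on B, and x_i e vanishes on N.
   A partition of unity on M, pulled back to B, reduces to this local situation. Conversely, if
   Y = rho(s) agrees on N with rho(c) for a section c of C, then s - c lies in the kernel of rho on N,
   hence s|N is a section of C. *)
theory Submission
  imports Defs
begin

section \<open>Calculus of smooth functions\<close>


text \<open>Tangent vectors are derivations on globally defined smooth functions, so local
  computations pass through cutoffs; those used on B are pulled back from M.
  \<open>blup_anchor\<close> is a \<open>THE\<close> over linear maps with prescribed values on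
  induced sections. Its uniqueness comes from sections supported off N: a section of the blowup
  times such a cutoff is itself induced by a section of A vanishing on N, so linearity fixes the
  anchor off the exceptional divisor and density fixes it everywhere.

  Division by |x|^2 rather than by one x_i makes the decomposition independent of an affine chart: b
  / x_i is smooth on part of B only and would call for cutoffs that separate points of one fibre of
  p, while |x|^2 and the sections x_i e live on M. In place of a normalised partition of unity,
  \<sigma> is recovered from finitely many cutoffs \<kappa> as (1 - P) \<sigma>, where P is the
  product of the functions 1 - \<kappa> and vanishes on the support of \<sigma>.\<close>

lemma frechet_derivative_cong_open:
  assumes "open S" "x \<in> S" "\<And>y. y \<in> S \<Longrightarrow> f y = g y"
  shows "frechet_derivative f (at x) = frechet_derivative g (at x)"
proof -
  have "(f has_derivative f') (at x) \<longleftrightarrow> (g has_derivative f') (at x)" for f'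
    using has_derivative_transform_within_open[of f f' x UNIV S g]
      has_derivative_transform_within_open[of g f' x UNIV S f] assms by auto
  then show ?thesis unfolding frechet_derivative_def by simp
qed

lemma Ck_on_cong:
  assumes "open S" "\<And>y. y \<in> S \<Longrightarrow> f y = g y"
  shows "Ck_on k S f \<longleftrightarrow> Ck_on k S g"
  using assms
proof (induction k arbitrary: f g)
  case 0
  then show ?case by (simp cong: continuous_on_cong)
next
  case (Suc k)
  have 1: "f differentiable at x \<longleftrightarrow> g differentiable at x" if "x \<in> S" for x
    using has_derivative_transform_within_open[of f _ x UNIV S g]
      has_derivative_transform_within_open[of g _ x UNIV S f] Suc.prems that
    unfolding differentiable_def by auto
  have "Ck_on k S (\<lambda>x. frechet_derivative f (at x) v) \<longleftrightarrow>
      Ck_on k S (\<lambda>x. frechet_derivative g (at x) v)" for v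
    by (rule Suc.IH) (use Suc.prems frechet_derivative_cong_open in \<open>metis+\<close>)
  with 1 show ?case by simp
qed

lemma Ck_on_subset: "Ck_on k S f \<Longrightarrow> T \<subseteq> S \<Longrightarrow> Ck_on k T f"
  by (induction k arbitrary: f) (auto intro: continuous_on_subset)

lemma Ck_on_SucD: "Ck_on (Suc k) S f \<Longrightarrow> Ck_on k S f"
proof (induction k arbitrary: f)
  case 0
  then show ?case
    by (auto intro!: differentiable_imp_continuous_on differentiable_at_imp_differentiable_on)
next
  case (Suc k)
  then show ?case by (metis Ck_on.simps(2))
qed

text \<open>\<open>frechet_derivative\<close> is a choice operator. A derivative \<open>f'\<close>
  given by a formula may replace it, and this is how the product, chain and quotient rules below
  reduce level \<open>Suc k\<close> to level \<open>k\<close>.\<close>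

lemma Ck_on_SucI:
  assumes "open S" "\<And>x. x \<in> S \<Longrightarrow> (f has_derivative f' x) (at x)"
    and "\<And>v. Ck_on k S (\<lambda>x. f' x v)"
  shows "Ck_on (Suc k) S f"
proof -
  have "frechet_derivative f (at x) = f' x" if "x \<in> S" for x
    using assms(2)[OF that] frechet_derivative_at by metis
  then have "Ck_on k S (\<lambda>x. frechet_derivative f (at x) v)" for v
    using Ck_on_cong[OF assms(1), of "\<lambda>x. frechet_derivative f (at x) v" "\<lambda>x. f' x v" k] assms(3)[of v]
    by simp
  then show ?thesis using assms(2) unfolding Ck_on.simps differentiable_def by blast
qed

lemma Ck_on_SucE:
  assumes "Ck_on (Suc k) S f" "x \<in> S"
  shows "(f has_derivative frechet_derivative f (at x)) (at x)"
  using assms frechet_derivative_works by auto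

lemma Ck_on_local:
  assumes "\<And>x. x \<in> S \<Longrightarrow> \<exists>T. open T \<and> x \<in> T \<and> Ck_on k T f"
  shows "Ck_on k S f"
  using assms
proof (induction k arbitrary: f)
  case 0
  show ?case unfolding Ck_on.simps
  proof (intro continuous_at_imp_continuous_on ballI)
    fix x assume "x \<in> S"
    then obtain T where "open T" "x \<in> T" "continuous_on T f" using 0 by force
    then show "isCont f x" by (simp add: continuous_on_eq_continuous_at)
  qed
next
  case (Suc k)
  have "\<exists>T. open T \<and> x \<in> T \<and> Ck_on k T (\<lambda>x. frechet_derivative f (at x) v)" if "x \<in> S" for x v
    using Suc.prems[OF that] by auto
  then have "Ck_on k S (\<lambda>x. frechet_derivative f (at x) v)" for v
    using Suc.IH by blast
  moreover have "f differentiable at x" if "x \<in> S" for x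
    using Suc.prems[OF that] by auto
  ultimately show ?case by simp
qed

lemma Ck_on_const: "Ck_on k S (\<lambda>_. c)"
  by (induction k arbitrary: c) simp_all

lemma Ck_on_bounded_linear:
  assumes "open S" "bounded_linear L" "Ck_on k S f"
  shows "Ck_on k S (\<lambda>x. L (f x))"
  using assms(3)
proof (induction k arbitrary: f)
  case 0
  then show ?case using bounded_linear.continuous_on[OF assms(2)] by auto
next
  case (Suc k)
  show ?case
    by (rule Ck_on_SucI[OF assms(1)
        bounded_linear.has_derivative[OF assms(2) Ck_on_SucE[OF Suc.prems]]])
       (use Suc in auto)
qed

lemma Ck_on_add:
  assumes "open S" "Ck_on k S f" "Ck_on k S g"
  shows "Ck_on k S (\<lambda>x. f x + g x)"
  using assms(2,3)
proof (induction k arbitrary: f g)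
  case 0
  then show ?case by (auto intro: continuous_intros)
next
  case (Suc k)
  show ?case
    by (rule Ck_on_SucI[OF assms(1) has_derivative_add[OF Ck_on_SucE[OF Suc.prems(1)]
        Ck_on_SucE[OF Suc.prems(2)]]]) (use Suc in auto)
qed

lemma Ck_on_scaleR:
  assumes "open S" "Ck_on k S f" "Ck_on k S g"
  shows "Ck_on k S (\<lambda>x. f x *\<^sub>R g x)"
  using assms(2,3)
proof (induction k arbitrary: f g)
  case 0
  then show ?case by (auto intro: continuous_intros)
next
  case (Suc k)
  show ?case
    by (rule Ck_on_SucI[OF assms(1) has_derivative_scaleR[OF Ck_on_SucE[OF Suc.prems(1)]
        Ck_on_SucE[OF Suc.prems(2)]]])
      (use Suc.prems Suc.prems[THEN Ck_on_SucD] in \<open>auto intro!: Ck_on_add[OF assms(1)] Suc.IH\<close>)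
qed

lemma Ck_on_sum:
  assumes "open S" "\<And>i. i \<in> I \<Longrightarrow> Ck_on k S (f i)"
  shows "Ck_on k S (\<lambda>x. \<Sum>i\<in>I. f i x)"
proof (cases "finite I")
  case True
  then show ?thesis using assms(2)
    by (induction I) (auto intro: Ck_on_const Ck_on_add[OF assms(1)])
qed (simp add: Ck_on_const)

lemma frechet_derivative_sum_Basis:
  fixes f :: "'a::euclidean_space \<Rightarrow> 'b::real_normed_vector"
  assumes "(f has_derivative f') (at x)"
  shows "f' w = (\<Sum>i\<in>Basis. (w \<bullet> i) *\<^sub>R f' i)"
proof -
  have lin: "linear f'" using assms has_derivative_linear by blast
  have "f' w = f' (\<Sum>i\<in>Basis. (w \<bullet> i) *\<^sub>R i)" by (simp add: euclidean_representation)
  then show ?thesis by (simp add: linear_sum[OF lin] linear_scale[OF lin])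
qed

text \<open>\<open>Ck_on\<close> controls derivatives in fixed directions, whereas the chain rule
  evaluates the outer derivative in the direction \<open>?g x v\<close>, which varies with x.
  Expanding that direction in the basis gives a sum of products to which the induction hypothesis
  applies.\<close>

lemma Ck_on_compose:
  fixes f :: "'b::euclidean_space \<Rightarrow> 'c::real_normed_vector"
    and g :: "'a::real_normed_vector \<Rightarrow> 'b"
  assumes "open S" "open T" "Ck_on k T f" "Ck_on k S g" "g ` S \<subseteq> T"
  shows "Ck_on k S (\<lambda>x. f (g x))"
  using assms(3-5)
proof (induction k arbitrary: f)
  case 0
  then show ?case by (auto intro: continuous_on_compose2)
next
  case (Suc k)
  let ?f = "\<lambda>y. frechet_derivative f (at y)" and ?g = "\<lambda>x. frechet_derivative g (at x)"
  have f: "(f has_derivative ?f (g x)) (at (g x))" if "x \<in> S" for x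
    using Suc.prems that by (intro Ck_on_SucE) auto
  have "((\<lambda>x. f (g x)) has_derivative (\<lambda>v. \<Sum>i\<in>Basis. (?g x v \<bullet> i) *\<^sub>R ?f (g x) i)) (at x)"
    if "x \<in> S" for x
  proof -
    have "((\<lambda>x. f (g x)) has_derivative (\<lambda>v. ?f (g x) (?g x v))) (at x)"
      using has_derivative_compose[OF Ck_on_SucE[OF Suc.prems(2) that] f[OF that]] .
    moreover have "(\<lambda>v. ?f (g x) (?g x v)) = (\<lambda>v. \<Sum>i\<in>Basis. (?g x v \<bullet> i) *\<^sub>R ?f (g x) i)"
      by (rule ext) (rule frechet_derivative_sum_Basis[OF f[OF that]])
    ultimately show ?thesis by (rule has_derivative_eq_rhs)
  qed
  moreover have "Ck_on k S (\<lambda>x. \<Sum>i\<in>Basis. (?g x v \<bullet> i) *\<^sub>R ?f (g x) i)" for v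
  proof (intro Ck_on_sum Ck_on_scaleR assms(1))
    fix i :: 'b
    show "Ck_on k S (\<lambda>x. ?g x v \<bullet> i)"
      using Suc.prems(2) by (intro Ck_on_bounded_linear[OF assms(1) bounded_linear_inner_left]) simp
    show "Ck_on k S (\<lambda>x. ?f (g x) i)"
      using Suc.prems Suc.prems(2)[THEN Ck_on_SucD] by (intro Suc.IH[of "\<lambda>y. ?f y i"]) auto
  qed
  ultimately show ?case by (rule Ck_on_SucI[OF assms(1)])
qed

text \<open>The derivative - f' / f^2 contains 1 / f again, which at level \<open>k\<close> is
  supplied by the induction hypothesis for the same f.\<close>

lemma Ck_on_inverse:
  fixes f :: "'a::real_normed_vector \<Rightarrow> real"
  assumes "open S" "Ck_on k S f" "\<And>x. x \<in> S \<Longrightarrow> f x \<noteq> 0"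
  shows "Ck_on k S (\<lambda>x. inverse (f x))"
  using assms(2)
proof (induction k)
  case 0
  then show ?case using assms(3) by (auto intro: continuous_intros)
next
  case (Suc k)
  have "((\<lambda>x. inverse (f x)) has_derivative
      (\<lambda>v. (inverse (f x) * inverse (f x) * (- 1)) *\<^sub>R frechet_derivative f (at x) v)) (at x)"
    if "x \<in> S" for x
    using Deriv.has_derivative_inverse[OF assms(3)[OF that] Ck_on_SucE[OF Suc.prems that]]
    by (auto simp: mult_ac)
  moreover have "Ck_on k S (\<lambda>x. (inverse (f x) * inverse (f x) * (- 1)) *\<^sub>R frechet_derivative f (at x) v)" for v
  proof (rule Ck_on_scaleR[OF assms(1)])
    have "Ck_on k S (\<lambda>x. inverse (f x))" using Suc Ck_on_SucD by blast
    then have "Ck_on k S (\<lambda>x. (- 1) *\<^sub>R (inverse (f x) *\<^sub>R inverse (f x)))"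
      by (intro Ck_on_scaleR assms(1) Ck_on_const)
    then show "Ck_on k S (\<lambda>x. inverse (f x) * inverse (f x) * (- 1))" by simp
  qed (use Suc.prems in auto)
  ultimately show ?case by (rule Ck_on_SucI[OF assms(1)])
qed

lemma smooth_on_cong:
  assumes "open S" "\<And>y. y \<in> S \<Longrightarrow> f y = g y"
  shows "smooth_on S f \<longleftrightarrow> smooth_on S g"
  using Ck_on_cong[of S f g] assms unfolding smooth_on_def by blast

lemma smooth_on_subset: "smooth_on S f \<Longrightarrow> T \<subseteq> S \<Longrightarrow> smooth_on T f"
  unfolding smooth_on_def using Ck_on_subset by blast

lemma smooth_on_eq:
  "smooth_on S f \<Longrightarrow> open S \<Longrightarrow> (\<And>z. z \<in> S \<Longrightarrow> f z = g z) \<Longrightarrow> smooth_on S g"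
  using smooth_on_cong[of S f g] by blast

lemma smooth_on_local:
  assumes "\<And>x. x \<in> S \<Longrightarrow> \<exists>T. open T \<and> x \<in> T \<and> smooth_on T f"
  shows "smooth_on S f"
  unfolding smooth_on_def
proof
  fix k show "Ck_on k S f"
    using assms unfolding smooth_on_def by (intro Ck_on_local) blast
qed

lemma smooth_on_const [simp]: "smooth_on S (\<lambda>_. c)"
  by (simp add: smooth_on_def Ck_on_const)

lemma smooth_on_bounded_linear:
  "open S \<Longrightarrow> bounded_linear L \<Longrightarrow> smooth_on S f \<Longrightarrow> smooth_on S (\<lambda>x. L (f x))"
  by (simp add: smooth_on_def Ck_on_bounded_linear)

lemma smooth_on_id: "open S \<Longrightarrow> smooth_on S (\<lambda>x. x)"
  unfolding smooth_on_def
proof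
  fix k assume "open S"
  show "Ck_on k S (\<lambda>x. x)"
  proof (cases k)
    case (Suc n)
    show ?thesis unfolding Suc
      by (rule Ck_on_SucI[OF \<open>open S\<close> has_derivative_ident]) (rule Ck_on_const)
  qed simp
qed

lemma smooth_on_add:
  "open S \<Longrightarrow> smooth_on S f \<Longrightarrow> smooth_on S g \<Longrightarrow> smooth_on S (\<lambda>x. f x + g x)"
  by (simp add: smooth_on_def Ck_on_add)

lemma smooth_on_scaleR:
  "open S \<Longrightarrow> smooth_on S f \<Longrightarrow> smooth_on S g \<Longrightarrow> smooth_on S (\<lambda>x. f x *\<^sub>R g x)"
  by (simp add: smooth_on_def Ck_on_scaleR)

lemma smooth_on_mult:
  fixes f g :: "'a::real_normed_vector \<Rightarrow> real"
  shows "open S \<Longrightarrow> smooth_on S f \<Longrightarrow> smooth_on S g \<Longrightarrow> smooth_on S (\<lambda>x. f x * g x)"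
  using smooth_on_scaleR[of S f g] by simp

lemma smooth_on_minus:
  "open S \<Longrightarrow> smooth_on S f \<Longrightarrow> smooth_on S g \<Longrightarrow> smooth_on S (\<lambda>x. f x - g x)"
  using smooth_on_add[of S f "\<lambda>x. (- 1) *\<^sub>R g x"] smooth_on_scaleR[of S "\<lambda>_. - 1" g] by simp

lemma smooth_on_sum:
  "open S \<Longrightarrow> (\<And>i. i \<in> I \<Longrightarrow> smooth_on S (f i)) \<Longrightarrow> smooth_on S (\<lambda>x. \<Sum>i\<in>I. f i x)"
  by (simp add: smooth_on_def Ck_on_sum)

lemma smooth_on_compose:
  fixes f :: "'b::euclidean_space \<Rightarrow> 'c::real_normed_vector"
    and g :: "'a::real_normed_vector \<Rightarrow> 'b"
  shows "open S \<Longrightarrow> open T \<Longrightarrow> smooth_on T f \<Longrightarrow> smooth_on S g \<Longrightarrow> g ` S \<subseteq> T \<Longrightarrow>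
    smooth_on S (\<lambda>x. f (g x))"
  by (simp add: smooth_on_def Ck_on_compose)

lemma smooth_on_inverse:
  fixes f :: "'a::real_normed_vector \<Rightarrow> real"
  shows "open S \<Longrightarrow> smooth_on S f \<Longrightarrow> (\<And>x. x \<in> S \<Longrightarrow> f x \<noteq> 0) \<Longrightarrow> smooth_on S (\<lambda>x. inverse (f x))"
  by (simp add: smooth_on_def Ck_on_inverse)

lemma smooth_on_divide:
  fixes f g :: "'a::real_normed_vector \<Rightarrow> real"
  shows "open S \<Longrightarrow> smooth_on S f \<Longrightarrow> smooth_on S g \<Longrightarrow> (\<And>x. x \<in> S \<Longrightarrow> g x \<noteq> 0) \<Longrightarrow>
    smooth_on S (\<lambda>x. f x / g x)"
  using smooth_on_mult[of S f "\<lambda>x. inverse (g x)"] smooth_on_inverse[of S g] by (simp add: divide_inverse)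

lemma smooth_on_inner_left:
  "open S \<Longrightarrow> smooth_on S f \<Longrightarrow> smooth_on S (\<lambda>x. f x \<bullet> i)"
  by (rule smooth_on_bounded_linear[OF _ bounded_linear_inner_left])

lemma smooth_on_componentwise:
  fixes f :: "'a::real_normed_vector \<Rightarrow> 'b::euclidean_space"
  assumes "open S" "\<And>i. i \<in> Basis \<Longrightarrow> smooth_on S (\<lambda>x. f x \<bullet> i)"
  shows "smooth_on S f"
proof -
  have "smooth_on S (\<lambda>x. \<Sum>i\<in>Basis. (f x \<bullet> i) *\<^sub>R i)"
    by (intro smooth_on_sum smooth_on_scaleR assms smooth_on_const)
  then show ?thesis by (simp add: euclidean_representation)
qed

lemma smooth_on_imp_continuous_on: "smooth_on S f \<Longrightarrow> continuous_on S f"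
  unfolding smooth_on_def using Ck_on.simps(1) by blast

lemma smooth_on_has_derivative:
  "smooth_on S f \<Longrightarrow> x \<in> S \<Longrightarrow> (f has_derivative frechet_derivative f (at x)) (at x)"
  unfolding smooth_on_def using Ck_on_SucE by blast

lemma smooth_on_frechet_derivative:
  "smooth_on S f \<Longrightarrow> smooth_on S (\<lambda>x. frechet_derivative f (at x) v)"
  unfolding smooth_on_def using Ck_on.simps(2) by blast

text \<open>The powers of t in the denominator make the family closed under differentiation up to
  linear combinations, so that one induction with arbitrary \<open>n\<close> yields all orders of
  smoothness. The function of interest is \<open>flat_exp 0\<close>.\<close>

definition flat_exp :: "nat \<Rightarrow> real \<Rightarrow> real" where
  "flat_exp n t = (if t > 0 then exp (- (1 / t)) / t ^ n else 0)"

lemma flat_exp_has_derivative: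
  "(flat_exp n has_real_derivative flat_exp (n + 2) t - real n * flat_exp (n + 1) t) (at t)"
proof -
  consider "t > 0" | "t < 0" | "t = 0" by linarith
  then show ?thesis
  proof cases
    case 1
    have "((\<lambda>t. exp (- (1 / t)) / t ^ n) has_real_derivative
       flat_exp (n + 2) t - real n * flat_exp (n + 1) t) (at t)"
    proof -
      have "((\<lambda>t. t ^ n) has_real_derivative real n * t ^ n / t) (at t)"
        using 1 DERIV_pow[of n t] by (cases n) auto
      moreover have "((\<lambda>t. exp (- (1 / t))) has_real_derivative exp (- (1 / t)) / t ^ 2) (at t)"
        using 1 by (auto intro!: derivative_eq_intros simp: power2_eq_square)
      ultimately have "((\<lambda>t. exp (- (1 / t)) / t ^ n) has_real_derivative
        (exp (- (1 / t)) / t ^ 2 * t ^ n - exp (- (1 / t)) * (real n * t ^ n / t)) / (t ^ n * t ^ n)) (at t)"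
        using 1 by (intro DERIV_divide) auto
      moreover have "(exp (- (1 / t)) / t ^ 2 * t ^ n - exp (- (1 / t)) * (real n * t ^ n / t)) / (t ^ n * t ^ n)
        = flat_exp (n + 2) t - real n * flat_exp (n + 1) t"
        using 1 by (simp add: flat_exp_def field_simps power2_eq_square)
      ultimately show ?thesis by simp
    qed
    then show ?thesis
      by (rule has_field_derivative_transform_within_open[where S = "{0<..}"])
        (use 1 in \<open>auto simp: flat_exp_def\<close>)
  next
    case 2
    have "((\<lambda>t. 0) has_real_derivative 0) (at t)" by simp
    then have "(flat_exp n has_real_derivative 0) (at t)"
      by (rule has_field_derivative_transform_within_open[where S = "{..<0}"])
        (use 2 in \<open>auto simp: flat_exp_def\<close>)
    then show ?thesis using 2 by (simp add: flat_exp_def)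
  next
    case 3
    have "((\<lambda>h. (flat_exp n (0 + h) - flat_exp n 0) / h) \<longlongrightarrow> 0) (at 0)"
    proof (rule filterlim_split_at_real)
      \<comment> \<open>From the right the difference quotient at 0 is s ^ (n + 1) / exp s with s =
        1 / h, and the exponential wins as s grows.\<close>
      have "((\<lambda>h::real. inverse h ^ Suc n / exp (inverse h)) \<longlongrightarrow> 0) (at_right 0)"
        by (rule filterlim_compose[OF tendsto_power_div_exp_0 filterlim_inverse_at_top_right])
      then show "((\<lambda>h. (flat_exp n (0 + h) - flat_exp n 0) / h) \<longlongrightarrow> 0) (at_right 0)"
        by (rule Lim_transform_eventually)
          (auto simp: flat_exp_def exp_minus field_simps eventually_at_filter)
      show "((\<lambda>h. (flat_exp n (0 + h) - flat_exp n 0) / h) \<longlongrightarrow> 0) (at_left 0)"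
        by (rule Lim_transform_eventually[OF tendsto_const])
          (auto simp: flat_exp_def eventually_at_filter)
    qed
    then show ?thesis using 3 by (simp add: DERIV_def flat_exp_def)
  qed
qed

lemma smooth_on_flat_exp: "smooth_on UNIV (flat_exp n)"
  unfolding smooth_on_def
proof
  fix k show "Ck_on k UNIV (flat_exp n)"
  proof (induction k arbitrary: n)
    case 0
    show ?case using DERIV_continuous_on[OF has_field_derivative_at_within[OF flat_exp_has_derivative]]
      by simp
  next
    case (Suc k)
    have d: "(flat_exp n has_derivative
        (\<lambda>v. (flat_exp (n + 2) t + (- real n) *\<^sub>R flat_exp (n + 1) t) *\<^sub>R v)) (at t)" for t
      using flat_exp_has_derivative[of n t] by (simp add: has_field_derivative_def mult_commute_abs)
    show ?case
      by (rule Ck_on_SucI[OF open_UNIV d]) (intro Ck_on_add Ck_on_scaleR Suc.IH Ck_on_const open_UNIV)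
  qed
qed

text \<open>The classical quotient: of t and 1 - t at least one is positive, so the denominator
  never vanishes.\<close>

definition smooth_step :: "real \<Rightarrow> real" where
  "smooth_step t = flat_exp 0 t / (flat_exp 0 t + flat_exp 0 (1 - t))"

lemma smooth_on_smooth_step: "smooth_on UNIV smooth_step"
proof -
  have a: "smooth_on UNIV (\<lambda>t. flat_exp 0 (1 - t))"
    by (rule smooth_on_compose[OF open_UNIV open_UNIV smooth_on_flat_exp])
      (auto intro!: smooth_on_minus smooth_on_id)
  have "flat_exp 0 t + flat_exp 0 (1 - t) \<noteq> 0" for t
    by (cases "t > 0"; cases "1 - t > 0")
      (auto simp: flat_exp_def add_nonneg_eq_0_iff intro!: less_imp_neq[symmetric] add_pos_pos)
  then have "smooth_on UNIV (\<lambda>t. flat_exp 0 t / (flat_exp 0 t + flat_exp 0 (1 - t)))"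
    by (intro smooth_on_divide smooth_on_add smooth_on_flat_exp a) auto
  then show ?thesis unfolding smooth_step_def[abs_def] .
qed

lemma smooth_step_0: "t \<le> 0 \<Longrightarrow> smooth_step t = 0"
  and smooth_step_1: "t \<ge> 1 \<Longrightarrow> smooth_step t = 1"
  by (auto simp: smooth_step_def flat_exp_def)

lemma smooth_bump_exists:
  fixes a :: "'e::euclidean_space"
  assumes "r > 0"
  obtains \<beta> :: "'e \<Rightarrow> real" where "smooth_on UNIV \<beta>"
    "\<And>x. dist a x \<le> r / 2 \<Longrightarrow> \<beta> x = 1" "\<And>x. dist a x \<ge> r \<Longrightarrow> \<beta> x = 0"
proof
  \<comment> \<open>The factor 4/3 makes the argument of the step equal to 1 at distance r/2, where
    1 - 1/4 = 3/4 remains, and equal to 0 at distance r. The squared distance is written as a sum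
    over the basis, a form to which the closure rules of \<open>smooth_on\<close> apply.\<close>
  let ?q = "\<lambda>x::'e. 4 / 3 * (1 - (\<Sum>i\<in>Basis. ((x - a) \<bullet> i) * ((x - a) \<bullet> i)) / r\<^sup>2)"
  let ?\<beta> = "\<lambda>x. smooth_step (?q x)"
  have q: "?q x = 4 / 3 * (1 - (dist a x)\<^sup>2 / r\<^sup>2)" for x
    by (simp add: dist_norm[of a x] norm_minus_commute[of a x] power2_norm_eq_inner euclidean_inner[of "x - a" "x - a"])
  have "smooth_on UNIV (\<lambda>x. 4 / 3 * (1 - (\<Sum>i\<in>Basis. ((x - a) \<bullet> i) * ((x - a) \<bullet> i)) * (1 / r\<^sup>2)))"
    by (intro smooth_on_mult smooth_on_minus smooth_on_const smooth_on_sum smooth_on_inner_left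
        smooth_on_id open_UNIV)
  then show "smooth_on UNIV ?\<beta>"
    by (intro smooth_on_compose[OF open_UNIV open_UNIV smooth_on_smooth_step]) auto
  show "?\<beta> x = 1" if "dist a x \<le> r / 2" for x
  proof -
    have "(dist a x)\<^sup>2 \<le> (r / 2)\<^sup>2" using that by (intro power_mono) auto
    then have "(dist a x)\<^sup>2 / r\<^sup>2 \<le> 1 / 4" using assms by (simp add: field_simps)
    then show ?thesis unfolding q by (intro smooth_step_1) (simp add: mult.commute)
  qed
  show "?\<beta> x = 0" if "dist a x \<ge> r" for x
  proof -
    have "r\<^sup>2 \<le> (dist a x)\<^sup>2" using that assms by (intro power_mono) auto
    then have "(dist a x)\<^sup>2 / r\<^sup>2 \<ge> 1" using assms by (simp add: field_simps)
    then show ?thesis unfolding q by (intro smooth_step_0) simp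
  qed
qed

text \<open>Both Hadamard lemmas take their quotient from such an integral. The maps
  \<open>A\<close> and \<open>B\<close> are affine: their derivatives do not depend on the point.
  The weight \<open>t ^ m\<close> is there for the induction: differentiating F (A x + t B x) in x
  yields one integral with a derivative of F along \<open>A'\<close> and one with a derivative along
  \<open>B'\<close> that carries a further factor t. Convexity of \<open>V\<close> serves the
  Leibniz rule.\<close>

lemma Ck_on_segment_integral:
  fixes A B :: "'e::euclidean_space \<Rightarrow> 'e" and F :: "'e \<Rightarrow> real"
  assumes S: "open S" and V: "open V" "convex V"
    and sub: "\<And>x t. x \<in> V \<Longrightarrow> 0 \<le> t \<Longrightarrow> t \<le> 1 \<Longrightarrow> A x + t *\<^sub>R B x \<in> S"
    and A: "\<And>x. (A has_derivative A') (at x)" and B: "\<And>x. (B has_derivative B') (at x)"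
    and F: "smooth_on S F"
  shows "Ck_on k V (\<lambda>x. integral (cbox 0 1) (\<lambda>t. t ^ m * F (A x + t *\<^sub>R B x)))"
  using F
proof (induction k arbitrary: F m)
  have contA: "continuous_on UNIV A" and contB: "continuous_on UNIV B"
    using A B by (meson has_derivative_continuous continuous_at_imp_continuous_on)+
  have cont: "continuous_on (V \<times> cbox 0 1) (\<lambda>(x, t). t ^ m * G (A x + t *\<^sub>R B x))"
    if "smooth_on S G" for G :: "'e \<Rightarrow> real" and m
  proof -
    have 1: "continuous_on (V \<times> cbox (0::real) 1) (\<lambda>z. A (fst z))" "continuous_on (V \<times> cbox (0::real) 1) (\<lambda>z. B (fst z))"
      by (rule continuous_on_compose2[OF contA] continuous_on_compose2[OF contB];
          auto intro!: continuous_intros)+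
    have "continuous_on (V \<times> cbox (0::real) 1) (\<lambda>z. A (fst z) + snd z *\<^sub>R B (fst z))"
      by (intro continuous_intros 1)
    then have "continuous_on (V \<times> cbox 0 1) (\<lambda>z. G (A (fst z) + snd z *\<^sub>R B (fst z)))"
      by (rule continuous_on_compose2[OF smooth_on_imp_continuous_on[OF that]]) (use sub in auto)
    then show ?thesis unfolding split_beta by (intro continuous_intros) auto
  qed
  have contx: "(\<lambda>t. t ^ m * G (A x + t *\<^sub>R B x)) integrable_on cbox 0 1"
    if "smooth_on S G" "x \<in> V" for G :: "'e \<Rightarrow> real" and m x
  proof (rule integrable_continuous)
    have "continuous_on (cbox 0 1) (\<lambda>t. (case (x, t) of (x, t) \<Rightarrow> t ^ m * G (A x + t *\<^sub>R B x)))"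
      by (rule continuous_on_compose2[OF cont[OF that(1)], of _ "\<lambda>t. (x, t)"])
        (use that(2) in \<open>auto intro!: continuous_intros\<close>)
    then show "continuous_on (cbox 0 1) (\<lambda>t. t ^ m * G (A x + t *\<^sub>R B x))" by simp
  qed
  have blA: "bounded_linear A'" and blB: "bounded_linear B'"
    using A B has_derivative_bounded_linear by blast+
  let ?I = "\<lambda>m F x. integral (cbox 0 1) (\<lambda>t. t ^ m * F (A x + t *\<^sub>R B x))"
  let ?F = "\<lambda>F x. frechet_derivative F (at x)"
  have deriv: "(?I m F has_derivative (\<lambda>v. ?I m (\<lambda>y. ?F F y (A' v)) x + ?I (m+1) (\<lambda>y. ?F F y (B' v)) x)) (at x)"
    if F: "smooth_on S F" and x: "x \<in> V" for F :: "'e \<Rightarrow> real" and m x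
  proof -
    let ?L = "\<lambda>x t v. t ^ m * ?F F (A x + t *\<^sub>R B x) (A' v + t *\<^sub>R B' v)"
    have hd: "((\<lambda>x. t ^ m * F (A x + t *\<^sub>R B x)) has_derivative ?L x t) (at x)"
      if "x \<in> V" "t \<in> cbox 0 1" for x t
    proof -
      have "((\<lambda>x. A x + t *\<^sub>R B x) has_derivative (\<lambda>v. A' v + t *\<^sub>R B' v)) (at x)"
        by (intro derivative_intros A B)
      moreover have "(F has_derivative ?F F (A x + t *\<^sub>R B x)) (at (A x + t *\<^sub>R B x))"
        using smooth_on_has_derivative[OF F] sub that by auto
      ultimately have "((\<lambda>x. F (A x + t *\<^sub>R B x)) has_derivative (\<lambda>v. ?F F (A x + t *\<^sub>R B x) (A' v + t *\<^sub>R B' v))) (at x)"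
        using has_derivative_compose by blast
      then show ?thesis by (intro derivative_intros)
    qed
    have bl: "blinfun_apply (Blinfun (?L x t)) = ?L x t" if "x \<in> V" "t \<in> cbox 0 1" for x t
      using bounded_linear_Blinfun_apply[OF has_derivative_bounded_linear[OF hd[OF that]]] .
    have lin: "?L x t v = t ^ m * ?F F (A x + t *\<^sub>R B x) (A' v) + t ^ (m + 1) * ?F F (A x + t *\<^sub>R B x) (B' v)"
      if "x \<in> V" "t \<in> cbox 0 1" for x t v
    proof -
      have "linear (?F F (A x + t *\<^sub>R B x))"
        using has_derivative_linear[OF smooth_on_has_derivative[OF F]] sub that by auto
      then show ?thesis by (simp add: linear_add linear_scale algebra_simps)
    qed
    \<comment> \<open>The Leibniz rule asks for the derivative as a bounded linear map that is
      jointly continuous in x and t; in finite dimension this may be tested on basis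
      vectors.\<close>
    have contL: "continuous_on (V \<times> cbox 0 1) (\<lambda>(x, t). Blinfun (?L x t))"
    proof (rule continuous_on_blinfun_componentwise)
      fix i :: 'e
      have "continuous_on (V \<times> cbox 0 1) (\<lambda>z. (case z of (x, t) \<Rightarrow> t ^ m * ?F F (A x + t *\<^sub>R B x) (A' i)) +
         (case z of (x, t) \<Rightarrow> t ^ (m + 1) * ?F F (A x + t *\<^sub>R B x) (B' i)))"
        by (intro continuous_on_add cont smooth_on_frechet_derivative F)
      moreover have "blinfun_apply (case z of (x, t) \<Rightarrow> Blinfun (?L x t)) i =
          (case z of (x, t) \<Rightarrow> t ^ m * ?F F (A x + t *\<^sub>R B x) (A' i)) +
         (case z of (x, t) \<Rightarrow> t ^ (m + 1) * ?F F (A x + t *\<^sub>R B x) (B' i))" if "z \<in> V \<times> cbox 0 1" for z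
        using that bl lin by (auto split: prod.splits)
      ultimately show "continuous_on (V \<times> cbox 0 1) (\<lambda>z. blinfun_apply (case z of (x, t) \<Rightarrow> Blinfun (?L x t)) i)"
        by (simp cong: continuous_on_cong)
    qed
    have "(?I m F has_derivative integral (cbox 0 1) (\<lambda>t. Blinfun (?L x t))) (at x within V)"
      using contx[OF F] contL bl hd V(2) x
      by (intro leibniz_rule) (auto intro: has_derivative_at_withinI)
    then have 1: "(?I m F has_derivative integral (cbox 0 1) (\<lambda>t. Blinfun (?L x t))) (at x)"
      using at_within_open[OF x V(1)] by simp
    have "(\<lambda>t. (case (x, t) of (x, t) \<Rightarrow> Blinfun (?L x t))) integrable_on cbox 0 1"
      by (rule integrable_continuous, rule continuous_on_compose2[OF contL, of _ "\<lambda>t. (x, t)"])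
        (use x in \<open>auto intro!: continuous_intros\<close>)
    then have int: "(\<lambda>t. Blinfun (?L x t)) integrable_on cbox 0 1" by simp
    have "blinfun_apply (integral (cbox 0 1) (\<lambda>t. Blinfun (?L x t))) v
        = ?I m (\<lambda>y. ?F F y (A' v)) x + ?I (m+1) (\<lambda>y. ?F F y (B' v)) x" for v
    proof -
      have "blinfun_apply (integral (cbox 0 1) (\<lambda>t. Blinfun (?L x t))) v
        = integral (cbox 0 1) (\<lambda>t. blinfun_apply (Blinfun (?L x t)) v)"
        by (rule blinfun_apply_integral[OF int])
      also have "\<dots> = integral (cbox 0 1) (\<lambda>t. t ^ m * ?F F (A x + t *\<^sub>R B x) (A' v) + t ^ (m + 1) * ?F F (A x + t *\<^sub>R B x) (B' v))"
        by (rule integral_cong) (use bl lin x in auto)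
      also have "\<dots> = ?I m (\<lambda>y. ?F F y (A' v)) x + ?I (m+1) (\<lambda>y. ?F F y (B' v)) x"
        by (rule integral_add) (intro contx smooth_on_frechet_derivative F x)+
      finally show ?thesis .
    qed
    then have "blinfun_apply (integral (cbox 0 1) (\<lambda>t. Blinfun (?L x t)))
        = (\<lambda>v. ?I m (\<lambda>y. ?F F y (A' v)) x + ?I (m+1) (\<lambda>y. ?F F y (B' v)) x)" by auto
    then show ?thesis using 1 by simp
  qed
  {
    case 0
    then show ?case unfolding Ck_on.simps
      by (intro continuous_at_imp_continuous_on ballI has_derivative_continuous[OF deriv])
  next
    case (Suc k)
    show ?case
      by (rule Ck_on_SucI[OF V(1) deriv[OF Suc.prems]], assumption)
         (intro Ck_on_add[OF V(1)] Suc.IH smooth_on_frechet_derivative[OF Suc.prems])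
  }
qed

lemma segment_integral_derivative:
  fixes F :: "'e::euclidean_space \<Rightarrow> real"
  assumes F: "smooth_on S F" and sub: "\<And>t. 0 \<le> t \<Longrightarrow> t \<le> 1 \<Longrightarrow> a + t *\<^sub>R b \<in> S"
  shows "((\<lambda>t. frechet_derivative F (at (a + t *\<^sub>R b)) b) has_integral F (a + b) - F a) (cbox 0 1)"
proof -
  have "((\<lambda>t. F (a + t *\<^sub>R b)) has_vector_derivative frechet_derivative F (at (a + t *\<^sub>R b)) b) (at t within {0..1})"
    if "t \<in> {0..1}" for t
  proof -
    let ?D = "frechet_derivative F (at (a + t *\<^sub>R b))"
    have d: "(F has_derivative ?D) (at (a + t *\<^sub>R b))"
      using smooth_on_has_derivative[OF F] sub that by auto
    have "((\<lambda>t. a + t *\<^sub>R b) has_derivative (\<lambda>s. s *\<^sub>R b)) (at t)"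
      by (auto intro!: derivative_eq_intros)
    from has_derivative_compose[OF this d]
    have "((\<lambda>t. F (a + t *\<^sub>R b)) has_derivative (\<lambda>s. ?D (s *\<^sub>R b))) (at t)" .
    then have "((\<lambda>t. F (a + t *\<^sub>R b)) has_vector_derivative ?D b) (at t)"
      unfolding has_vector_derivative_def using linear_scale[OF has_derivative_linear[OF d]] by simp
    then show ?thesis using has_vector_derivative_at_within by blast
  qed
  from fundamental_theorem_of_calculus[OF _ this] show ?thesis by simp
qed

text \<open>Near a point of the hyperplane x.i = 0, let \<open>?A\<close> be the projection onto it.
  Since F vanishes at \<open>?A x\<close>, integrating its derivative along the segment from
  \<open>?A x\<close> to x gives F x as x.i times an integral of the i-th partial derivative. That
  integral is smooth in x, and on the hyperplane it is the partial derivative itself, which explains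
  the value chosen there.\<close>

lemma hadamard_divide:
  fixes F :: "'e::euclidean_space \<Rightarrow> real"
  assumes S: "open S" and F: "smooth_on S F" and i: "i \<in> Basis"
    and z: "\<And>x. x \<in> S \<Longrightarrow> x \<bullet> i = 0 \<Longrightarrow> F x = 0"
  shows "smooth_on S (\<lambda>x. if x \<bullet> i = 0 then frechet_derivative F (at x) i else F x / (x \<bullet> i))"
    (is "smooth_on S ?h")
proof (rule smooth_on_local)
  fix a assume a: "a \<in> S"
  show "\<exists>T. open T \<and> a \<in> T \<and> smooth_on T ?h"
  proof (cases "a \<bullet> i = 0")
    case False
    let ?T = "S \<inter> {x. x \<bullet> i \<noteq> 0}"
    have o: "open ?T" by (intro open_Int S open_Collect_neq continuous_intros)
    have "smooth_on ?T (\<lambda>x. F x / (x \<bullet> i))"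
      by (intro smooth_on_divide o smooth_on_subset[OF F] smooth_on_inner_left smooth_on_id) auto
    then have "smooth_on ?T ?h" by (subst smooth_on_cong[OF o]) auto
    then show ?thesis using o a False by blast
  next
    case True
    obtain r where r: "r > 0" "ball a r \<subseteq> S" using S a openE by blast
    let ?A = "\<lambda>x. x - (x \<bullet> i) *\<^sub>R i" and ?B = "\<lambda>x. (x \<bullet> i) *\<^sub>R i"
    \<comment> \<open>As a lies on the hyperplane, the projection does not increase the distance
      from a (Pythagoras), so with x the ball contains the whole segment.\<close>
    have sub: "?A x + t *\<^sub>R ?B x \<in> ball a r" if x: "x \<in> ball a r" and t: "0 \<le> t" "t \<le> 1" for x t
    proof -
      have "norm (?A x - a) \<le> norm (x - a)"
      proof -
        have e: "x - a = (?A x - a) + ?B x" by simp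
        have "orthogonal (?A x - a) (?B x)"
          using True i by (simp add: orthogonal_def inner_diff_left inner_diff_right inner_commute)
        then have "norm ((?A x - a) + ?B x) ^ 2 = norm (?A x - a) ^ 2 + norm (?B x) ^ 2"
          by (rule norm_add_Pythagorean)
        then have "norm (?A x - a) ^ 2 \<le> norm (x - a) ^ 2" unfolding e[symmetric] by (metis le_add_same_cancel1 zero_le_power2)
        then show ?thesis by (rule power2_le_imp_le) (rule norm_ge_zero)
      qed
      then have "?A x \<in> ball a r" using x by (simp add: dist_norm norm_minus_commute)
      then have "(1 - t) *\<^sub>R ?A x + t *\<^sub>R x \<in> ball a r"
        using x t by (intro convexD) (auto simp: convex_ball)
      moreover have "(1 - t) *\<^sub>R ?A x + t *\<^sub>R x = ?A x + t *\<^sub>R ?B x" by (simp add: algebra_simps)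
      ultimately show ?thesis by metis
    qed
    let ?G = "\<lambda>x. integral (cbox 0 1) (\<lambda>t. t ^ 0 * frechet_derivative F (at (?A x + t *\<^sub>R ?B x)) i)"
    have "smooth_on (ball a r) ?G" unfolding smooth_on_def
    proof
      fix k
      have dA: "(?A has_derivative ?A) (at x)" and dB: "(?B has_derivative ?B) (at x)" for x
        by (auto intro!: derivative_eq_intros)
      show "Ck_on k (ball a r) ?G"
        by (rule Ck_on_segment_integral[OF S open_ball convex_ball _ dA dB smooth_on_frechet_derivative[OF F]])
          (use sub r(2) in blast)
    qed
    moreover have "?G x = ?h x" if x: "x \<in> ball a r" for x
    proof (cases "x \<bullet> i = 0")
      case True
      then show ?thesis by simp
    next
      case False
      have "((\<lambda>t. frechet_derivative F (at (?A x + t *\<^sub>R ?B x)) (?B x)) has_integral F (?A x + ?B x) - F (?A x)) (cbox 0 1)"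
        by (rule segment_integral_derivative[OF F]) (use sub[OF x] r(2) in blast)
      then have "((\<lambda>t. (x \<bullet> i) * frechet_derivative F (at (?A x + t *\<^sub>R ?B x)) i) has_integral F (?A x + ?B x) - F (?A x)) (cbox 0 1)"
      proof (rule has_integral_eq[rotated])
        fix t :: real assume "t \<in> cbox 0 1"
        then have "?A x + t *\<^sub>R ?B x \<in> S" using sub[OF x, of t] r(2) by auto
        from has_derivative_linear[OF smooth_on_has_derivative[OF F this]]
        show "frechet_derivative F (at (?A x + t *\<^sub>R ?B x)) (?B x) =
          (x \<bullet> i) * frechet_derivative F (at (?A x + t *\<^sub>R ?B x)) i" by (simp add: linear_scale)
      qed
      moreover have "F (?A x) = 0"
        by (rule z) (use sub[OF x, of 0] r(2) i in \<open>auto simp: inner_diff_left\<close>)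
      ultimately have "((\<lambda>t. (x \<bullet> i) * frechet_derivative F (at (?A x + t *\<^sub>R ?B x)) i) has_integral F x) (cbox 0 1)"
        by simp
      then have "((\<lambda>t. (1 / (x \<bullet> i)) * ((x \<bullet> i) * frechet_derivative F (at (?A x + t *\<^sub>R ?B x)) i)) has_integral (1 / (x \<bullet> i)) * F x) (cbox 0 1)"
        by (rule has_integral_mult_right)
      then have "((\<lambda>t. frechet_derivative F (at (?A x + t *\<^sub>R ?B x)) i) has_integral F x / (x \<bullet> i)) (cbox 0 1)"
        using False by simp
      then show ?thesis using False by (simp add: integral_unique)
    qed
    ultimately have "smooth_on (ball a r) ?h" by (subst smooth_on_cong[OF open_ball, symmetric])
    then show ?thesis using r by (intro exI[of _ "ball a r"]) auto
  qed
qed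

text \<open>First-order expansion with smooth coefficients, from integration along the segments that
  start at the centre. It brings a function into a form that a derivation can evaluate by the
  product rule.\<close>

lemma hadamard_point:
  fixes F :: "'e::euclidean_space \<Rightarrow> real"
  assumes F: "smooth_on (ball a r) F"
  obtains G where "\<forall>i. smooth_on (ball a r) (G i)"
    "\<forall>x\<in>ball a r. F x = F a + (\<Sum>i\<in>Basis. ((x - a) \<bullet> i) * G i x)"
    "\<forall>i. G i a = frechet_derivative F (at a) i"
proof (rule that; intro allI ballI)
  let ?B = "\<lambda>x. x - a"
  let ?G = "\<lambda>i x. integral (cbox 0 1) (\<lambda>t. t ^ 0 * frechet_derivative F (at (a + t *\<^sub>R ?B x)) i)"
  have sub: "a + t *\<^sub>R (x - a) \<in> ball a r" if "x \<in> ball a r" "0 \<le> t" "t \<le> 1" for x t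
  proof -
    have "dist a (a + t *\<^sub>R (x - a)) = t * dist a x"
      using that(2) by (simp add: dist_norm norm_minus_commute)
    also have "\<dots> \<le> dist a x" using that mult_left_le_one_le[of "dist a x" t] by simp
    finally show ?thesis using that(1) by simp
  qed
  show "smooth_on (ball a r) (?G i)" for i unfolding smooth_on_def
  proof
    fix k
    show "Ck_on k (ball a r) (?G i)"
      by (rule Ck_on_segment_integral[where S = "ball a r" and A' = "\<lambda>_. 0" and B' = "\<lambda>x. x"])
        (use sub in \<open>auto intro!: derivative_eq_intros smooth_on_frechet_derivative[OF F]\<close>)
  qed
  show "?G i a = frechet_derivative F (at a) i" for i by simp
  show "F x = F a + (\<Sum>i\<in>Basis. (?B x \<bullet> i) * ?G i x)" if x: "x \<in> ball a r" for x
  proof -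
    have 1: "((\<lambda>t. frechet_derivative F (at (a + t *\<^sub>R ?B x)) (?B x)) has_integral F (a + ?B x) - F a) (cbox 0 1)"
      by (rule segment_integral_derivative[OF F]) (use sub[OF x] in blast)
    have cont: "continuous_on (cbox 0 1) (\<lambda>t. frechet_derivative F (at (a + t *\<^sub>R ?B x)) i)" for i
      by (rule continuous_on_compose2[OF smooth_on_imp_continuous_on[OF smooth_on_frechet_derivative[OF F]]])
        (use sub[OF x] in \<open>auto intro!: continuous_intros\<close>)
    have 2: "((\<lambda>t. \<Sum>i\<in>Basis. (?B x \<bullet> i) * frechet_derivative F (at (a + t *\<^sub>R ?B x)) i) has_integral
        (\<Sum>i\<in>Basis. (?B x \<bullet> i) * ?G i x)) (cbox 0 1)"
      using integrable_integral[OF integrable_continuous[OF cont]]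
      by (intro has_integral_sum has_integral_mult_right) auto
    have 3: "frechet_derivative F (at (a + t *\<^sub>R ?B x)) (?B x) =
       (\<Sum>i\<in>Basis. (?B x \<bullet> i) * frechet_derivative F (at (a + t *\<^sub>R ?B x)) i)" if "t \<in> cbox 0 1" for t
    proof -
      have "a + t *\<^sub>R ?B x \<in> ball a r" using sub[OF x, of t] that by auto
      from frechet_derivative_sum_Basis[OF smooth_on_has_derivative[OF F this], of "?B x"]
      show ?thesis by simp
    qed
    have "((\<lambda>t. frechet_derivative F (at (a + t *\<^sub>R ?B x)) (?B x)) has_integral
        (\<Sum>i\<in>Basis. (?B x \<bullet> i) * ?G i x)) (cbox 0 1)"
      by (rule has_integral_eq[OF _ 2], rule 3[symmetric])
    from has_integral_unique[OF this 1] show ?thesis by simp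
  qed
qed

section \<open>Functions and tangent vectors on manifolds\<close>


text \<open>Smoothness of a germ, tested in one chart. By \<open>smooth_transfer\<close> every chart
  of the maximal atlas gives the same notion; the pointwise form suits proofs by cases on the
  position of a point, and \<open>smooth_funs_on_iff\<close> leads back to the definition by whole
  chart images.\<close>

definition smooth_near :: "('m, 'e::euclidean_space) chart set \<Rightarrow> ('m \<Rightarrow> real) \<Rightarrow> 'm \<Rightarrow> bool" where
  "smooth_near \<A> f x \<longleftrightarrow> (\<exists>(U, \<phi>)\<in>\<A>. x \<in> U \<and>
     (\<exists>S. open S \<and> \<phi> x \<in> S \<and> S \<subseteq> \<phi> ` U \<and> smooth_on S (f \<circ> inv_into U \<phi>)))"

lemma is_chartD: "is_chart (U, \<phi>) \<Longrightarrow> inj_on \<phi> U" "is_chart (U, \<phi>) \<Longrightarrow> open (\<phi> ` U)"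
  by (auto simp: is_chart_def)

lemma compatibleD:
  assumes "compatible (U, \<phi>) (V, \<psi>)"
  shows "open (\<phi> ` (U \<inter> V))" "open (\<psi> ` (U \<inter> V))"
    "smooth_on (\<phi> ` (U \<inter> V)) (\<psi> \<circ> inv_into U \<phi>)" "smooth_on (\<psi> ` (U \<inter> V)) (\<phi> \<circ> inv_into V \<psi>)"
  using assms by (auto simp: compatible_def)

lemma compatible_sym: "compatible c c' \<Longrightarrow> compatible c' c"
  by (cases c; cases c') (auto simp: compatible_def Int_commute)

lemma open_image_transfer:
  assumes "inj_on \<phi> U" "inj_on \<psi> V" "compatible (U, \<phi>) (V, \<psi>)" "open (\<psi> ` (V \<inter> X))"
  shows "open (\<phi> ` (U \<inter> V \<inter> X))"
proof -
  have "\<phi> ` (U \<inter> V \<inter> X) = \<phi> ` (U \<inter> V) \<inter> (\<psi> \<circ> inv_into U \<phi>) -` (\<psi> ` (V \<inter> X))"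
    using assms(1,2) by (fastforce simp: inj_on_def inv_into_f_f)
  then show ?thesis
    using continuous_open_preimage[OF smooth_on_imp_continuous_on[OF compatibleD(3)]
        compatibleD(1) assms(4)] assms(3) by metis
qed

lemma smooth_transfer:
  assumes c: "is_chart (U, \<phi>)" "is_chart (V, \<psi>)" "compatible (U, \<phi>) (V, \<psi>)"
    and x: "x \<in> U" "x \<in> V" and S: "open S" "\<phi> x \<in> S"
    and f: "smooth_on S (f \<circ> inv_into U \<phi>)"
  shows "\<exists>S'. open S' \<and> \<psi> x \<in> S' \<and> S' \<subseteq> \<psi> ` V \<and> smooth_on S' (f \<circ> inv_into V \<psi>)"
proof -
  note inj = is_chartD(1)[OF c(1)] is_chartD(1)[OF c(2)]
  let ?T = "\<psi> ` (U \<inter> V)" and ?g = "\<phi> \<circ> inv_into V \<psi>"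
  let ?S = "?T \<inter> ?g -` S"
  note g = compatibleD[OF c(3)]
  have o: "open ?S"
    by (rule continuous_open_preimage[OF smooth_on_imp_continuous_on[OF g(4)] g(2) S(1)])
  have "smooth_on ?S (\<lambda>z. (f \<circ> inv_into U \<phi>) (?g z))"
    by (rule smooth_on_compose[OF o S(1) f smooth_on_subset[OF g(4)]]) auto
  moreover have "(f \<circ> inv_into U \<phi>) (?g z) = (f \<circ> inv_into V \<psi>) z" if "z \<in> ?S" for z
    using that inj by (auto simp: inv_into_f_f)
  ultimately have "smooth_on ?S (f \<circ> inv_into V \<psi>)" using smooth_on_eq[OF _ o] by blast
  moreover have "\<psi> x \<in> ?S" "?S \<subseteq> \<psi> ` V" using x S inj by (auto simp: inv_into_f_f)
  ultimately show ?thesis using o by blast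
qed

text \<open>The part of the theory that rests on smooth chart changes alone; it serves for M and,
  through the sublocale \<open>B\<close>, for the blowup.\<close>

locale chart_atlas =
  fixes \<A> :: "('m, 'e::euclidean_space) chart set"
  assumes charts: "c \<in> \<A> \<Longrightarrow> is_chart c"
    and compat: "c \<in> \<A> \<Longrightarrow> c' \<in> \<A> \<Longrightarrow> compatible c c'"
begin

abbreviation "opn \<equiv> openin (mtop \<A>)"

lemma topspace_mtop: "topspace (mtop \<A>) = points \<A>"
  unfolding mtop_def topology_generated_by_topspace points_def
  by (auto intro: open_UNIV) (metis IntI UNIV_I open_UNIV vimage_UNIV)

lemma chart_in_max: "c \<in> \<A> \<Longrightarrow> c \<in> max_atlas \<A>"
  using charts compat by (cases c) (auto simp: max_atlas_def points_def)

lemma maxD: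
  assumes "(U, \<phi>) \<in> max_atlas \<A>"
  shows "is_chart (U, \<phi>)" "inj_on \<phi> U" "open (\<phi> ` U)" "U \<subseteq> points \<A>"
    "(V, \<psi>) \<in> \<A> \<Longrightarrow> compatible (U, \<phi>) (V, \<psi>)"
  using assms by (auto simp: max_atlas_def is_chart_def)

lemma point_chart:
  assumes "x \<in> points \<A>"
  obtains U \<phi> where "(U, \<phi>) \<in> \<A>" "x \<in> U"
  using assms by (auto simp: points_def)

text \<open>Together with \<open>openin_mtopI\<close> this replaces the generated topology by a
  criterion: a set of points is open iff its image in each chart is. For a subbasic set the image is
  the preimage of an open set under a transition map.\<close>

lemma openin_imp_open_image_atlas:
  assumes "opn X" "(U, \<phi>) \<in> \<A>"
  shows "open (\<phi> ` (U \<inter> X))"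
proof -
  note U = charts[OF assms(2), THEN is_chartD(1)] charts[OF assms(2), THEN is_chartD(2)]
  have "generate_topology_on {U \<inter> \<phi> -` W |U \<phi> W. (U, \<phi>) \<in> \<A> \<and> open W} X"
    using assms(1) by (simp add: mtop_def openin_topology_generated_by_iff)
  then show ?thesis
  proof induction
    case Empty
    show ?case by simp
  next
    case (Int a b)
    have "\<phi> ` (U \<inter> (a \<inter> b)) = \<phi> ` (U \<inter> a) \<inter> \<phi> ` (U \<inter> b)"
      using U(1) by (auto simp: inj_on_def)
    then show ?case using Int by auto
  next
    case (UN K)
    have "\<phi> ` (U \<inter> \<Union>K) = (\<Union>k\<in>K. \<phi> ` (U \<inter> k))" by auto
    then show ?case using UN by auto
  next
    case (Basis s)
    then obtain V \<psi> W where s: "s = V \<inter> \<psi> -` W" "(V, \<psi>) \<in> \<A>" "open W" by blast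
    note c = compat[OF assms(2) s(2)]
    have "\<phi> ` (U \<inter> s) = \<phi> ` (U \<inter> V) \<inter> (\<psi> \<circ> inv_into U \<phi>) -` W"
      using U(1) s(1) by (fastforce simp: inv_into_f_f)
    then show ?case
      using continuous_open_preimage[OF smooth_on_imp_continuous_on[OF compatibleD(3)[OF c]]
          compatibleD(1)[OF c] s(3)] by simp
  qed
qed

lemma openin_mtopI:
  assumes "X \<subseteq> points \<A>" "\<And>U \<phi>. (U, \<phi>) \<in> \<A> \<Longrightarrow> open (\<phi> ` (U \<inter> X))"
  shows "opn X"
proof (subst openin_subopen, intro ballI)
  fix x assume "x \<in> X"
  then obtain U \<phi> where U: "(U, \<phi>) \<in> \<A>" "x \<in> U" using assms(1) point_chart by blast
  let ?T = "U \<inter> \<phi> -` (\<phi> ` (U \<inter> X))"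
  have "opn ?T" unfolding mtop_def
    by (rule topology_generated_by_Basis) (use U assms(2) in blast)
  moreover have "?T \<subseteq> X" using charts[OF U(1)] by (auto simp: is_chart_def inj_on_def)
  ultimately show "\<exists>T. opn T \<and> x \<in> T \<and> T \<subseteq> X" using U \<open>x \<in> X\<close> by blast
qed

lemma openin_imp_open_image:
  assumes "opn X" "(U, \<phi>) \<in> max_atlas \<A>"
  shows "open (\<phi> ` (U \<inter> X))"
proof -
  have "\<phi> ` (U \<inter> X) = (\<Union>(V, \<psi>)\<in>\<A>. \<phi> ` (U \<inter> V \<inter> X))"
    using maxD(4)[OF assms(2)] by (fastforce simp: points_def)
  moreover have "open (\<phi> ` (U \<inter> V \<inter> X))" if "(V, \<psi>) \<in> \<A>" for V \<psi>
    by (rule open_image_transfer[OF maxD(2)[OF assms(2)] _ maxD(5)[OF assms(2) that]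
          openin_imp_open_image_atlas[OF assms(1) that]])
       (use charts[OF that] in \<open>auto simp: is_chart_def\<close>)
  ultimately show ?thesis by auto
qed

lemma opn_chart_preimage:
  assumes "(U, \<phi>) \<in> max_atlas \<A>" "open W"
  shows "opn (U \<inter> \<phi> -` W)"
proof (rule openin_mtopI)
  show "U \<inter> \<phi> -` W \<subseteq> points \<A>" using maxD(4)[OF assms(1)] by auto
  fix V \<psi> assume V: "(V, \<psi>) \<in> \<A>"
  note c = maxD(5)[OF assms(1) V]
  have "\<psi> ` (V \<inter> (U \<inter> \<phi> -` W)) = \<psi> ` (U \<inter> V) \<inter> (\<phi> \<circ> inv_into V \<psi>) -` W"
    using charts[OF V] by (fastforce simp: inv_into_f_f is_chart_def)
  then show "open (\<psi> ` (V \<inter> (U \<inter> \<phi> -` W)))"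
    using continuous_open_preimage[OF smooth_on_imp_continuous_on[OF compatibleD(4)[OF c]]
          compatibleD(2)[OF c] assms(2)] by simp
qed

lemma opn_chart: "(U, \<phi>) \<in> max_atlas \<A> \<Longrightarrow> opn U"
  using opn_chart_preimage[of U \<phi> UNIV] by simp

lemma opn_subset: "opn W \<Longrightarrow> W \<subseteq> points \<A>"
  using openin_subset topspace_mtop by fastforce

lemma opn_points: "opn (points \<A>)"
  using openin_topspace[of "mtop \<A>"] by (simp add: topspace_mtop)

text \<open>Slice charts are taken from the maximal atlas. Two of its charts are compared near a
  given point by factoring through a chart of the atlas around that point.\<close>

lemma max_compat:
  assumes "(U, \<phi>) \<in> max_atlas \<A>" "(V, \<psi>) \<in> max_atlas \<A>"
  shows "compatible (U, \<phi>) (V, \<psi>)"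
proof -
  have *: "open (\<phi> ` (U \<inter> V)) \<and> smooth_on (\<phi> ` (U \<inter> V)) (\<psi> \<circ> inv_into U \<phi>)"
    if U: "(U, \<phi>) \<in> max_atlas \<A>" and V: "(V, \<psi>) \<in> max_atlas \<A>" for U V :: "'m set" and \<phi> \<psi>
  proof
    show "open (\<phi> ` (U \<inter> V))" by (rule openin_imp_open_image[OF opn_chart[OF V] U])
    show "smooth_on (\<phi> ` (U \<inter> V)) (\<psi> \<circ> inv_into U \<phi>)"
    proof (rule smooth_on_local)
      fix z assume "z \<in> \<phi> ` (U \<inter> V)"
      then obtain x where x: "z = \<phi> x" "x \<in> U" "x \<in> V" by blast
      then obtain V' \<kappa> where V': "(V', \<kappa>) \<in> \<A>" "x \<in> V'" using maxD(4)[OF U] point_chart by blast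
      note cU = compatibleD[OF maxD(5)[OF U V'(1)]] and cV = compatibleD[OF maxD(5)[OF V V'(1)]]
      note inj = maxD(2)[OF U] maxD(2)[OF V] maxD(2)[OF chart_in_max[OF V'(1)]]
      let ?S = "\<phi> ` (U \<inter> V') \<inter> (\<kappa> \<circ> inv_into U \<phi>) -` (\<kappa> ` (V \<inter> V'))"
      have o: "open ?S"
        by (rule continuous_open_preimage[OF smooth_on_imp_continuous_on[OF cU(3)] cU(1) cV(2)])
      have "smooth_on ?S (\<lambda>z. (\<psi> \<circ> inv_into V' \<kappa>) ((\<kappa> \<circ> inv_into U \<phi>) z))"
        by (rule smooth_on_compose[OF o cV(2) cV(4) smooth_on_subset[OF cU(3)]]) auto
      moreover have "(\<psi> \<circ> inv_into V' \<kappa>) ((\<kappa> \<circ> inv_into U \<phi>) z) = (\<psi> \<circ> inv_into U \<phi>) z" if "z \<in> ?S" for z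
        using that inj by (auto simp: inv_into_f_f inj_on_eq_iff)
      ultimately have "smooth_on ?S (\<psi> \<circ> inv_into U \<phi>)" using smooth_on_eq[OF _ o] by blast
      moreover have "z \<in> ?S" using x V' inj by (auto simp: inv_into_f_f)
      ultimately show "\<exists>T. open T \<and> z \<in> T \<and> smooth_on T (\<psi> \<circ> inv_into U \<phi>)" using o by blast
    qed
  qed
  show ?thesis using *[OF assms] *[OF assms(2,1)] by (auto simp: compatible_def Int_commute)
qed

lemma smooth_nearI:
  assumes "(V, \<psi>) \<in> max_atlas \<A>" "x \<in> V" "open S" "\<psi> x \<in> S" "smooth_on S (f \<circ> inv_into V \<psi>)"
  shows "smooth_near \<A> f x"
proof -
  obtain U \<phi> where U: "(U, \<phi>) \<in> \<A>" "x \<in> U" using maxD(4)[OF assms(1)] assms(2) point_chart by blast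
  from smooth_transfer[OF maxD(1)[OF assms(1)] charts[OF U(1)] maxD(5)[OF assms(1) U(1)] assms(2) U(2) assms(3-5)]
  show ?thesis unfolding smooth_near_def using U by auto
qed

lemma smooth_near_chart:
  assumes "smooth_near \<A> f x" "(V, \<psi>) \<in> max_atlas \<A>" "x \<in> V"
  obtains S where "open S" "\<psi> x \<in> S" "S \<subseteq> \<psi> ` V" "smooth_on S (f \<circ> inv_into V \<psi>)"
proof -
  obtain U \<phi> S where U: "(U, \<phi>) \<in> \<A>" "x \<in> U" "open S" "\<phi> x \<in> S" "smooth_on S (f \<circ> inv_into U \<phi>)"
    using assms(1) unfolding smooth_near_def by blast
  from smooth_transfer[OF charts[OF U(1)] maxD(1)[OF assms(2)] compatible_sym[OF maxD(5)[OF assms(2) U(1)]] U(2) assms(3) U(3-5)]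
  show ?thesis using that by blast
qed

lemma smooth_near_point: "smooth_near \<A> f x \<Longrightarrow> x \<in> points \<A>"
  by (auto simp: smooth_near_def points_def)

lemma smooth_near_opn:
  assumes "smooth_near \<A> f x"
  obtains X where "opn X" "x \<in> X" "\<And>y. y \<in> X \<Longrightarrow> smooth_near \<A> f y"
proof -
  obtain U \<phi> S where U: "(U, \<phi>) \<in> \<A>" "x \<in> U" "open S" "\<phi> x \<in> S" "smooth_on S (f \<circ> inv_into U \<phi>)"
    using assms(1) unfolding smooth_near_def by blast
  note m = chart_in_max[OF U(1)]
  show ?thesis
    by (rule that[of "U \<inter> \<phi> -` S"]) (use U in \<open>auto intro: opn_chart_preimage[OF m] smooth_nearI[OF m]\<close>)
qed

lemma smooth_near_cong:
  assumes "smooth_near \<A> f x" "opn X" "x \<in> X" "\<And>y. y \<in> X \<Longrightarrow> f y = g y"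
  shows "smooth_near \<A> g x"
proof -
  obtain U \<phi> where U: "(U, \<phi>) \<in> \<A>" "x \<in> U" using point_chart[OF smooth_near_point[OF assms(1)]] .
  note m = chart_in_max[OF U(1)]
  obtain S where S: "open S" "\<phi> x \<in> S" "S \<subseteq> \<phi> ` U" "smooth_on S (f \<circ> inv_into U \<phi>)"
    using smooth_near_chart[OF assms(1) m U(2)] .
  let ?S = "S \<inter> \<phi> ` (U \<inter> X)"
  have o: "open ?S" using S openin_imp_open_image[OF assms(2) m] by auto
  have "smooth_on ?S (f \<circ> inv_into U \<phi>)" using S smooth_on_subset by blast
  moreover have "(f \<circ> inv_into U \<phi>) z = (g \<circ> inv_into U \<phi>) z" if "z \<in> ?S" for z
    using that assms(4) maxD(2)[OF m] by (auto simp: inv_into_f_f)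
  ultimately have "smooth_on ?S (g \<circ> inv_into U \<phi>)" using smooth_on_eq[OF _ o] by blast
  then show ?thesis using smooth_nearI[OF m U(2) o] S U assms(3) by blast
qed

lemma smooth_near_common:
  assumes "smooth_near \<A> f x" "smooth_near \<A> g x"
  obtains U \<phi> S where "(U, \<phi>) \<in> \<A>" "x \<in> U" "open S" "\<phi> x \<in> S" "S \<subseteq> \<phi> ` U"
    "smooth_on S (f \<circ> inv_into U \<phi>)" "smooth_on S (g \<circ> inv_into U \<phi>)"
proof -
  obtain U \<phi> where U: "(U, \<phi>) \<in> \<A>" "x \<in> U" using point_chart[OF smooth_near_point[OF assms(1)]] .
  note m = chart_in_max[OF U(1)]
  obtain S where S: "open S" "\<phi> x \<in> S" "S \<subseteq> \<phi> ` U" "smooth_on S (f \<circ> inv_into U \<phi>)"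
    using smooth_near_chart[OF assms(1) m U(2)] .
  obtain T where T: "open T" "\<phi> x \<in> T" "T \<subseteq> \<phi> ` U" "smooth_on T (g \<circ> inv_into U \<phi>)"
    using smooth_near_chart[OF assms(2) m U(2)] .
  show ?thesis
    by (rule that[OF U, of "S \<inter> T"]) (use S T in \<open>auto intro: smooth_on_subset\<close>)
qed

lemma smooth_near_const:
  assumes "x \<in> points \<A>"
  shows "smooth_near \<A> (\<lambda>_. c) x"
proof -
  obtain U \<phi> where U: "(U, \<phi>) \<in> \<A>" "x \<in> U" using point_chart[OF assms] .
  show ?thesis
    by (rule smooth_nearI[OF chart_in_max[OF U(1)] U(2) open_UNIV]) (simp_all add: comp_def)
qed

lemma smooth_near_add:
  assumes "smooth_near \<A> f x" "smooth_near \<A> g x"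
  shows "smooth_near \<A> (\<lambda>x. f x + g x) x"
proof -
  obtain U \<phi> S where c: "(U, \<phi>) \<in> \<A>" "x \<in> U" "open S" "\<phi> x \<in> S" "S \<subseteq> \<phi> ` U"
    "smooth_on S (f \<circ> inv_into U \<phi>)" "smooth_on S (g \<circ> inv_into U \<phi>)"
    using smooth_near_common[OF assms] .
  show ?thesis
    using smooth_nearI[OF chart_in_max[OF c(1)] c(2-4), of "\<lambda>x. f x + g x"] smooth_on_add[OF c(3,6,7)]
    by (simp add: comp_def)
qed

lemma smooth_near_mult:
  assumes "smooth_near \<A> f x" "smooth_near \<A> g x"
  shows "smooth_near \<A> (\<lambda>x. f x * g x) x"
proof -
  obtain U \<phi> S where c: "(U, \<phi>) \<in> \<A>" "x \<in> U" "open S" "\<phi> x \<in> S" "S \<subseteq> \<phi> ` U"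
    "smooth_on S (f \<circ> inv_into U \<phi>)" "smooth_on S (g \<circ> inv_into U \<phi>)"
    using smooth_near_common[OF assms] .
  show ?thesis
    using smooth_nearI[OF chart_in_max[OF c(1)] c(2-4), of "\<lambda>x. f x * g x"] smooth_on_mult[OF c(3,6,7)]
    by (simp add: comp_def)
qed

lemma smooth_near_minus:
  assumes "smooth_near \<A> f x" "smooth_near \<A> g x"
  shows "smooth_near \<A> (\<lambda>x. f x - g x) x"
  using smooth_near_add[OF assms(1) smooth_near_mult[OF smooth_near_const[OF smooth_near_point[OF assms(2)]] assms(2)], of "- 1"]
  by simp

lemma smooth_near_sum:
  assumes "x \<in> points \<A>" "\<And>i. i \<in> I \<Longrightarrow> smooth_near \<A> (f i) x"
  shows "smooth_near \<A> (\<lambda>x. \<Sum>i\<in>I. f i x) x"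
proof (cases "finite I")
  case True
  then show ?thesis using assms
    by (induction I) (auto intro: smooth_near_add smooth_near_const)
qed (simp add: smooth_near_const[OF assms(1)])

lemma smooth_near_prod:
  assumes "x \<in> points \<A>" "\<And>i. i \<in> I \<Longrightarrow> smooth_near \<A> (f i) x"
  shows "smooth_near \<A> (\<lambda>x. \<Prod>i\<in>I. f i x) x"
proof (cases "finite I")
  case True
  then show ?thesis using assms
    by (induction I) (auto intro: smooth_near_mult smooth_near_const)
qed (simp add: smooth_near_const[OF assms(1)])

lemma smooth_near_continuous:
  assumes "smooth_near \<A> f x" "open V" "f x \<in> V"
  obtains X where "opn X" "x \<in> X" "\<And>y. y \<in> X \<Longrightarrow> f y \<in> V"
proof -
  obtain U \<phi> S where U: "(U, \<phi>) \<in> \<A>" "x \<in> U" "open S" "\<phi> x \<in> S" "S \<subseteq> \<phi> ` U" "smooth_on S (f \<circ> inv_into U \<phi>)"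
    using smooth_near_common[OF assms(1,1)] by metis
  note m = chart_in_max[OF U(1)]
  have o: "open (S \<inter> (f \<circ> inv_into U \<phi>) -` V)"
    by (rule continuous_open_preimage[OF smooth_on_imp_continuous_on[OF U(6)] U(3) assms(2)])
  show ?thesis
    by (rule that[OF opn_chart_preimage[OF m o]]) (use U assms(3) maxD(2)[OF m] in \<open>auto simp: inv_into_f_f\<close>)
qed

lemma smooth_near_inverse:
  assumes "smooth_near \<A> f x" "f x \<noteq> 0"
  shows "smooth_near \<A> (\<lambda>x. inverse (f x)) x"
proof -
  obtain U \<phi> S where c: "(U, \<phi>) \<in> \<A>" "x \<in> U" "open S" "\<phi> x \<in> S" "S \<subseteq> \<phi> ` U"
    "smooth_on S (f \<circ> inv_into U \<phi>)"
    using smooth_near_common[OF assms(1,1)] by metis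
  let ?T = "S \<inter> (f \<circ> inv_into U \<phi>) -` (- {0})"
  have o: "open ?T"
    by (rule continuous_open_preimage[OF smooth_on_imp_continuous_on[OF c(6)] c(3)]) auto
  have "smooth_on ?T (\<lambda>z. inverse ((f \<circ> inv_into U \<phi>) z))"
    by (rule smooth_on_inverse[OF o smooth_on_subset[OF c(6)]]) auto
  moreover have "\<phi> x \<in> ?T" using c assms(2) maxD(2)[OF chart_in_max[OF c(1)]] by (auto simp: inv_into_f_f)
  ultimately show ?thesis
    using smooth_nearI[OF chart_in_max[OF c(1)] c(2) o, of "\<lambda>x. inverse (f x)"] by (simp add: comp_def)
qed

lemma opn_smooth_preimage:
  assumes "opn W" "\<And>x. x \<in> W \<Longrightarrow> smooth_near \<A> f x" "open V"
  shows "opn {x \<in> W. f x \<in> V}"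
proof (subst openin_subopen, intro ballI)
  fix x assume x: "x \<in> {x \<in> W. f x \<in> V}"
  then obtain X where X: "opn X" "x \<in> X" "\<And>y. y \<in> X \<Longrightarrow> f y \<in> V"
    using smooth_near_continuous[OF assms(2) assms(3)] by blast
  show "\<exists>T. opn T \<and> x \<in> T \<and> T \<subseteq> {x \<in> W. f x \<in> V}"
    by (rule exI[of _ "X \<inter> W"]) (use X x assms(1) in auto)
qed

lemma smooth_funs_on_iff:
  assumes "opn W"
  shows "f \<in> smooth_funs_on \<A> W \<longleftrightarrow> (\<forall>x\<in>W. smooth_near \<A> f x)"
proof
  assume f: "f \<in> smooth_funs_on \<A> W"
  show "\<forall>x\<in>W. smooth_near \<A> f x"
  proof
    fix x assume x: "x \<in> W"
    then obtain U \<phi> where U: "(U, \<phi>) \<in> \<A>" "x \<in> U" using point_chart opn_subset[OF assms] by blast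
    show "smooth_near \<A> f x"
      by (rule smooth_nearI[OF chart_in_max[OF U(1)] U(2) openin_imp_open_image[OF assms chart_in_max[OF U(1)]]])
        (use f U x in \<open>auto simp: smooth_funs_on_def\<close>)
  qed
next
  assume f: "\<forall>x\<in>W. smooth_near \<A> f x"
  have "smooth_on (\<phi> ` (U \<inter> W)) (f \<circ> inv_into U \<phi>)" if U: "(U, \<phi>) \<in> \<A>" for U \<phi>
  proof (rule smooth_on_local)
    fix z assume "z \<in> \<phi> ` (U \<inter> W)"
    then obtain x where x: "z = \<phi> x" "x \<in> U" "x \<in> W" by blast
    then show "\<exists>T. open T \<and> z \<in> T \<and> smooth_on T (f \<circ> inv_into U \<phi>)"
      using smooth_near_chart[OF _ chart_in_max[OF U] x(2)] f by metis
  qed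
  then show "f \<in> smooth_funs_on \<A> W" by (auto simp: smooth_funs_on_def)
qed

lemma smooth_funs_iff: "f \<in> smooth_funs \<A> \<longleftrightarrow> (\<forall>x\<in>points \<A>. smooth_near \<A> f x)"
  by (rule smooth_funs_on_iff[OF opn_points])

lemma smooth_funs_nearD: "f \<in> smooth_funs \<A> \<Longrightarrow> x \<in> points \<A> \<Longrightarrow> smooth_near \<A> f x"
  using smooth_funs_iff by blast

lemma smooth_funs_const: "(\<lambda>_. c) \<in> smooth_funs \<A>"
  by (simp add: smooth_funs_iff smooth_near_const)

lemma smooth_funs_add: "f \<in> smooth_funs \<A> \<Longrightarrow> g \<in> smooth_funs \<A> \<Longrightarrow> (\<lambda>x. f x + g x) \<in> smooth_funs \<A>"
  by (simp add: smooth_funs_iff smooth_near_add)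

lemma smooth_funs_mult: "f \<in> smooth_funs \<A> \<Longrightarrow> g \<in> smooth_funs \<A> \<Longrightarrow> (\<lambda>x. f x * g x) \<in> smooth_funs \<A>"
  by (simp add: smooth_funs_iff smooth_near_mult)

lemma smooth_funs_minus: "f \<in> smooth_funs \<A> \<Longrightarrow> g \<in> smooth_funs \<A> \<Longrightarrow> (\<lambda>x. f x - g x) \<in> smooth_funs \<A>"
  by (simp add: smooth_funs_iff smooth_near_minus)

lemma smooth_funs_sum: "(\<And>i. i \<in> I \<Longrightarrow> f i \<in> smooth_funs \<A>) \<Longrightarrow> (\<lambda>x. \<Sum>i\<in>I. f i x) \<in> smooth_funs \<A>"
  by (simp add: smooth_funs_iff smooth_near_sum)

lemma smooth_funs_cong: "f \<in> smooth_funs \<A> \<Longrightarrow> (\<And>x. x \<in> points \<A> \<Longrightarrow> f x = g x) \<Longrightarrow> g \<in> smooth_funs \<A>"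
  unfolding smooth_funs_iff using smooth_near_cong[OF _ opn_points] by blast

lemma smooth_near_chart_fun:
  assumes "(U, \<phi>) \<in> max_atlas \<A>" "x \<in> U" "open S" "\<phi> x \<in> S" "smooth_on S F"
  shows "smooth_near \<A> (\<lambda>x. F (\<phi> x)) x"
proof (rule smooth_nearI[OF assms(1,2)])
  show o: "open (S \<inter> \<phi> ` U)" using assms(3) maxD(3)[OF assms(1)] by auto
  show "\<phi> x \<in> S \<inter> \<phi> ` U" using assms by auto
  have "smooth_on (S \<inter> \<phi> ` U) F" using assms(5) smooth_on_subset by blast
  then show "smooth_on (S \<inter> \<phi> ` U) ((\<lambda>x. F (\<phi> x)) \<circ> inv_into U \<phi>)"
    using smooth_on_cong[OF o, of F "(\<lambda>x. F (\<phi> x)) \<circ> inv_into U \<phi>"] by (auto simp: f_inv_into_f)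
qed

lemma smooth_near_coordinate:
  assumes "(U, \<phi>) \<in> max_atlas \<A>" "x \<in> U"
  shows "smooth_near \<A> (\<lambda>x. \<phi> x \<bullet> i) x"
  by (rule smooth_near_chart_fun[OF assms open_UNIV _ smooth_on_inner_left[OF open_UNIV smooth_on_id[OF open_UNIV]]]) simp

end

section \<open>Tangent vectors as derivations\<close>

lemma tangent_spaceD:
  assumes "v \<in> tangent_space \<A> x"
  shows "f \<notin> smooth_funs \<A> \<Longrightarrow> v f = 0"
    "f \<in> smooth_funs \<A> \<Longrightarrow> g \<in> smooth_funs \<A> \<Longrightarrow> v (\<lambda>z. c * f z + g z) = c * v f + v g"
    "f \<in> smooth_funs \<A> \<Longrightarrow> g \<in> smooth_funs \<A> \<Longrightarrow> v (\<lambda>z. f z * g z) = f x * v g + g x * v f"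
  using assms by (auto simp: tangent_space_def)

lemma tangent_space_lin:
  assumes "u \<in> tangent_space \<A> x" "v \<in> tangent_space \<A> x"
  shows "(\<lambda>f. c * u f + v f) \<in> tangent_space \<A> x"
  using assms unfolding tangent_space_def by (auto simp: algebra_simps)

lemma tangent_space_0: "(\<lambda>_. 0) \<in> tangent_space \<A> x"
  by (simp add: tangent_space_def)

context chart_atlas begin

lemma tangent_rules:
  assumes v: "v \<in> tangent_space \<A> x"
  shows "f \<in> smooth_funs \<A> \<Longrightarrow> g \<in> smooth_funs \<A> \<Longrightarrow> v (\<lambda>z. f z + g z) = v f + v g"
    "f \<in> smooth_funs \<A> \<Longrightarrow> g \<in> smooth_funs \<A> \<Longrightarrow> v (\<lambda>z. f z - g z) = v f - v g"
    "f \<in> smooth_funs \<A> \<Longrightarrow> v (\<lambda>z. c * f z) = c * v f"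
    "v (\<lambda>_. c) = 0"
proof -
  have 0: "v (\<lambda>_. 0) = 0"
    using tangent_spaceD(2)[OF v smooth_funs_const smooth_funs_const, of "- 1" 0 0] by simp
  \<comment> \<open>The product rule for 1 times 1 gives v 1 = v 1 + v 1.\<close>
  have 1: "v (\<lambda>_. 1) = 0"
    using tangent_spaceD(3)[OF v smooth_funs_const smooth_funs_const, of 1 1] by simp
  show "v (\<lambda>_. c) = 0" 
    using tangent_spaceD(2)[OF v smooth_funs_const smooth_funs_const, of c 1 0] 0 1 by simp
  show "f \<in> smooth_funs \<A> \<Longrightarrow> g \<in> smooth_funs \<A> \<Longrightarrow> v (\<lambda>z. f z + g z) = v f + v g"
    using tangent_spaceD(2)[OF v, of f g 1] by simp
  show "f \<in> smooth_funs \<A> \<Longrightarrow> g \<in> smooth_funs \<A> \<Longrightarrow> v (\<lambda>z. f z - g z) = v f - v g"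
    using tangent_spaceD(2)[OF v, of g f "- 1"] by simp
  show "f \<in> smooth_funs \<A> \<Longrightarrow> v (\<lambda>z. c * f z) = c * v f"
    using tangent_spaceD(2)[OF v _ smooth_funs_const, of f c 0] 0 by simp
qed

lemma tangent_sum:
  assumes v: "v \<in> tangent_space \<A> x" and "\<And>i. i \<in> I \<Longrightarrow> f i \<in> smooth_funs \<A>" "finite I"
  shows "v (\<lambda>z. \<Sum>i\<in>I. f i z) = (\<Sum>i\<in>I. v (f i))"
  using assms(3,2)
  by (induction I) (auto simp: tangent_rules[OF v] smooth_funs_sum)

text \<open>The cutoff annihilates f - g, and at x it is 1 while f - g is 0; so the product rule,
  applied to the zero function, leaves v (f - g) = 0. The cutoff is an argument of the lemma so that
  on the blowup one pulled back from M can be supplied.\<close>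

lemma tangent_local:
  assumes v: "v \<in> tangent_space \<A> x" and s: "f \<in> smooth_funs \<A>" "g \<in> smooth_funs \<A>" "\<kappa> \<in> smooth_funs \<A>"
    and "\<kappa> x = 1" "f x = g x" "\<And>z. \<kappa> z * (f z - g z) = 0"
  shows "v f = v g"
proof -
  have d: "(\<lambda>z. f z - g z) \<in> smooth_funs \<A>" by (rule smooth_funs_minus[OF s(1,2)])
  have "v (\<lambda>z. \<kappa> z * (f z - g z)) = \<kappa> x * v (\<lambda>z. f z - g z) + (f x - g x) * v \<kappa>"
    by (rule tangent_spaceD(3)[OF v s(3) d])
  moreover have "(\<lambda>z. \<kappa> z * (f z - g z)) = (\<lambda>_. 0)" using assms(7) by auto
  ultimately have "v (\<lambda>z. f z - g z) = 0" using assms(5,6) tangent_rules(4)[OF v, of 0] by simp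
  then show ?thesis using tangent_rules(2)[OF v s(1,2)] by simp
qed

end

locale hausdorff_atlas = chart_atlas \<A> for \<A> :: "('m, 'e::euclidean_space) chart set" +
  assumes hausdorff: "Hausdorff_space (mtop \<A>)"
begin

text \<open>\<open>K\<close> corresponds to a closed ball in a chart, so it is compact, and closed
  by the Hausdorff property. Closedness is what makes extension by zero smooth: the complement of
  \<open>K\<close> is an open set on which the function is 0.\<close>

lemma bump:
  assumes W: "opn W" "x \<in> W"
  obtains \<kappa> K X where "\<kappa> \<in> smooth_funs \<A>" "compactin (mtop \<A>) K" "closedin (mtop \<A>) K" "K \<subseteq> W"
    "opn X" "x \<in> X" "X \<subseteq> K" "\<And>y. y \<in> X \<Longrightarrow> \<kappa> y = 1" "\<And>y. y \<notin> K \<Longrightarrow> \<kappa> y = 0"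
proof -
  obtain U \<phi> where U: "(U, \<phi>) \<in> \<A>" "x \<in> U" using point_chart W opn_subset by blast
  note m = chart_in_max[OF U(1)]
  note inj = maxD(2)[OF m]
  have "open (\<phi> ` (U \<inter> W))" by (rule openin_imp_open_image[OF W(1) m])
  then obtain r where r: "r > 0" "cball (\<phi> x) r \<subseteq> \<phi> ` (U \<inter> W)"
    using U W open_contains_cball by blast
  obtain \<beta> :: "'e \<Rightarrow> real" where b: "smooth_on UNIV \<beta>"
    "\<And>z. dist (\<phi> x) z \<le> r / 2 \<Longrightarrow> \<beta> z = 1" "\<And>z. dist (\<phi> x) z \<ge> r \<Longrightarrow> \<beta> z = 0"
    using smooth_bump_exists[OF r(1)] by blast
  define \<kappa> where "\<kappa> y = (if y \<in> U then \<beta> (\<phi> y) else 0)" for y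
  define K where "K = inv_into U \<phi> ` cball (\<phi> x) r"
  define X where "X = U \<inter> \<phi> -` ball (\<phi> x) (r / 2)"
  have K: "K = U \<inter> \<phi> -` cball (\<phi> x) r"
  proof (intro set_eqI iffI)
    fix y assume "y \<in> K"
    then obtain z where z: "z \<in> cball (\<phi> x) r" "y = inv_into U \<phi> z" unfolding K_def by blast
    moreover have "z \<in> \<phi> ` U" using z r by blast
    ultimately show "y \<in> U \<inter> \<phi> -` cball (\<phi> x) r"
      by (auto simp: f_inv_into_f inv_into_into)
  next
    fix y assume "y \<in> U \<inter> \<phi> -` cball (\<phi> x) r"
    then show "y \<in> K" unfolding K_def using inv_into_f_f[OF inj, of y] by force
  qed
  have "continuous_map (top_of_set (\<phi> ` U)) (mtop \<A>) (inv_into U \<phi>)"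
    unfolding continuous_map_def
  proof (intro conjI allI impI)
    show "inv_into U \<phi> \<in> topspace (top_of_set (\<phi> ` U)) \<rightarrow> topspace (mtop \<A>)"
      using maxD(4)[OF m] by (auto simp: topspace_mtop inv_into_into)
    fix X assume X: "opn X"
    have "{z \<in> topspace (top_of_set (\<phi> ` U)). inv_into U \<phi> z \<in> X} = \<phi> ` (U \<inter> X)"
      using inj by (force simp: inv_into_f_f)
    then show "openin (top_of_set (\<phi> ` U)) {z \<in> topspace (top_of_set (\<phi> ` U)). inv_into U \<phi> z \<in> X}"
      using openin_imp_open_image[OF X m] open_openin_trans[of "\<phi> ` U" "\<phi> ` (U \<inter> X)"] maxD(3)[OF m] by auto
  qed
  then have comp: "compactin (mtop \<A>) K" unfolding K_def
    using r(2) by (intro image_compactin) (auto simp: compactin_subtopology)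
  then have clo: "closedin (mtop \<A>) K" using compactin_imp_closedin[OF hausdorff] by blast
  have 0: "\<kappa> y = 0" if "y \<notin> K" for y using that b(3) unfolding K \<kappa>_def by auto
  show ?thesis
  proof (rule that)
    show "\<kappa> \<in> smooth_funs \<A>" unfolding smooth_funs_iff
    proof
      fix y assume y: "y \<in> points \<A>"
      show "smooth_near \<A> \<kappa> y"
      proof (cases "y \<in> U")
        case True
        have "smooth_near \<A> (\<lambda>y. \<beta> (\<phi> y)) y"
          by (rule smooth_near_chart_fun[OF m True open_UNIV _ b(1)]) simp
        then show ?thesis by (rule smooth_near_cong[OF _ opn_chart[OF m] True]) (simp add: \<kappa>_def)
      next
        case False
        have "opn (points \<A> - K)" using clo topspace_mtop by (metis closedin_def)
        then show ?thesis
          by (rule smooth_near_cong[OF smooth_near_const[OF y, of 0]]) (use y False 0 in \<open>auto simp: K\<close>)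
      qed
    qed
    show "K \<subseteq> W" using r(2) inj unfolding K by (fastforce simp: inj_on_def)
    show "opn X" unfolding X_def by (rule opn_chart_preimage[OF m open_ball])
    show "x \<in> X" unfolding X_def using U r by auto
    show "X \<subseteq> K" unfolding X_def K using r by auto
    show "\<kappa> y = 1" if "y \<in> X" for y using that b(2) by (auto simp: X_def \<kappa>_def)
  qed (use comp clo 0 in auto)
qed

lemma opn_compl: "closedin (mtop \<A>) K \<Longrightarrow> opn (points \<A> - K)"
  using topspace_mtop by (metis closedin_def)

lemma cutoff:
  assumes "\<kappa> \<in> smooth_funs \<A>" "closedin (mtop \<A>) K" "\<And>y. y \<notin> K \<Longrightarrow> \<kappa> y = 0"
    and "\<And>y. y \<in> K \<Longrightarrow> smooth_near \<A> f y"
  shows "(\<lambda>y. \<kappa> y * f y) \<in> smooth_funs \<A>"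
  unfolding smooth_funs_iff
proof
  fix y assume y: "y \<in> points \<A>"
  show "smooth_near \<A> (\<lambda>y. \<kappa> y * f y) y"
  proof (cases "y \<in> K")
    case True
    then show ?thesis using smooth_near_mult smooth_funs_nearD[OF assms(1) y] assms(4) by blast
  next
    case False
    show ?thesis
      by (rule smooth_near_cong[OF smooth_near_const[OF y, of 0] opn_compl[OF assms(2)]])
        (use y False assms(3) in auto)
  qed
qed

text \<open>Tangent vectors act on global functions only; a function that is smooth near x is made
  global here without changing its germ.\<close>

lemma extend_germ:
  assumes "smooth_near \<A> f x"
  obtains g X where "g \<in> smooth_funs \<A>" "opn X" "x \<in> X" "\<And>y. y \<in> X \<Longrightarrow> g y = f y"
proof -
  obtain W where W: "opn W" "x \<in> W" "\<And>y. y \<in> W \<Longrightarrow> smooth_near \<A> f y"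
    using smooth_near_opn[OF assms] by blast
  obtain \<kappa> K X where b: "\<kappa> \<in> smooth_funs \<A>" "closedin (mtop \<A>) K" "K \<subseteq> W"
    "opn X" "x \<in> X" "\<And>y. y \<in> X \<Longrightarrow> \<kappa> y = 1" "\<And>y. y \<notin> K \<Longrightarrow> \<kappa> y = 0"
    using bump[OF W(1,2)] by metis
  show ?thesis
    by (rule that[of "\<lambda>y. \<kappa> y * f y" X]) (use b W cutoff[OF b(1,2,7), of f] in auto)
qed

lemma tangent_germ:
  assumes v: "v \<in> tangent_space \<A> x" and s: "f \<in> smooth_funs \<A>" "g \<in> smooth_funs \<A>"
    and X: "opn X" "x \<in> X" "\<And>y. y \<in> X \<Longrightarrow> f y = g y"
  shows "v f = v g"
proof -
  obtain \<kappa> K Y where b: "\<kappa> \<in> smooth_funs \<A>" "K \<subseteq> X"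
    "x \<in> Y" "\<And>y. y \<in> Y \<Longrightarrow> \<kappa> y = 1" "\<And>y. y \<notin> K \<Longrightarrow> \<kappa> y = 0"
    using bump[OF X(1,2)] by metis
  have "\<kappa> z * (f z - g z) = 0" for z using b(2,5) X(3) by (cases "z \<in> K") auto
  then show ?thesis using tangent_local[OF v s b(1)] b X by auto
qed

end

section \<open>Tangent vectors in coordinates\<close>

abbreviation chart_derivative ::
    "'m set \<Rightarrow> ('m \<Rightarrow> 'e::euclidean_space) \<Rightarrow> 'm \<Rightarrow> ('m \<Rightarrow> real) \<Rightarrow> 'e \<Rightarrow> real" where
  "chart_derivative U \<phi> x f w \<equiv> frechet_derivative (f \<circ> inv_into U \<phi>) (at (\<phi> x)) w"

context chart_atlas begin

lemma chart_derivative_has_derivative: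
  assumes "smooth_near \<A> f x" "(U, \<phi>) \<in> max_atlas \<A>" "x \<in> U"
  shows "((f \<circ> inv_into U \<phi>) has_derivative chart_derivative U \<phi> x f) (at (\<phi> x))"
  using smooth_near_chart[OF assms] smooth_on_has_derivative by metis

lemma chart_derivative_rules:
  assumes f: "smooth_near \<A> f x" and g: "smooth_near \<A> g x" and U: "(U, \<phi>) \<in> max_atlas \<A>" "x \<in> U"
  shows "chart_derivative U \<phi> x (\<lambda>z. c * f z + g z) w = c * chart_derivative U \<phi> x f w + chart_derivative U \<phi> x g w"
    "chart_derivative U \<phi> x (\<lambda>z. f z * g z) w = f x * chart_derivative U \<phi> x g w + g x * chart_derivative U \<phi> x f w"
proof -
  note d = chart_derivative_has_derivative[OF f U] chart_derivative_has_derivative[OF g U]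
  have "((\<lambda>z. c * (f \<circ> inv_into U \<phi>) z + (g \<circ> inv_into U \<phi>) z) has_derivative
      (\<lambda>w. c * chart_derivative U \<phi> x f w + chart_derivative U \<phi> x g w)) (at (\<phi> x))"
    by (intro derivative_intros d)
  from frechet_derivative_at[OF this]
  show "chart_derivative U \<phi> x (\<lambda>z. c * f z + g z) w = c * chart_derivative U \<phi> x f w + chart_derivative U \<phi> x g w"
    by (simp add: comp_def fun_eq_iff)
  have "((\<lambda>z. (f \<circ> inv_into U \<phi>) z * (g \<circ> inv_into U \<phi>) z) has_derivative
      (\<lambda>w. (f \<circ> inv_into U \<phi>) (\<phi> x) * chart_derivative U \<phi> x g w + chart_derivative U \<phi> x f w * (g \<circ> inv_into U \<phi>) (\<phi> x))) (at (\<phi> x))"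
    by (intro derivative_intros d)
  from frechet_derivative_at[OF this]
  show "chart_derivative U \<phi> x (\<lambda>z. f z * g z) w = f x * chart_derivative U \<phi> x g w + g x * chart_derivative U \<phi> x f w"
    using maxD(2)[OF U(1)] U(2) by (simp add: comp_def fun_eq_iff inv_into_f_f mult.commute)
qed

text \<open>Inverse of \<open>coords\<close>; the value 0 on functions that are not smooth is the
  convention of \<open>tangent_space\<close>.\<close>

definition tangent_of_coords :: "'m set \<Rightarrow> ('m \<Rightarrow> 'e) \<Rightarrow> 'm \<Rightarrow> 'e \<Rightarrow> 'm tangent" where
  "tangent_of_coords U \<phi> x w = (\<lambda>f. if f \<in> smooth_funs \<A> then chart_derivative U \<phi> x f w else 0)"

lemma tangent_of_coords_in:
  assumes "(U, \<phi>) \<in> max_atlas \<A>" "x \<in> U"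
  shows "tangent_of_coords U \<phi> x w \<in> tangent_space \<A> x"
proof -
  have x: "x \<in> points \<A>" using maxD(4)[OF assms(1)] assms(2) by blast
  have s: "(\<lambda>z. c * f z + g z) \<in> smooth_funs \<A>" if "f \<in> smooth_funs \<A>" "g \<in> smooth_funs \<A>" for f g c
    using that smooth_funs_add smooth_funs_mult[OF smooth_funs_const] by simp
  show ?thesis
    unfolding tangent_space_def tangent_of_coords_def
    using chart_derivative_rules[OF smooth_funs_nearD[OF _ x] smooth_funs_nearD[OF _ x] assms]
    by (auto simp: s smooth_funs_mult)
qed

end

context hausdorff_atlas begin

text \<open>Coordinate functions made global, so that tangent vectors can act on them. The last
  clause serves slice charts: a cut normal coordinate vanishes on all of N, outside the chart as
  well.\<close>

lemma cut_coordinate: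
  assumes "(U, \<phi>) \<in> max_atlas \<A>" "x \<in> U"
  obtains \<zeta> X where "\<forall>i. \<zeta> i \<in> smooth_funs \<A>" "opn X" "x \<in> X" "X \<subseteq> U" "\<forall>y\<in>X. \<forall>i. \<zeta> i y = \<phi> y \<bullet> i"
    "\<forall>y i. \<zeta> i y \<noteq> 0 \<longrightarrow> y \<in> U \<and> \<phi> y \<bullet> i \<noteq> 0"
proof -
  obtain \<kappa> K X where b: "\<kappa> \<in> smooth_funs \<A>" "closedin (mtop \<A>) K" "K \<subseteq> U" "X \<subseteq> K"
    "opn X" "x \<in> X" "\<And>y. y \<in> X \<Longrightarrow> \<kappa> y = 1" "\<And>y. y \<notin> K \<Longrightarrow> \<kappa> y = 0"
    using bump[OF opn_chart[OF assms(1)] assms(2)] by metis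
  show ?thesis
  proof (rule that[of "\<lambda>i y. \<kappa> y * (\<phi> y \<bullet> i)" X])
    show "\<forall>i. (\<lambda>y. \<kappa> y * (\<phi> y \<bullet> i)) \<in> smooth_funs \<A>"
      by (intro allI, rule cutoff[OF b(1,2,8)]) (use smooth_near_coordinate[OF assms(1)] b(3) in blast)+
  qed (use b in auto)
qed

text \<open>By \<open>hadamard_point\<close>, f is near x the sum of the constant f x and of
  products of two global functions, one of which vanishes at x. On such a product a derivation sees
  only its value on the coordinate factor times the value of the other factor at x, which is a
  partial derivative.\<close>

lemma tangent_repr:
  assumes U: "(U, \<phi>) \<in> max_atlas \<A>" "x \<in> U" and v: "v \<in> tangent_space \<A> x"
  shows "\<exists>w. \<forall>f\<in>smooth_funs \<A>. v f = chart_derivative U \<phi> x f w"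
proof -
  obtain \<zeta> Y where *: "\<forall>i. \<zeta> i \<in> smooth_funs \<A>" "opn Y" "x \<in> Y" "Y \<subseteq> U" "\<forall>y\<in>Y. \<forall>i. \<zeta> i y = \<phi> y \<bullet> i"
    by (rule cut_coordinate[OF U]) (rule that)
  note z = *(1)[rule_format] *(2-4) *(5)[rule_format]
  define w where "w = (\<Sum>i\<in>Basis. v (\<zeta> i) *\<^sub>R i)"
  have x: "x \<in> points \<A>" using maxD(4)[OF U(1)] U(2) by blast
  show ?thesis
  proof (intro exI ballI)
    fix f assume f: "f \<in> smooth_funs \<A>"
    obtain S where S: "open S" "\<phi> x \<in> S" "S \<subseteq> \<phi> ` U" "smooth_on S (f \<circ> inv_into U \<phi>)"
      using smooth_near_chart[OF smooth_funs_nearD[OF f x] U] .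
    have "open (S \<inter> \<phi> ` (U \<inter> Y))" using S openin_imp_open_image[OF z(2) U(1)] by auto
    moreover have "\<phi> x \<in> S \<inter> \<phi> ` (U \<inter> Y)" using S(2) U(2) z(3) by blast
    ultimately obtain r where r: "r > 0" "ball (\<phi> x) r \<subseteq> S \<inter> \<phi> ` (U \<inter> Y)"
      using openE by blast
    let ?F = "f \<circ> inv_into U \<phi>"
    have "smooth_on (ball (\<phi> x) r) ?F" using S(4) r(2) smooth_on_subset by blast
    then obtain G where *: "\<forall>i. smooth_on (ball (\<phi> x) r) (G i)"
      "\<forall>z\<in>ball (\<phi> x) r. ?F z = ?F (\<phi> x) + (\<Sum>i\<in>Basis. ((z - \<phi> x) \<bullet> i) * G i z)"
      "\<forall>i. G i (\<phi> x) = frechet_derivative ?F (at (\<phi> x)) i" by (rule hadamard_point) (rule that)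
    note G = *(1)[rule_format] *(2)[rule_format] *(3)[rule_format]
    \<comment> \<open>The support of the cutoff is kept inside the ball on which the expansion
      holds; that ball was chosen so that the cut coordinates are the true ones there.\<close>
    let ?W = "U \<inter> \<phi> -` ball (\<phi> x) r"
    have "x \<in> ?W" using U r by auto
    then obtain \<kappa> K X where b: "\<kappa> \<in> smooth_funs \<A>" "closedin (mtop \<A>) K" "K \<subseteq> ?W"
      "opn X" "x \<in> X" "X \<subseteq> K" "\<And>y. y \<in> X \<Longrightarrow> \<kappa> y = 1" "\<And>y. y \<notin> K \<Longrightarrow> \<kappa> y = 0"
      using bump[OF opn_chart_preimage[OF U(1) open_ball]] by metis
    define H where "H i y = \<kappa> y * G i (\<phi> y)" for i y
    have H: "H i \<in> smooth_funs \<A>" for i unfolding H_def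
      by (rule cutoff[OF b(1,2,8)]) (use b(3) smooth_near_chart_fun[OF U(1) _ open_ball _ G(1)] in blast)+
    let ?g = "\<lambda>y. f x + (\<Sum>i\<in>Basis. (\<zeta> i y - \<phi> x \<bullet> i) * H i y)"
    have sg: "(\<lambda>y. (\<zeta> i y - \<phi> x \<bullet> i) * H i y) \<in> smooth_funs \<A>" for i
      by (intro smooth_funs_mult smooth_funs_minus z(1) smooth_funs_const H)
    have "v f = v ?g"
    proof (rule tangent_germ[OF v f])
      show "?g \<in> smooth_funs \<A>" by (intro smooth_funs_add smooth_funs_const smooth_funs_sum sg)
      show "opn X" "x \<in> X" by (rule b)+
      fix y assume y: "y \<in> X"
      then have yW: "y \<in> U" "\<phi> y \<in> ball (\<phi> x) r" using b by auto
      then have "\<phi> y \<in> \<phi> ` (U \<inter> Y)" using r by blast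
      then have "y \<in> Y" using yW maxD(2)[OF U(1)] by (auto simp: inj_on_def)
      then show "f y = ?g y" using G(2)[OF yW(2)] yW(1) U(2) z(5) b(7)[OF y] maxD(2)[OF U(1)]
        by (simp add: H_def inv_into_f_f inner_diff_left)
    qed
    also have "\<dots> = (\<Sum>i\<in>Basis. v (\<lambda>y. (\<zeta> i y - \<phi> x \<bullet> i) * H i y))"
      using sg by (simp add: tangent_rules[OF v] smooth_funs_const smooth_funs_sum tangent_sum[OF v])
    also have "\<dots> = (\<Sum>i\<in>Basis. (w \<bullet> i) * frechet_derivative ?F (at (\<phi> x)) i)"
    proof (rule sum.cong)
      fix i :: 'e assume i: "i \<in> Basis"
      have "v (\<lambda>y. (\<zeta> i y - \<phi> x \<bullet> i) * H i y) = (\<zeta> i x - \<phi> x \<bullet> i) * v (H i) + H i x * v (\<lambda>y. \<zeta> i y - \<phi> x \<bullet> i)"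
        by (intro tangent_spaceD(3)[OF v] smooth_funs_minus z(1) smooth_funs_const H)
      also have "\<dots> = H i x * v (\<zeta> i)"
        by (simp add: z(3,5) tangent_rules[OF v] z(1) smooth_funs_const)
      also have "\<dots> = (w \<bullet> i) * frechet_derivative ?F (at (\<phi> x)) i"
        using i b(5,7) by (simp add: H_def G(3) w_def inner_sum_left_Basis)
      finally show "v (\<lambda>y. (\<zeta> i y - \<phi> x \<bullet> i) * H i y) = (w \<bullet> i) * frechet_derivative ?F (at (\<phi> x)) i" .
    qed simp
    also have "\<dots> = chart_derivative U \<phi> x f w"
      using frechet_derivative_sum_Basis[OF chart_derivative_has_derivative[OF smooth_funs_nearD[OF f x] U], of w]
      by simp
    finally show "v f = chart_derivative U \<phi> x f w" .
  qed
qed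

lemma chart_derivative_coordinate:
  assumes U: "(U, \<phi>) \<in> max_atlas \<A>" "x \<in> U" and X: "opn X" "x \<in> X" "X \<subseteq> U" "\<And>y. y \<in> X \<Longrightarrow> \<zeta> y = \<phi> y \<bullet> i"
  shows "chart_derivative U \<phi> x \<zeta> w = w \<bullet> i"
proof -
  have "((\<lambda>z. z \<bullet> i) has_derivative (\<lambda>w. w \<bullet> i)) (at (\<phi> x))" by (auto intro!: derivative_eq_intros)
  moreover have "((\<zeta> \<circ> inv_into U \<phi>) has_derivative (\<lambda>w. w \<bullet> i)) (at (\<phi> x))"
    using calculation
    by (rule has_derivative_transform_within_open[OF _ openin_imp_open_image[OF X(1) U(1)]])
      (use U X maxD(2)[OF U(1)] in \<open>auto simp: inv_into_f_f\<close>)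
  ultimately show ?thesis using frechet_derivative_at by metis
qed

text \<open>The cut coordinate functions recover the components of the vector; this justifies the
  \<open>THE\<close> in \<open>coords\<close>.\<close>

lemma coords_unique:
  assumes U: "(U, \<phi>) \<in> max_atlas \<A>" "x \<in> U"
    and "\<forall>f\<in>smooth_funs \<A>. chart_derivative U \<phi> x f w = chart_derivative U \<phi> x f w'"
  shows "w = w'"
proof -
  obtain \<zeta> Y where *: "\<forall>i. \<zeta> i \<in> smooth_funs \<A>" "opn Y" "x \<in> Y" "Y \<subseteq> U" "\<forall>y\<in>Y. \<forall>i. \<zeta> i y = \<phi> y \<bullet> i"
    by (rule cut_coordinate[OF U]) (rule that)
  note z = *(1)[rule_format] *(2-4) *(5)[rule_format]
  show ?thesis
  proof (rule euclidean_eqI)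
    fix i :: 'e
    have "chart_derivative U \<phi> x (\<zeta> i) w = chart_derivative U \<phi> x (\<zeta> i) w'" using assms(3) z(1) by blast
    then show "w \<bullet> i = w' \<bullet> i" by (simp add: chart_derivative_coordinate[OF U z(2-4), OF z(5)])
  qed
qed

lemma coords_eq:
  assumes U: "(U, \<phi>) \<in> max_atlas \<A>" "x \<in> U" and v: "v \<in> tangent_space \<A> x" and f: "f \<in> smooth_funs \<A>"
  shows "v f = chart_derivative U \<phi> x f (coords \<A> (U, \<phi>) x v)"
proof -
  obtain w where w: "\<forall>f\<in>smooth_funs \<A>. v f = chart_derivative U \<phi> x f w"
    using tangent_repr[OF U v] by blast
  have "coords \<A> (U, \<phi>) x v = w" unfolding coords_def using w coords_unique[OF U]
    by (auto intro!: the_equality)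
  then show ?thesis using w f by simp
qed

lemma coordsI:
  assumes U: "(U, \<phi>) \<in> max_atlas \<A>" "x \<in> U" and v: "v \<in> tangent_space \<A> x"
    and "\<And>f. f \<in> smooth_funs \<A> \<Longrightarrow> v f = chart_derivative U \<phi> x f w"
  shows "coords \<A> (U, \<phi>) x v = w"
  using coords_eq[OF U v] assms(4) coords_unique[OF U] by metis

lemma coords_tangent_of_coords:
  assumes "(U, \<phi>) \<in> max_atlas \<A>" "x \<in> U"
  shows "coords \<A> (U, \<phi>) x (tangent_of_coords U \<phi> x w) = w"
  by (rule coordsI[OF assms tangent_of_coords_in[OF assms]]) (simp add: tangent_of_coords_def)

lemma coords_lin:
  assumes U: "(U, \<phi>) \<in> max_atlas \<A>" "x \<in> U" and u: "u \<in> tangent_space \<A> x" and v: "v \<in> tangent_space \<A> x"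
  shows "coords \<A> (U, \<phi>) x (\<lambda>f. c * u f + v f) = c *\<^sub>R coords \<A> (U, \<phi>) x u + coords \<A> (U, \<phi>) x v"
proof (rule coordsI[OF U tangent_space_lin[OF u v]])
  fix f assume f: "f \<in> smooth_funs \<A>"
  have x: "x \<in> points \<A>" using maxD(4)[OF U(1)] U(2) by blast
  have "linear (chart_derivative U \<phi> x f)"
    using chart_derivative_has_derivative[OF smooth_funs_nearD[OF f x] U] has_derivative_linear by blast
  then show "c * u f + v f = chart_derivative U \<phi> x f (c *\<^sub>R coords \<A> (U, \<phi>) x u + coords \<A> (U, \<phi>) x v)"
    by (simp add: linear_add linear_scale coords_eq[OF U u f] coords_eq[OF U v f])
qed

lemma coords_component:
  assumes U: "(U, \<phi>) \<in> max_atlas \<A>" "x \<in> U" and v: "v \<in> tangent_space \<A> x" and z: "\<zeta> \<in> smooth_funs \<A>"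
    and X: "opn X" "x \<in> X" "X \<subseteq> U" "\<And>y. y \<in> X \<Longrightarrow> \<zeta> y = \<phi> y \<bullet> i"
  shows "coords \<A> (U, \<phi>) x v \<bullet> i = v \<zeta>"
  using coords_eq[OF U v z] chart_derivative_coordinate[OF U X] by simp

text \<open>The chain rule for the two local expressions of f. It decides how representatives of
  normal lines transform between slice charts.\<close>

lemma coords_change:
  assumes U: "(U, \<phi>) \<in> max_atlas \<A>" "x \<in> U" and V: "(V, \<psi>) \<in> max_atlas \<A>" "x \<in> V"
    and v: "v \<in> tangent_space \<A> x"
  shows "coords \<A> (V, \<psi>) x v = frechet_derivative (\<psi> \<circ> inv_into U \<phi>) (at (\<phi> x)) (coords \<A> (U, \<phi>) x v)"
proof (rule coordsI[OF V v])
  fix f assume f: "f \<in> smooth_funs \<A>"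
  have x: "x \<in> points \<A>" using maxD(4)[OF U(1)] U(2) by blast
  note inj = maxD(2)[OF U(1)] maxD(2)[OF V(1)]
  note c = compatibleD[OF max_compat[OF U(1) V(1)]]
  let ?D = "frechet_derivative (\<psi> \<circ> inv_into U \<phi>) (at (\<phi> x))"
  have 1: "((\<psi> \<circ> inv_into U \<phi>) has_derivative ?D) (at (\<phi> x))"
    by (rule smooth_on_has_derivative[OF c(3)]) (use U V in auto)
  have "((f \<circ> inv_into V \<psi>) has_derivative chart_derivative V \<psi> x f) (at ((\<psi> \<circ> inv_into U \<phi>) (\<phi> x)))"
    using chart_derivative_has_derivative[OF smooth_funs_nearD[OF f x] V] U inj by (simp add: inv_into_f_f)
  from has_derivative_compose[OF 1 this]
  have "((\<lambda>z. (f \<circ> inv_into V \<psi>) ((\<psi> \<circ> inv_into U \<phi>) z)) has_derivative (\<lambda>w. chart_derivative V \<psi> x f (?D w))) (at (\<phi> x))" .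
  then have "((f \<circ> inv_into U \<phi>) has_derivative (\<lambda>w. chart_derivative V \<psi> x f (?D w))) (at (\<phi> x))"
    by (rule has_derivative_transform_within_open[OF _ c(1)]) (use U V inj in \<open>auto simp: inv_into_f_f\<close>)
  then show "v f = chart_derivative V \<psi> x f (?D (coords \<A> (U, \<phi>) x v))"
    unfolding coords_eq[OF U v f] using frechet_derivative_at by metis
qed

text \<open>Forwards, the cut normal coordinates vanish on N and read off the normal components of
  v. Backwards, a function vanishing on N is 0 along the coordinate lines in the directions of
  \<open>D\<close>, which near y stay in N, so its partial derivatives in those directions
  vanish.\<close>

lemma sub_tangent_iff:
  assumes sl: "slice_chart \<A> N U \<phi> D" and y: "y \<in> U" "y \<in> N" and v: "v \<in> tangent_space \<A> y"
  shows "v \<in> sub_tangent_space \<A> N y \<longleftrightarrow> (\<forall>i\<in>Basis - D. coords \<A> (U, \<phi>) y v \<bullet> i = 0)"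
proof
  have U: "(U, \<phi>) \<in> max_atlas \<A>" and D: "D \<subseteq> Basis" and UN: "U \<inter> N = {x \<in> U. \<forall>i\<in>Basis - D. \<phi> x \<bullet> i = 0}"
    using sl by (auto simp: slice_chart_def)
  {
    assume vs: "v \<in> sub_tangent_space \<A> N y"
    obtain \<zeta> Y where *: "\<forall>i. \<zeta> i \<in> smooth_funs \<A>" "opn Y" "y \<in> Y" "Y \<subseteq> U" "\<forall>y\<in>Y. \<forall>i. \<zeta> i y = \<phi> y \<bullet> i"
      "\<forall>y i. \<zeta> i y \<noteq> 0 \<longrightarrow> y \<in> U \<and> \<phi> y \<bullet> i \<noteq> 0"
      by (rule cut_coordinate[OF U y(1)]) (rule that)
    note z = *(1)[rule_format] *(2-4) *(5)[rule_format] *(6)[rule_format]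
    show "\<forall>i\<in>Basis - D. coords \<A> (U, \<phi>) y v \<bullet> i = 0"
    proof
      fix i assume i: "i \<in> Basis - D"
      have "\<zeta> i z = 0" if "z \<in> N" for z using z(6)[of i z] UN i that by auto
      then have "v (\<zeta> i) = 0" using vs z(1) by (auto simp: sub_tangent_space_def)
      then show "coords \<A> (U, \<phi>) y v \<bullet> i = 0" using coords_component[OF U y(1) v z(1-4), OF z(5)] by simp
    qed
  }
  assume 0: "\<forall>i\<in>Basis - D. coords \<A> (U, \<phi>) y v \<bullet> i = 0"
  have "v f = 0" if f: "f \<in> smooth_funs \<A>" "\<forall>z\<in>N. f z = 0" for f
  proof -
    have yp: "y \<in> points \<A>" using maxD(4)[OF U] y by blast
    note d = chart_derivative_has_derivative[OF smooth_funs_nearD[OF f(1) yp] U y(1)]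
    have "chart_derivative U \<phi> y f j = 0" if j: "j \<in> D" for j
    proof -
      have "((\<lambda>t::real. \<phi> y + t *\<^sub>R j) has_derivative (\<lambda>t. t *\<^sub>R j)) (at 0)"
        by (auto intro!: derivative_eq_intros)
      moreover have "((f \<circ> inv_into U \<phi>) has_derivative chart_derivative U \<phi> y f) (at (\<phi> y + 0 *\<^sub>R j))" using d by simp
      ultimately have 1: "((\<lambda>t. (f \<circ> inv_into U \<phi>) (\<phi> y + t *\<^sub>R j)) has_derivative (\<lambda>t. chart_derivative U \<phi> y f (t *\<^sub>R j))) (at 0)"
        by (rule has_derivative_compose)
      \<comment> \<open>The line stays in the chart only for some t, so the comparison with 0 is
        made on an open set of parameters around 0.\<close>
      let ?T = "(\<lambda>t::real. \<phi> y + t *\<^sub>R j) -` (\<phi> ` U)"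
      have oT: "open ?T" by (intro open_vimage maxD(3)[OF U] continuous_intros)
      have 0: "(f \<circ> inv_into U \<phi>) (\<phi> y + t *\<^sub>R j) = 0" if t: "t \<in> ?T" for t
      proof -
        obtain x where x: "x \<in> U" "\<phi> y + t *\<^sub>R j = \<phi> x" using t by auto
        have "\<phi> x \<bullet> i = 0" if i: "i \<in> Basis - D" for i
        proof -
          have "\<phi> y \<bullet> i = 0" using UN y i by blast
          moreover have "j \<bullet> i = 0" using i j D by (intro inner_not_same_Basis) auto
          ultimately show ?thesis by (simp add: x(2)[symmetric] inner_add_left)
        qed
        then have "x \<in> N" using UN x(1) by auto
        then show ?thesis using x f(2) maxD(2)[OF U] by (simp add: inv_into_f_f)
      qed
      have "((\<lambda>t. 0::real) has_derivative (\<lambda>t. chart_derivative U \<phi> y f (t *\<^sub>R j))) (at 0)"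
        by (rule has_derivative_transform_within_open[OF 1 oT]) (use y 0 in auto)
      moreover have "((\<lambda>t::real. 0::real) has_derivative (\<lambda>t. 0)) (at 0)" by simp
      ultimately have "(\<lambda>t. chart_derivative U \<phi> y f (t *\<^sub>R j)) = (\<lambda>t. 0)" by (rule has_derivative_unique)
      from fun_cong[OF this, of 1] show ?thesis by simp
    qed
    then show "v f = 0"
      unfolding coords_eq[OF U y(1) v f(1)] frechet_derivative_sum_Basis[OF d, of "coords \<A> (U, \<phi>) y v"]
      using 0 by (intro sum.neutral) auto
  qed
  then show "v \<in> sub_tangent_space \<A> N y" using v by (auto simp: sub_tangent_space_def)
qed

end

section \<open>Charts of the blowup\<close>


text \<open>The blowdown map written in the affine chart that belongs to i: the affine coordinates
  u_j are multiplied by u_i to recover the normal coordinates x_j.\<close>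

definition blowdown_coords :: "'e::euclidean_space set \<Rightarrow> 'e \<Rightarrow> 'e \<Rightarrow> 'e" where
  "blowdown_coords D i u = (\<Sum>j\<in>Basis. (if j \<in> D \<or> j = i then u \<bullet> j else (u \<bullet> i) * (u \<bullet> j)) *\<^sub>R j)"

lemma blowdown_coords_inner:
  "j \<in> Basis \<Longrightarrow> blowdown_coords D i u \<bullet> j = (if j \<in> D \<or> j = i then u \<bullet> j else (u \<bullet> i) * (u \<bullet> j))"
  by (simp add: blowdown_coords_def inner_sum_left_Basis)

lemma smooth_on_blowdown_coords:
  assumes "open S"
  shows "smooth_on S (blowdown_coords D i)"
proof (rule smooth_on_componentwise[OF assms])
  fix j :: 'a assume "j \<in> Basis"
  then show "smooth_on S (\<lambda>u. blowdown_coords D i u \<bullet> j)"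
    by (cases "j \<in> D \<or> j = i")
      (auto simp: blowdown_coords_inner intro!: smooth_on_mult smooth_on_inner_left smooth_on_id assms)
qed

text \<open>On the exceptional divisor the transversal direction i is sent to a vector with normal
  components 1 at i and u_j elsewhere. These are homogeneous coordinates of the very line that the
  point u stands for.\<close>

lemma blowdown_coords_derivative:
  assumes "u \<bullet> i = 0" "i \<in> Basis"
  shows "\<exists>B. (blowdown_coords D i has_derivative B) (at u) \<and>
    B i = (\<Sum>j\<in>Basis. (if j \<in> D \<or> j = i then i \<bullet> j else u \<bullet> j) *\<^sub>R j)"
proof -
  let ?B = "\<lambda>v. \<Sum>j\<in>Basis. (if j \<in> D \<or> j = i then v \<bullet> j else (v \<bullet> i) * (u \<bullet> j) + (u \<bullet> i) * (v \<bullet> j)) *\<^sub>R j"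
  have "((\<lambda>u. if j \<in> D \<or> j = i then u \<bullet> j else (u \<bullet> i) * (u \<bullet> j)) has_derivative
      (\<lambda>v. if j \<in> D \<or> j = i then v \<bullet> j else (v \<bullet> i) * (u \<bullet> j) + (u \<bullet> i) * (v \<bullet> j))) (at u)" for j
    by (cases "j \<in> D \<or> j = i") (auto intro!: derivative_eq_intros)
  then have "(blowdown_coords D i has_derivative ?B) (at u)"
    unfolding blowdown_coords_def[abs_def]
    by (intro has_derivative_sum has_derivative_scaleR_left)
  then show ?thesis using assms by (intro exI[of _ ?B]) (auto intro!: sum.cong)
qed

lemma compatibleI:
  assumes inj: "inj_on \<phi> U" "inj_on \<psi> V"
    and "\<phi> ` (U \<inter> V) = S" "open S" "smooth_on S \<tau>" "\<And>x. x \<in> U \<Longrightarrow> x \<in> V \<Longrightarrow> \<psi> x = \<tau> (\<phi> x)"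
    and "\<psi> ` (U \<inter> V) = T" "open T" "smooth_on T \<sigma>" "\<And>x. x \<in> U \<Longrightarrow> x \<in> V \<Longrightarrow> \<phi> x = \<sigma> (\<psi> x)"
  shows "compatible (U, \<phi>) (V, \<psi>)"
proof -
  have "smooth_on S (\<psi> \<circ> inv_into U \<phi>)"
    by (rule smooth_on_eq[OF assms(5,4)]) (use assms(3,6) inj in \<open>auto simp: inv_into_f_f\<close>)
  moreover have "smooth_on T (\<phi> \<circ> inv_into V \<psi>)"
    by (rule smooth_on_eq[OF assms(9,8)]) (use assms(7,10) inj in \<open>auto simp: inv_into_f_f\<close>)
  ultimately show ?thesis unfolding compatible_def using assms(3,4,7,8) by simp
qed

lemma blowdown_simps [simp]: "blowdown (Inl x) = x" "blowdown (Inr (y, l)) = y"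
  by (simp_all add: blowdown_def)

locale submanifold = hausdorff_atlas \<A> for \<A> :: "('m, 'e::euclidean_space) chart set" +
  fixes N :: "'m set"
  assumes submanifold: "closed_embedded_submanifold \<A> N"
begin

abbreviation "BA \<equiv> blup_atlas \<A> N"
abbreviation "BP \<equiv> blup_points \<A> N"
abbreviation "Exc \<equiv> exceptional \<A> N"
abbreviation "slice \<equiv> slice_chart \<A> N"
abbreviation "bdom U \<phi> D i \<equiv> fst (blup_chart \<A> N U \<phi> D i)"
abbreviation "bmap U \<phi> D i \<equiv> snd (blup_chart \<A> N U \<phi> D i)"

lemma closed_N: "closedin (mtop \<A>) N"
  using submanifold by (auto simp: closed_embedded_submanifold_def)

lemma N_points: "N \<subseteq> points \<A>"
  using closedin_subset[OF closed_N] by (simp add: topspace_mtop)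

lemma opn_off_N: "opn (points \<A> - N)"
  by (rule opn_compl[OF closed_N])

lemma slice_exists:
  assumes "y \<in> N"
  obtains U \<phi> D where "y \<in> U" "slice U \<phi> D"
  using submanifold assms by (auto simp: closed_embedded_submanifold_def)

lemma sliceD:
  assumes "slice U \<phi> D"
  shows "(U, \<phi>) \<in> max_atlas \<A>" "D \<subseteq> Basis" "x \<in> U \<Longrightarrow> x \<in> N \<longleftrightarrow> (\<forall>i\<in>Basis - D. \<phi> x \<bullet> i = 0)"
  using assms by (auto simp: slice_chart_def)

lemma BP_Inl: "Inl x \<in> BP \<longleftrightarrow> x \<in> points \<A> \<and> x \<notin> N"
  by (auto simp: blup_points_def exceptional_def)

lemma BP_Inr: "Inr (y, l) \<in> BP \<longleftrightarrow> y \<in> N \<and> l \<in> proj_normal \<A> N y"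
  by (auto simp: blup_points_def exceptional_def)

lemma BP_blowdown: "b \<in> BP \<Longrightarrow> blowdown b \<in> points \<A>"
  using N_points by (auto simp: blup_points_def exceptional_def)

lemma BP_off_N: "b \<in> BP \<Longrightarrow> blowdown b \<notin> N \<Longrightarrow> b = Inl (blowdown b)"
  by (auto simp: blup_points_def exceptional_def)

lemma Exc_iff: "b \<in> Exc \<longleftrightarrow> b \<in> BP \<and> blowdown b \<in> N"
  by (auto simp: blup_points_def exceptional_def)

lemma sub_tangent_lin:
  assumes "u \<in> sub_tangent_space \<A> N x" "v \<in> sub_tangent_space \<A> N x"
  shows "(\<lambda>f. c * u f + v f) \<in> sub_tangent_space \<A> N x"
  using assms tangent_space_lin by (auto simp: sub_tangent_space_def)

lemma normal_line_eqI:
  assumes "c \<noteq> 0" "(\<lambda>f. v' f - c * v f) \<in> sub_tangent_space \<A> N y"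
  shows "normal_line \<A> N y v' = normal_line \<A> N y v"
proof -
  let ?S = "sub_tangent_space \<A> N y"
  have *: "\<exists>d. d \<noteq> 0 \<and> (\<lambda>f. w f - d * v f) \<in> ?S"
    if "c \<noteq> 0" "(\<lambda>f. v' f - c * v f) \<in> ?S" "d \<noteq> 0" "(\<lambda>f. w f - d * v' f) \<in> ?S" for c d v v' w
  proof (intro exI conjI)
    show "d * c \<noteq> 0" using that by simp
    show "(\<lambda>f. w f - d * c * v f) \<in> ?S"
      using sub_tangent_lin[OF that(2,4), of d] by (simp add: algebra_simps)
  qed
  have "(\<lambda>f. v f - (1 / c) * v' f) \<in> ?S"
  proof -
    have "(\<lambda>_. 0) \<in> ?S" by (simp add: sub_tangent_space_def tangent_space_0)
    from sub_tangent_lin[OF assms(2) this, of "- 1 / c"]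
    have "(\<lambda>f. (- 1 / c) * (v' f - c * v f) + 0) \<in> ?S" .
    moreover have "(\<lambda>f. (- 1 / c) * (v' f - c * v f) + 0) = (\<lambda>f. v f - (1 / c) * v' f)"
      using assms(1) by (simp add: fun_eq_iff field_simps)
    ultimately show ?thesis by metis
  qed
  moreover have "1 / c \<noteq> 0" using assms(1) by simp
  ultimately show ?thesis unfolding normal_line_def using * assms by blast
qed

text \<open>\<open>normal_coords\<close> evaluates a class at a vector picked by
  \<open>SOME\<close>. Every member of a class represents it, so the picked vector may be used as if
  the class had been defined by it.\<close>

lemma proj_normal_rep:
  assumes "l \<in> proj_normal \<A> N y"
  defines "v \<equiv> SOME v. v \<in> l"
  shows "v \<in> tangent_space \<A> y" "v \<notin> sub_tangent_space \<A> N y" "l = normal_line \<A> N y v"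
proof -
  let ?S = "sub_tangent_space \<A> N y"
  obtain v0 where v0: "v0 \<in> tangent_space \<A> y" "v0 \<notin> ?S" "l = normal_line \<A> N y v0"
    using assms(1) by (auto simp: proj_normal_def)
  have "v0 \<in> l" unfolding v0(3) normal_line_def
    using v0(1) by (auto intro!: exI[of _ 1] simp: sub_tangent_space_def tangent_space_0)
  then have vl: "v \<in> l" unfolding v_def using someI[of "\<lambda>v. v \<in> l" v0] by simp
  then show "v \<in> tangent_space \<A> y" using v0(3) by (auto simp: normal_line_def)
  obtain c where c: "c \<noteq> 0" "(\<lambda>f. v f - c * v0 f) \<in> ?S" using vl v0(3) by (auto simp: normal_line_def)
  show "l = normal_line \<A> N y v" using normal_line_eqI[OF c] v0(3) by simp
  show "v \<notin> ?S"
  proof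
    assume "v \<in> ?S"
    have "(\<lambda>_. 0) \<in> ?S" by (simp add: sub_tangent_space_def tangent_space_0)
    from sub_tangent_lin[OF c(2) this, of "- 1"]
    have "(\<lambda>f. c * v0 f - v f) \<in> ?S" by simp
    from sub_tangent_lin[OF \<open>v \<in> ?S\<close> this, of 1] have "(\<lambda>f. c * v0 f) \<in> ?S" by simp
    from sub_tangent_lin[OF this \<open>(\<lambda>_. 0) \<in> ?S\<close>, of "1 / c"] c(1) have "v0 \<in> ?S" by simp
    then show False using v0 by blast
  qed
qed

lemma bdom_iff:
  "b \<in> bdom U \<phi> D i \<longleftrightarrow> b \<in> BP \<and> blowdown b \<in> U \<and> normal_coords \<A> (U, \<phi>) b \<bullet> i \<noteq> 0"
  by (simp add: blup_chart_def)

lemma bmap_inner: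
  "j \<in> Basis \<Longrightarrow> bmap U \<phi> D i b \<bullet> j = (if j \<in> D \<or> j = i then \<phi> (blowdown b) \<bullet> j
     else (normal_coords \<A> (U, \<phi>) b \<bullet> j) / (normal_coords \<A> (U, \<phi>) b \<bullet> i))"
  by (simp add: blup_chart_def inner_sum_left_Basis)

lemma normal_coords_simps [simp]:
  "normal_coords \<A> (U, \<phi>) (Inl x) = \<phi> x"
  "normal_coords \<A> (U, \<phi>) (Inr (y, l)) = coords \<A> (U, \<phi>) y (SOME v. v \<in> l)"
  by (simp_all add: normal_coords_def)

text \<open>Off N the ratio is multiplied back by the i-th coordinate. Over N all normal coordinates
  of the base point are 0, in agreement with u_i = 0.\<close>

lemma bmap_blowdown:
  assumes s: "slice U \<phi> D" and i: "i \<in> Basis - D" and b: "b \<in> bdom U \<phi> D i"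
  shows "\<phi> (blowdown b) = blowdown_coords D i (bmap U \<phi> D i b)"
proof (rule euclidean_eqI)
  fix j :: 'e assume j: "j \<in> Basis"
  have b': "b \<in> BP" "blowdown b \<in> U" "normal_coords \<A> (U, \<phi>) b \<bullet> i \<noteq> 0" using b by (auto simp: bdom_iff)
  show "\<phi> (blowdown b) \<bullet> j = blowdown_coords D i (bmap U \<phi> D i b) \<bullet> j"
  proof (cases "j \<in> D \<or> j = i")
    case True
    then show ?thesis using j by (simp add: blowdown_coords_inner bmap_inner)
  next
    case False
    show ?thesis
    proof (cases "blowdown b \<in> N")
      case True
      then have "\<phi> (blowdown b) \<bullet> j = 0" "\<phi> (blowdown b) \<bullet> i = 0" using sliceD(3)[OF s b'(2)] False i j by auto
      then show ?thesis using False i j by (simp add: blowdown_coords_inner bmap_inner)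
    next
      case N: False
      then have "b = Inl (blowdown b)" using BP_off_N b'(1) by blast
      then have "normal_coords \<A> (U, \<phi>) b = \<phi> (blowdown b)" using normal_coords_simps(1) by metis
      then show ?thesis using False b'(3) i j by (simp add: blowdown_coords_inner bmap_inner)
    qed
  qed
qed

text \<open>Makes u_i the defining equation of the exceptional divisor in this chart, hence the
  coordinate by which \<open>hadamard_divide\<close> is applied.\<close>

lemma bmap_zero_iff:
  assumes s: "slice U \<phi> D" and i: "i \<in> Basis - D" and b: "b \<in> bdom U \<phi> D i"
  shows "bmap U \<phi> D i b \<bullet> i = 0 \<longleftrightarrow> blowdown b \<in> N"
proof -
  have b': "b \<in> BP" "blowdown b \<in> U" "normal_coords \<A> (U, \<phi>) b \<bullet> i \<noteq> 0" using b by (auto simp: bdom_iff)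
  have "\<phi> (blowdown b) \<bullet> i = 0" if "blowdown b \<in> N" using sliceD(3)[OF s b'(2)] that i by auto
  moreover have "\<phi> (blowdown b) \<bullet> i \<noteq> 0" if "blowdown b \<notin> N"
    using BP_off_N[OF b'(1) that] b'(3) normal_coords_simps(1) by metis
  ultimately show ?thesis using i by (auto simp: bmap_inner)
qed

text \<open>The i-th coordinate of \<open>bmap\<close> is that of the base point and not a ratio;
  the ratio at i would be 1, whence the case distinction.\<close>

lemma normal_coords_ratio:
  assumes i: "i \<in> Basis - D" and b: "b \<in> bdom U \<phi> D i" and j: "j \<in> Basis - D"
  shows "normal_coords \<A> (U, \<phi>) b \<bullet> j =
    (normal_coords \<A> (U, \<phi>) b \<bullet> i) * (if j = i then 1 else bmap U \<phi> D i b \<bullet> j)"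
  using assms by (auto simp: bmap_inner bdom_iff)

lemma sub_tangent_prop:
  assumes s: "slice U \<phi> D" and y: "y \<in> U" "y \<in> N"
    and v: "v \<in> tangent_space \<A> y" "v' \<in> tangent_space \<A> y"
  shows "(\<lambda>f. v' f - c * v f) \<in> sub_tangent_space \<A> N y \<longleftrightarrow>
    (\<forall>j\<in>Basis - D. coords \<A> (U, \<phi>) y v' \<bullet> j = c * (coords \<A> (U, \<phi>) y v \<bullet> j))"
proof -
  have eq: "(\<lambda>f. v' f - c * v f) = (\<lambda>f. (- c) * v f + v' f)" by (simp add: fun_eq_iff)
  have t: "(\<lambda>f. (- c) * v f + v' f) \<in> tangent_space \<A> y" by (rule tangent_space_lin[OF v])
  show ?thesis unfolding eq sub_tangent_iff[OF s y t] coords_lin[OF sliceD(1)[OF s] y(1) v]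
    by (simp add: inner_add_left inner_diff_left)
qed

text \<open>Equal affine coordinates give the same base point. Over N they make the homogeneous
  normal coordinates of two representatives proportional, so that the classes agree.\<close>

lemma inj_bmap:
  assumes s: "slice U \<phi> D" and i: "i \<in> Basis - D"
  shows "inj_on (bmap U \<phi> D i) (bdom U \<phi> D i)"
proof (rule inj_onI)
  fix b b' assume b: "b \<in> bdom U \<phi> D i" and b': "b' \<in> bdom U \<phi> D i" and e: "bmap U \<phi> D i b = bmap U \<phi> D i b'"
  note B = b[unfolded bdom_iff] b'[unfolded bdom_iff]
  have "\<phi> (blowdown b) = \<phi> (blowdown b')" using bmap_blowdown[OF s i] b b' e by metis
  then have p: "blowdown b = blowdown b'" using maxD(2)[OF sliceD(1)[OF s]] B by (auto dest: inj_onD)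
  show "b = b'"
  proof (cases "blowdown b \<in> N")
    case False
    then show ?thesis using BP_off_N[of b] BP_off_N[of b'] B p by simp
  next
    case True
    obtain y l where y: "b = Inr (y, l)" using True B by (cases b) (auto simp: BP_Inl)
    obtain l' where y': "b' = Inr (y, l')" using True B p y by (cases b') (auto simp: BP_Inl)
    have yN: "y \<in> U" "y \<in> N" "l \<in> proj_normal \<A> N y" "l' \<in> proj_normal \<A> N y" using B y y' by (auto simp: BP_Inr)
    define v where "v = (SOME v. v \<in> l)"
    define v' where "v' = (SOME v. v \<in> l')"
    note r = proj_normal_rep[OF yN(3), folded v_def] and r' = proj_normal_rep[OF yN(4), folded v'_def]
    let ?c = "coords \<A> (U, \<phi>) y"
    have n: "normal_coords \<A> (U, \<phi>) b = ?c v" "normal_coords \<A> (U, \<phi>) b' = ?c v'"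
      using y y' by (simp_all add: v_def v'_def)
    have nz: "?c v \<bullet> i \<noteq> 0" "?c v' \<bullet> i \<noteq> 0" using B n by auto
    let ?k = "(?c v' \<bullet> i) / (?c v \<bullet> i)"
    have "?c v' \<bullet> j = ?k * (?c v \<bullet> j)" if "j \<in> Basis - D" for j
      using normal_coords_ratio[OF i b that] normal_coords_ratio[OF i b' that] nz by (simp add: n e)
    then have "(\<lambda>f. v' f - ?k * v f) \<in> sub_tangent_space \<A> N y"
      using sub_tangent_prop[OF s yN(1,2) r(1) r'(1)] by blast
    then have "l' = l" using normal_line_eqI[of ?k] nz r(3) r'(3) by auto
    then show ?thesis using y y' by simp
  qed
qed

lemma bmap_surj:
  assumes s: "slice U \<phi> D" and i: "i \<in> Basis - D" and x: "x \<in> U" "blowdown_coords D i u = \<phi> x"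
  obtains b where "b \<in> bdom U \<phi> D i" "bmap U \<phi> D i b = u" "blowdown b = x"
proof (cases "u \<bullet> i = 0")
  case False
  note U = sliceD(1)[OF s]
  have xi: "\<phi> x \<bullet> i = u \<bullet> i" using i x(2)[symmetric] by (simp add: blowdown_coords_inner)
  have "x \<notin> N" using sliceD(3)[OF s x(1)] i xi False by auto
  then have b: "Inl x \<in> bdom U \<phi> D i" using x xi False maxD(4)[OF U] by (auto simp: bdom_iff BP_Inl)
  have "bmap U \<phi> D i (Inl x) = u"
  proof (rule euclidean_eqI)
    fix j :: 'e assume j: "j \<in> Basis"
    show "bmap U \<phi> D i (Inl x) \<bullet> j = u \<bullet> j"
      using i j False xi by (auto simp: bmap_inner x(2)[symmetric] blowdown_coords_inner)
  qed
  then show ?thesis using that b by simp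
next
  case True
  note U = sliceD(1)[OF s]
  have xn: "\<phi> x \<bullet> j = 0" if "j \<in> Basis - D" for j
    using that x(2)[symmetric] True by (auto simp: blowdown_coords_inner)
  then have xN: "x \<in> N" using sliceD(3)[OF s x(1)] by auto
  let ?c = "coords \<A> (U, \<phi>) x"
  \<comment> \<open>Homogeneous coordinates of the line sought, normalised to 1 at i. Components
    along \<open>D\<close> do not affect the class and are set to 0.\<close>
  define w where "w = (\<Sum>j\<in>Basis. (if j = i then 1 else if j \<in> D then 0 else u \<bullet> j) *\<^sub>R j)"
  have w: "w \<bullet> j = (if j = i then 1 else if j \<in> D then 0 else u \<bullet> j)" if "j \<in> Basis" for j
    using that by (simp add: w_def inner_sum_left_Basis)
  define v where "v = tangent_of_coords U \<phi> x w"
  have v: "v \<in> tangent_space \<A> x" "?c v = w"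
    unfolding v_def by (rule tangent_of_coords_in[OF U x(1)], rule coords_tangent_of_coords[OF U x(1)])
  have vs: "v \<notin> sub_tangent_space \<A> N x"
    unfolding sub_tangent_iff[OF s x(1) xN v(1)] using i by (auto simp: v w intro!: bexI[of _ i])
  define l where "l = normal_line \<A> N x v"
  have l: "l \<in> proj_normal \<A> N x" unfolding l_def proj_normal_def using v vs by blast
  \<comment> \<open>The representative seen by \<open>normal_coords\<close> may differ from v by a
    factor c and by a vector tangent to N; the factor cancels in the ratios.\<close>
  define v' where "v' = (SOME v. v \<in> l)"
  note r = proj_normal_rep[OF l, folded v'_def]
  have "v' \<in> normal_line \<A> N x v'" using r(1)
    by (auto simp: normal_line_def sub_tangent_space_def tangent_space_0 intro!: exI[of _ 1])
  then have "v' \<in> normal_line \<A> N x v" using r(3) l_def by simp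
  then obtain c where c: "c \<noteq> 0" "(\<lambda>f. v' f - c * v f) \<in> sub_tangent_space \<A> N x"
    by (auto simp: normal_line_def)
  have cv: "?c v' \<bullet> j = c * (w \<bullet> j)" if "j \<in> Basis - D" for j
    using c(2) sub_tangent_prop[OF s x(1) xN v(1) r(1)] that v(2) by auto
  let ?b = "Inr (x, l)"
  have n: "normal_coords \<A> (U, \<phi>) ?b = ?c v'" by (simp add: v'_def)
  have ci: "?c v' \<bullet> i = c" using cv[OF i] w i by simp
  have b: "?b \<in> bdom U \<phi> D i" unfolding bdom_iff n using ci c x l xN by (auto simp: BP_Inr)
  have "bmap U \<phi> D i ?b = u"
  proof (rule euclidean_eqI)
    fix j :: 'e assume j: "j \<in> Basis"
    consider "j \<in> D" | "j = i" | "j \<notin> D" "j \<noteq> i" by blast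
    then show "bmap U \<phi> D i ?b \<bullet> j = u \<bullet> j"
    proof cases
      case 1
      then show ?thesis using j by (simp add: bmap_inner x(2)[symmetric] blowdown_coords_inner)
    next
      case 2
      then show ?thesis using i xn True by (simp add: bmap_inner)
    next
      case 3
      then show ?thesis using j ci c(1) by (simp add: bmap_inner n[unfolded normal_coords_simps] cv w)
    qed
  qed
  then show ?thesis using that[OF b] by simp
qed

text \<open>Describes images in an affine chart through the blowdown map, so that openness in the
  blowup reduces to continuity of \<open>blowdown_coords\<close>.\<close>

lemma bmap_image:
  assumes s: "slice U \<phi> D" and i: "i \<in> Basis - D" and W: "W \<subseteq> U"
  shows "bmap U \<phi> D i ` {b \<in> bdom U \<phi> D i. blowdown b \<in> W} = {u. blowdown_coords D i u \<in> \<phi> ` W}"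
proof (intro set_eqI iffI)
  fix u assume "u \<in> bmap U \<phi> D i ` {b \<in> bdom U \<phi> D i. blowdown b \<in> W}"
  then show "u \<in> {u. blowdown_coords D i u \<in> \<phi> ` W}" using bmap_blowdown[OF s i] by force
next
  fix u assume "u \<in> {u. blowdown_coords D i u \<in> \<phi> ` W}"
  then obtain x where x: "x \<in> W" "blowdown_coords D i u = \<phi> x" by blast
  then obtain b where "b \<in> bdom U \<phi> D i" "bmap U \<phi> D i b = u" "blowdown b = x"
    using bmap_surj[OF s i _ x(2)] W by blast
  then show "u \<in> bmap U \<phi> D i ` {b \<in> bdom U \<phi> D i. blowdown b \<in> W}" using x by blast
qed

lemma open_blowdown_coords_vimage: "open S \<Longrightarrow> open {u. blowdown_coords D i u \<in> S}"
  using open_vimage[OF _ smooth_on_imp_continuous_on[OF smooth_on_blowdown_coords[OF open_UNIV]]]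
  by (simp add: vimage_def)

lemma is_chart_bchart:
  assumes s: "slice U \<phi> D" and i: "i \<in> Basis - D"
  shows "is_chart (bdom U \<phi> D i, bmap U \<phi> D i)"
proof -
  have "bmap U \<phi> D i ` bdom U \<phi> D i = {u. blowdown_coords D i u \<in> \<phi> ` U}"
  proof -
    have "{b \<in> bdom U \<phi> D i. blowdown b \<in> U} = bdom U \<phi> D i" by (auto simp: bdom_iff)
    then show ?thesis using bmap_image[OF s i order_refl] by simp
  qed
  then show ?thesis
    using inj_bmap[OF s i] open_blowdown_coords_vimage[OF maxD(3)[OF sliceD(1)[OF s]]]
    unfolding is_chart_def prod.case by simp
qed

text \<open>The homogeneous normal coordinates of a second slice chart are given, up to a common nonzero
  factor, by the quotients of the transition map by the coordinate \<open>i\<close> of the exceptional divisor.\<close>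

definition normal_quotient ::
    "'m set \<Rightarrow> ('m \<Rightarrow> 'e) \<Rightarrow> 'e set \<Rightarrow> 'e \<Rightarrow> ('m \<Rightarrow> 'e) \<Rightarrow> 'e \<Rightarrow> 'e \<Rightarrow> real" where
  "normal_quotient U \<phi> D i \<psi> j = (\<lambda>u.
     if u \<bullet> i = 0 then frechet_derivative (\<lambda>u. \<psi> (inv_into U \<phi> (blowdown_coords D i u)) \<bullet> j) (at u) i
     else (\<psi> (inv_into U \<phi> (blowdown_coords D i u)) \<bullet> j) / (u \<bullet> i))"

lemma smooth_transition_blowdown:
  assumes s: "slice U \<phi> D" and V: "(V, \<psi>) \<in> max_atlas \<A>"
  shows "open {u. blowdown_coords D i u \<in> \<phi> ` (U \<inter> V)}"
    "smooth_on {u. blowdown_coords D i u \<in> \<phi> ` (U \<inter> V)} (\<lambda>u. \<psi> (inv_into U \<phi> (blowdown_coords D i u)))"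
proof -
  note c = compatibleD[OF max_compat[OF sliceD(1)[OF s] V]]
  show o: "open {u. blowdown_coords D i u \<in> \<phi> ` (U \<inter> V)}" by (rule open_blowdown_coords_vimage[OF c(1)])
  show "smooth_on {u. blowdown_coords D i u \<in> \<phi> ` (U \<inter> V)} (\<lambda>u. \<psi> (inv_into U \<phi> (blowdown_coords D i u)))"
    using smooth_on_compose[OF o c(1) c(3) smooth_on_blowdown_coords[OF o]] by auto
qed

text \<open>The hyperplane u_i = 0 is mapped into N, where the normal coordinates of the second
  slice chart vanish; hence they are divisible by u_i.\<close>

lemma smooth_normal_quotient:
  assumes s: "slice U \<phi> D" and i: "i \<in> Basis - D" and s': "slice V \<psi> D'" and j: "j \<in> Basis - D'"
  shows "smooth_on {u. blowdown_coords D i u \<in> \<phi> ` (U \<inter> V)} (normal_quotient U \<phi> D i \<psi> j)"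
  unfolding normal_quotient_def
proof (rule hadamard_divide)
  note t = smooth_transition_blowdown[OF s sliceD(1)[OF s'], where i = i]
  show "open {u. blowdown_coords D i u \<in> \<phi> ` (U \<inter> V)}" by (rule t)
  show "smooth_on {u. blowdown_coords D i u \<in> \<phi> ` (U \<inter> V)} (\<lambda>u. \<psi> (inv_into U \<phi> (blowdown_coords D i u)) \<bullet> j)"
    by (intro smooth_on_inner_left t)
  show "i \<in> Basis" using i by simp
  fix u assume u: "u \<in> {u. blowdown_coords D i u \<in> \<phi> ` (U \<inter> V)}" "u \<bullet> i = 0"
  then obtain x where x: "x \<in> U" "x \<in> V" "blowdown_coords D i u = \<phi> x" by blast
  have "\<phi> x \<bullet> k = 0" if "k \<in> Basis - D" for k
    using that x(3)[symmetric] u(2) by (auto simp: blowdown_coords_inner)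
  then have "x \<in> N" using sliceD(3)[OF s x(1)] by blast
  then have "\<psi> x \<bullet> j = 0" using sliceD(3)[OF s' x(2)] j by blast
  then show "\<psi> (inv_into U \<phi> (blowdown_coords D i u)) \<bullet> j = 0"
    using x maxD(2)[OF sliceD(1)[OF s]] by (simp add: inv_into_f_f)
qed

text \<open>Off N the factor is u_i. Over N it is the i-th homogeneous coordinate: divided by it,
  the representative is modulo TN the image of the direction i under the derivative of the blowdown
  map. Tangent vectors transform by the derivative of the chart change, and the chain rule turns the
  normal components in the second chart into the derivatives that \<open>normal_quotient\<close>
  takes there.\<close>

lemma normal_coords_quotient:
  assumes s: "slice U \<phi> D" and i: "i \<in> Basis - D" and s': "slice V \<psi> D'"
    and b: "b \<in> bdom U \<phi> D i" "blowdown b \<in> V"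
  shows "\<exists>k. k \<noteq> 0 \<and> (\<forall>j\<in>Basis - D'. normal_coords \<A> (V, \<psi>) b \<bullet> j =
    k * normal_quotient U \<phi> D i \<psi> j (bmap U \<phi> D i b))"
proof -
  note U = sliceD(1)[OF s] and V = sliceD(1)[OF s']
  note B = b(1)[unfolded bdom_iff]
  define u where "u = bmap U \<phi> D i b"
  have bc: "blowdown_coords D i u = \<phi> (blowdown b)" using bmap_blowdown[OF s i b(1)] u_def by simp
  have inv: "inv_into U \<phi> (\<phi> (blowdown b)) = blowdown b" using maxD(2)[OF U] B by (simp add: inv_into_f_f)
  show ?thesis
  proof (cases "blowdown b \<in> N")
    case False
    then have u0: "u \<bullet> i \<noteq> 0" using bmap_zero_iff[OF s i b(1)] u_def by simp
    have "b = Inl (blowdown b)" using BP_off_N B False by blast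
    then have "normal_coords \<A> (V, \<psi>) b = \<psi> (blowdown b)" using normal_coords_simps(1) by metis
    then have "normal_coords \<A> (V, \<psi>) b \<bullet> j = (u \<bullet> i) * normal_quotient U \<phi> D i \<psi> j u" for j
      using u0 by (simp add: normal_quotient_def bc inv)
    then show ?thesis using u0 u_def by blast
  next
    case True
    then have u0: "u \<bullet> i = 0" using bmap_zero_iff[OF s i b(1)] u_def by simp
    obtain y l where y: "b = Inr (y, l)" using True B by (cases b) (auto simp: BP_Inl)
    have yN: "y \<in> U" "y \<in> V" "y \<in> N" "l \<in> proj_normal \<A> N y" using B y b(2) by (auto simp: BP_Inr)
    define v where "v = (SOME v. v \<in> l)"
    note r = proj_normal_rep[OF yN(4), folded v_def]
    let ?c = "coords \<A> (U, \<phi>) y" and ?c' = "coords \<A> (V, \<psi>) y"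
    have n: "normal_coords \<A> (U, \<phi>) b = ?c v" "normal_coords \<A> (V, \<psi>) b = ?c' v" using y by (simp_all add: v_def)
    define k where "k = ?c v \<bullet> i"
    have k: "k \<noteq> 0" using B n k_def by simp
    obtain B' where B': "(blowdown_coords D i has_derivative B') (at u)"
      "B' i = (\<Sum>j\<in>Basis. (if j \<in> D \<or> j = i then i \<bullet> j else u \<bullet> j) *\<^sub>R j)"
      using blowdown_coords_derivative[OF u0] i by blast
    define w where "w = B' i"
    have w: "w \<bullet> j = (if j = i then 1 else u \<bullet> j)" if "j \<in> Basis - D" for j
      using that i by (simp add: w_def B'(2) inner_sum_left_Basis)
    define vw where "vw = tangent_of_coords U \<phi> y w"
    have vw: "vw \<in> tangent_space \<A> y" "?c vw = w"
      unfolding vw_def by (rule tangent_of_coords_in[OF U yN(1)], rule coords_tangent_of_coords[OF U yN(1)])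
    have "?c v \<bullet> j = k * (w \<bullet> j)" if "j \<in> Basis - D" for j
      using normal_coords_ratio[OF i b(1) that] w[OF that] by (simp add: n k_def u_def)
    then have "(\<lambda>f. v f - k * vw f) \<in> sub_tangent_space \<A> N y"
      using sub_tangent_prop[OF s yN(1,3) vw(1) r(1)] vw(2) by simp
    then have cv: "?c' v \<bullet> j = k * (?c' vw \<bullet> j)" if "j \<in> Basis - D'" for j
      using sub_tangent_prop[OF s' yN(2,3) vw(1) r(1)] that by blast
    let ?L = "frechet_derivative (\<psi> \<circ> inv_into U \<phi>) (at (\<phi> y))"
    have L: "?c' vw = ?L w" using coords_change[OF U yN(1) V yN(2) vw(1)] vw(2) by simp
    have "((\<psi> \<circ> inv_into U \<phi>) has_derivative ?L) (at (blowdown_coords D i u))"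
      using smooth_on_has_derivative[OF compatibleD(3)[OF max_compat[OF U V]], of "\<phi> y"] yN bc y by simp
    from has_derivative_compose[OF B'(1) this]
    have d: "((\<lambda>u. \<psi> (inv_into U \<phi> (blowdown_coords D i u))) has_derivative (\<lambda>x. ?L (B' x))) (at u)" by simp
    have "?c' vw \<bullet> j = normal_quotient U \<phi> D i \<psi> j u" for j
    proof -
      have "((\<lambda>u. \<psi> (inv_into U \<phi> (blowdown_coords D i u)) \<bullet> j) has_derivative (\<lambda>x. ?L (B' x) \<bullet> j)) (at u)"
        by (rule has_derivative_inner_left[OF d])
      from frechet_derivative_at[OF this, symmetric] show ?thesis
        by (simp add: normal_quotient_def u0 L w_def)
    qed
    then show ?thesis using k cv n(2) u_def by auto
  qed
qed

text \<open>One direction of compatibility, to be used twice with the charts exchanged. The common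
  factor of the homogeneous coordinates cancels in the ratios
  \<open>?h j u / ?h i' u\<close>.\<close>

lemma compatible_bchart:
  assumes s: "slice U \<phi> D" and i: "i \<in> Basis - D" and s': "slice V \<psi> D'" and i': "i' \<in> Basis - D'"
  shows "\<exists>S \<tau>. bmap U \<phi> D i ` (bdom U \<phi> D i \<inter> bdom V \<psi> D' i') = S \<and> open S \<and> smooth_on S \<tau> \<and>
     (\<forall>b\<in>bdom U \<phi> D i \<inter> bdom V \<psi> D' i'. bmap V \<psi> D' i' b = \<tau> (bmap U \<phi> D i b))"
proof -
  note U = sliceD(1)[OF s] and V = sliceD(1)[OF s']
  let ?Z = "{u. blowdown_coords D i u \<in> \<phi> ` (U \<inter> V)}"
  let ?F = "\<lambda>u. \<psi> (inv_into U \<phi> (blowdown_coords D i u))"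
  let ?h = "normal_quotient U \<phi> D i \<psi>"
  \<comment> \<open>Over V, the second affine chart covers the points whose homogeneous coordinate
    i' is nonzero; by \<open>normal_coords_quotient\<close> this is where \<open>?h i'\<close> does
    not vanish.\<close>
  let ?S = "?Z \<inter> ?h i' -` (- {0})"
  let ?\<tau> = "\<lambda>u. \<Sum>j\<in>Basis. (if j \<in> D' \<or> j = i' then ?F u \<bullet> j else ?h j u / ?h i' u) *\<^sub>R j"
  note t = smooth_transition_blowdown[OF s V, where i = i]
  note q = smooth_normal_quotient[OF s i s']
  have o: "open ?S"
    by (rule continuous_open_preimage[OF smooth_on_imp_continuous_on[OF q[OF i']] t(1)]) auto
  have sm: "smooth_on ?S ?\<tau>"
  proof (intro smooth_on_sum smooth_on_scaleR o smooth_on_const)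
    fix j :: 'e assume j: "j \<in> Basis"
    show "smooth_on ?S (\<lambda>u. if j \<in> D' \<or> j = i' then ?F u \<bullet> j else ?h j u / ?h i' u)"
    proof (cases "j \<in> D' \<or> j = i'")
      case True
      then show ?thesis using smooth_on_inner_left[OF o smooth_on_subset[OF t(2)]] by simp
    next
      case False
      then have "smooth_on ?S (\<lambda>u. ?h j u / ?h i' u)"
        using j i' by (intro smooth_on_divide o smooth_on_subset[OF q]) auto
      then show ?thesis using False by simp
    qed
  qed
  have half: "bmap U \<phi> D i b \<in> ?Z \<and> (b \<in> bdom V \<psi> D' i' \<longleftrightarrow> ?h i' (bmap U \<phi> D i b) \<noteq> 0) \<and>
      (b \<in> bdom V \<psi> D' i' \<longrightarrow> bmap V \<psi> D' i' b = ?\<tau> (bmap U \<phi> D i b))"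
    if b: "b \<in> bdom U \<phi> D i" "blowdown b \<in> V" for b
  proof -
    let ?u = "bmap U \<phi> D i b"
    note B = b(1)[unfolded bdom_iff]
    have bc: "blowdown_coords D i ?u = \<phi> (blowdown b)" using bmap_blowdown[OF s i b(1)] by simp
    have inv: "?F ?u = \<psi> (blowdown b)" using maxD(2)[OF U] B by (simp add: inv_into_f_f bc)
    obtain k where k: "k \<noteq> 0" "\<forall>j\<in>Basis - D'. normal_coords \<A> (V, \<psi>) b \<bullet> j = k * ?h j ?u"
      using normal_coords_quotient[OF s i s' b] by blast
    have 1: "?u \<in> ?Z" using bc B b(2) by auto
    have 2: "b \<in> bdom V \<psi> D' i' \<longleftrightarrow> ?h i' ?u \<noteq> 0" using k i' B b(2) by (simp add: bdom_iff)
    have 3: "bmap V \<psi> D' i' b = ?\<tau> ?u" if "b \<in> bdom V \<psi> D' i'"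
    proof (rule euclidean_eqI)
      fix j :: 'e assume j: "j \<in> Basis"
      show "bmap V \<psi> D' i' b \<bullet> j = ?\<tau> ?u \<bullet> j"
        using j k i' by (auto simp: bmap_inner inner_sum_left_Basis inv)
    qed
    show ?thesis using 1 2 3 by blast
  qed
  have img: "bmap U \<phi> D i ` (bdom U \<phi> D i \<inter> bdom V \<psi> D' i') = ?S"
  proof (intro set_eqI iffI)
    fix u assume "u \<in> bmap U \<phi> D i ` (bdom U \<phi> D i \<inter> bdom V \<psi> D' i')"
    then obtain b where b: "b \<in> bdom U \<phi> D i" "b \<in> bdom V \<psi> D' i'" "u = bmap U \<phi> D i b" by blast
    have "blowdown b \<in> V" using b(2) by (simp add: bdom_iff)
    from half[OF b(1) this] b show "u \<in> ?S" by auto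
  next
    fix u assume u: "u \<in> ?S"
    then obtain x where x: "x \<in> U" "x \<in> V" "blowdown_coords D i u = \<phi> x" by blast
    obtain b where b: "b \<in> bdom U \<phi> D i" "bmap U \<phi> D i b = u" "blowdown b = x"
      using bmap_surj[OF s i x(1,3)] .
    have "blowdown b \<in> V" using b(3) x by simp
    from half[OF b(1) this] b u show "u \<in> bmap U \<phi> D i ` (bdom U \<phi> D i \<inter> bdom V \<psi> D' i')" by auto
  qed
  have "bmap V \<psi> D' i' b = ?\<tau> (bmap U \<phi> D i b)" if "b \<in> bdom U \<phi> D i \<inter> bdom V \<psi> D' i'" for b
  proof -
    have "b \<in> bdom U \<phi> D i" "b \<in> bdom V \<psi> D' i'" "blowdown b \<in> V" using that bdom_iff[of b V] by blast+
    then show ?thesis using half by blast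
  qed
  then show ?thesis using img o sm by blast
qed

lemma off_chart:
  assumes "(V, \<psi>) \<in> max_atlas \<A>"
  shows "is_chart (Inl ` (V - N), \<psi> \<circ> blowdown)" "(\<psi> \<circ> blowdown) ` (Inl ` (V - N)) = \<psi> ` (V - N)"
proof -
  show *: "(\<psi> \<circ> blowdown) ` (Inl ` (V - N)) = \<psi> ` (V - N)" by (simp add: image_image)
  have "V \<inter> (points \<A> - N) = V - N" using maxD(4)[OF assms] by auto
  then have "open (\<psi> ` (V - N))" using openin_imp_open_image[OF opn_off_N assms] by simp
  moreover have "inj_on (\<psi> \<circ> blowdown) (Inl ` (V - N))" using maxD(2)[OF assms] by (auto simp: inj_on_def)
  ultimately show "is_chart (Inl ` (V - N), \<psi> \<circ> blowdown)" unfolding is_chart_def prod.case * by blast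
qed

lemma compatible_off_off:
  assumes U: "(U, \<phi>) \<in> max_atlas \<A>" and V: "(V, \<psi>) \<in> max_atlas \<A>"
  shows "compatible (Inl ` (U - N), \<phi> \<circ> blowdown :: 'm blup \<Rightarrow> 'e) (Inl ` (V - N), \<psi> \<circ> blowdown)"
proof -
  note c = compatibleD[OF max_compat[OF U V]]
  have i: "Inl ` (U - N) \<inter> Inl ` (V - N) = (Inl ` (U \<inter> V - N) :: 'm blup set)" by auto
  have o: "open (\<phi> ` (U \<inter> V - N))" "open (\<psi> ` (U \<inter> V - N))"
  proof -
    have "opn (V \<inter> (points \<A> - N))" "opn (U \<inter> (points \<A> - N))" using opn_chart U V opn_off_N by blast+
    from openin_imp_open_image[OF this(1) U] openin_imp_open_image[OF this(2) V]
    show "open (\<phi> ` (U \<inter> V - N))" "open (\<psi> ` (U \<inter> V - N))"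
    proof -
      have "U \<inter> (V \<inter> (points \<A> - N)) = U \<inter> V - N" "V \<inter> (U \<inter> (points \<A> - N)) = U \<inter> V - N"
        using maxD(4)[OF U] by auto
      then show "open (\<phi> ` (U \<inter> (V \<inter> (points \<A> - N)))) \<Longrightarrow> open (\<phi> ` (U \<inter> V - N))"
        "open (\<psi> ` (V \<inter> (U \<inter> (points \<A> - N)))) \<Longrightarrow> open (\<psi> ` (U \<inter> V - N))" by simp_all
    qed
  qed
  show ?thesis
  proof (rule compatibleI)
    show "inj_on (\<phi> \<circ> blowdown) (Inl ` (U - N))" "inj_on (\<psi> \<circ> blowdown) (Inl ` (V - N))"
      by (rule is_chartD(1)[OF off_chart(1)[OF U]], rule is_chartD(1)[OF off_chart(1)[OF V]])
    show "(\<phi> \<circ> blowdown) ` (Inl ` (U - N) \<inter> Inl ` (V - N)) = \<phi> ` (U \<inter> V - N)"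
      "(\<psi> \<circ> blowdown) ` (Inl ` (U - N) \<inter> Inl ` (V - N)) = \<psi> ` (U \<inter> V - N)"
      unfolding i by (simp_all add: image_image)
    show "smooth_on (\<phi> ` (U \<inter> V - N)) (\<psi> \<circ> inv_into U \<phi>)" "smooth_on (\<psi> ` (U \<inter> V - N)) (\<phi> \<circ> inv_into V \<psi>)"
      by (rule smooth_on_subset[OF c(3)], blast, rule smooth_on_subset[OF c(4)], blast)
  qed (use o maxD(2)[OF U] maxD(2)[OF V] in \<open>auto simp: inv_into_f_f\<close>)
qed

text \<open>The overlap lies where the coordinate i of the slice chart is nonzero. It misses N, and
  there the affine coordinates arise by plain division by that coordinate.\<close>

lemma compatible_off_bchart:
  assumes s: "slice U \<phi> D" and i: "i \<in> Basis - D" and V: "(V, \<psi>) \<in> max_atlas \<A>"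
  shows "compatible (bdom U \<phi> D i, bmap U \<phi> D i) (Inl ` (V - N), \<psi> \<circ> blowdown)"
proof -
  note U = sliceD(1)[OF s]
  let ?X = "V \<inter> (U \<inter> \<phi> -` {z. z \<bullet> i \<noteq> 0})"
  let ?Z = "{u. blowdown_coords D i u \<in> \<phi> ` (U \<inter> V)}"
  have oi: "open {z::'e. z \<bullet> i \<noteq> 0}" by (intro open_Collect_neq continuous_intros)
  have XN: "x \<notin> N" if "x \<in> ?X" for x using that sliceD(3)[OF s] i by auto
  have int: "bdom U \<phi> D i \<inter> Inl ` (V - N) = Inl ` ?X"
    using XN maxD(4)[OF U] by (auto simp: bdom_iff BP_Inl)
  note t = smooth_transition_blowdown[OF s V, where i = i]
  let ?q = "\<lambda>z. \<Sum>j\<in>Basis. (if j \<in> D \<or> j = i then z \<bullet> j else (z \<bullet> j) / (z \<bullet> i)) *\<^sub>R j"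
  have oX: "open (\<psi> ` ?X)" by (rule openin_imp_open_image[OF opn_chart_preimage[OF U oi] V])
  have iX: "Inl x \<in> bdom U \<phi> D i \<and> bmap U \<phi> D i (Inl x) \<bullet> i = \<phi> x \<bullet> i \<and>
      blowdown_coords D i (bmap U \<phi> D i (Inl x)) = \<phi> x" if "x \<in> ?X" for x
  proof -
    have "Inl x \<in> bdom U \<phi> D i" using that int by blast
    then show ?thesis using bmap_blowdown[OF s i, of "Inl x"] i by (simp add: bmap_inner)
  qed
  show ?thesis
  proof (rule compatibleI[where S = "?Z \<inter> {u. u \<bullet> i \<noteq> 0}" and T = "\<psi> ` ?X"
        and \<tau> = "\<lambda>u. \<psi> (inv_into U \<phi> (blowdown_coords D i u))" and \<sigma> = "\<lambda>z. ?q ((\<phi> \<circ> inv_into V \<psi>) z)"])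
    show "inj_on (bmap U \<phi> D i) (bdom U \<phi> D i)" by (rule inj_bmap[OF s i])
    show "inj_on (\<psi> \<circ> blowdown) (Inl ` (V - N))" by (rule is_chartD(1)[OF off_chart(1)[OF V]])
    show "open (?Z \<inter> {u. u \<bullet> i \<noteq> 0})" using t(1) oi by blast
    show "smooth_on (?Z \<inter> {u. u \<bullet> i \<noteq> 0}) (\<lambda>u. \<psi> (inv_into U \<phi> (blowdown_coords D i u)))"
      by (rule smooth_on_subset[OF t(2)]) blast
    show "bmap U \<phi> D i ` (bdom U \<phi> D i \<inter> Inl ` (V - N)) = ?Z \<inter> {u. u \<bullet> i \<noteq> 0}"
    proof (intro set_eqI iffI)
      fix u assume "u \<in> bmap U \<phi> D i ` (bdom U \<phi> D i \<inter> Inl ` (V - N))"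
      then obtain x where "x \<in> ?X" "u = bmap U \<phi> D i (Inl x)" unfolding int by blast
      then show "u \<in> ?Z \<inter> {u. u \<bullet> i \<noteq> 0}" using iX[of x] by auto
    next
      fix u assume u: "u \<in> ?Z \<inter> {u. u \<bullet> i \<noteq> 0}"
      then obtain x where x: "x \<in> U" "x \<in> V" "blowdown_coords D i u = \<phi> x" by blast
      obtain b where b: "b \<in> bdom U \<phi> D i" "bmap U \<phi> D i b = u" "blowdown b = x"
        using bmap_surj[OF s i x(1,3)] .
      have "x \<notin> N" using bmap_zero_iff[OF s i b(1)] b u by auto
      then have "b = Inl x" using BP_off_N[of b] b by (auto simp: bdom_iff)
      then show "u \<in> bmap U \<phi> D i ` (bdom U \<phi> D i \<inter> Inl ` (V - N))" using b x \<open>x \<notin> N\<close> by blast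
    qed
    show "(\<psi> \<circ> blowdown) ` (bdom U \<phi> D i \<inter> Inl ` (V - N)) = \<psi> ` ?X" unfolding int by (simp add: image_image)
    show "open (\<psi> ` ?X)" by (rule oX)
    show "smooth_on (\<psi> ` ?X) (\<lambda>z. ?q ((\<phi> \<circ> inv_into V \<psi>) z))"
    proof (rule smooth_on_compose[OF oX oi, where f = ?q and g = "\<phi> \<circ> inv_into V \<psi>"])
      show "smooth_on {z. z \<bullet> i \<noteq> 0} ?q"
      proof (intro smooth_on_sum smooth_on_scaleR oi smooth_on_const)
        fix j :: 'e
        show "smooth_on {z. z \<bullet> i \<noteq> 0} (\<lambda>z. if j \<in> D \<or> j = i then z \<bullet> j else (z \<bullet> j) / (z \<bullet> i))"
          by (cases "j \<in> D \<or> j = i") (auto intro!: smooth_on_inner_left smooth_on_divide oi smooth_on_id)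
      qed
      show "smooth_on (\<psi> ` ?X) (\<phi> \<circ> inv_into V \<psi>)"
        by (rule smooth_on_subset[OF compatibleD(4)[OF max_compat[OF U V]]]) auto
      show "(\<phi> \<circ> inv_into V \<psi>) ` \<psi> ` ?X \<subseteq> {z. z \<bullet> i \<noteq> 0}" using maxD(2)[OF V] by (auto simp: inv_into_f_f)
    qed
  next
    fix b assume "b \<in> bdom U \<phi> D i" "b \<in> Inl ` (V - N)"
    then obtain x where x: "x \<in> ?X" "b = Inl x" using int by blast
    have inv: "inv_into U \<phi> (\<phi> x) = x" "inv_into V \<psi> (\<psi> x) = x"
      using x maxD(2)[OF U] maxD(2)[OF V] by (auto simp: inv_into_f_f)
    show "(\<psi> \<circ> blowdown) b = \<psi> (inv_into U \<phi> (blowdown_coords D i (bmap U \<phi> D i b)))"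
      using iX[OF x(1)] x(2) inv by simp
    show "bmap U \<phi> D i b = ?q ((\<phi> \<circ> inv_into V \<psi>) ((\<psi> \<circ> blowdown) b))"
    proof (rule euclidean_eqI)
      fix j :: 'e assume j: "j \<in> Basis"
      have e: "(\<phi> \<circ> inv_into V \<psi>) ((\<psi> \<circ> blowdown) b) = \<phi> x" using x(2) inv(2) by simp
      show "bmap U \<phi> D i b \<bullet> j = ?q ((\<phi> \<circ> inv_into V \<psi>) ((\<psi> \<circ> blowdown) b)) \<bullet> j"
        unfolding e unfolding x(2) bmap_inner[OF j] inner_sum_left_Basis[OF j] by simp
    qed
  qed
qed

lemma blup_atlas_cases:
  assumes "c \<in> BA"
  obtains (off) U \<phi> where "(U, \<phi>) \<in> \<A>" "c = (Inl ` (U - N), \<phi> \<circ> blowdown)"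
  | (exc) U \<phi> D i where "slice U \<phi> D" "i \<in> Basis - D" "c = (bdom U \<phi> D i, bmap U \<phi> D i)"
  using assms unfolding blup_atlas_def by auto

lemma off_in_BA: "(U, \<phi>) \<in> \<A> \<Longrightarrow> (Inl ` (U - N), \<phi> \<circ> blowdown) \<in> BA"
  unfolding blup_atlas_def by blast

lemma bchart_in_BA: "slice U \<phi> D \<Longrightarrow> i \<in> Basis - D \<Longrightarrow> (bdom U \<phi> D i, bmap U \<phi> D i) \<in> BA"
  unfolding blup_atlas_def by auto

text \<open>From here on the general theory of charts is available for the blowup under the prefix
  \<open>B\<close>.\<close>

sublocale B: chart_atlas BA
proof
  fix c assume "c \<in> BA"
  then show "is_chart c"
    by (cases rule: blup_atlas_cases) (auto intro: off_chart chart_in_max is_chart_bchart[unfolded prod.collapse])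
next
  fix c c' assume c: "c \<in> BA" "c' \<in> BA"
  from c(1) show "compatible c c'"
  proof (cases rule: blup_atlas_cases)
    case off: (off U \<phi>)
    note U = chart_in_max[OF off(1)]
    from c(2) show ?thesis
    proof (cases rule: blup_atlas_cases)
      case off': (off V \<psi>)
      show ?thesis unfolding off off' by (rule compatible_off_off[OF U chart_in_max[OF off'(1)]])
    next
      case (exc V \<psi> D i)
      show ?thesis unfolding off exc by (rule compatible_sym[OF compatible_off_bchart[OF exc(1,2) U]])
    qed
  next
    case exc: (exc U \<phi> D i)
    from c(2) show ?thesis
    proof (cases rule: blup_atlas_cases)
      case (off V \<psi>)
      show ?thesis unfolding off exc by (rule compatible_off_bchart[OF exc(1,2) chart_in_max[OF off(1)]])
    next
      case exc': (exc V \<psi> D' i')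
      obtain S \<tau> where 1: "bmap U \<phi> D i ` (bdom U \<phi> D i \<inter> bdom V \<psi> D' i') = S" "open S" "smooth_on S \<tau>"
        "\<forall>b\<in>bdom U \<phi> D i \<inter> bdom V \<psi> D' i'. bmap V \<psi> D' i' b = \<tau> (bmap U \<phi> D i b)"
        using compatible_bchart[OF exc(1,2) exc'(1,2)] by blast
      obtain T \<sigma> where 2: "bmap V \<psi> D' i' ` (bdom V \<psi> D' i' \<inter> bdom U \<phi> D i) = T" "open T" "smooth_on T \<sigma>"
        "\<forall>b\<in>bdom V \<psi> D' i' \<inter> bdom U \<phi> D i. bmap U \<phi> D i b = \<sigma> (bmap V \<psi> D' i' b)"
        using compatible_bchart[OF exc'(1,2) exc(1,2)] by blast
      show ?thesis unfolding exc exc'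
        by (rule compatibleI[OF inj_bmap[OF exc(1,2)] inj_bmap[OF exc'(1,2)] 1(1-3) _ _ 2(2,3)])
          (use 1(4) 2(1,4) in \<open>auto simp: Int_commute\<close>)
    qed
  qed
qed

text \<open>A vector that is not tangent to N has a nonzero normal component, and that component
  selects the affine chart.\<close>

lemma exceptional_chart:
  assumes s: "slice U \<phi> D" and b: "b \<in> BP" "blowdown b \<in> U" "blowdown b \<in> N"
  obtains i where "i \<in> Basis - D" "b \<in> bdom U \<phi> D i"
proof -
  obtain y l where y: "b = Inr (y, l)" using b by (cases b) (auto simp: BP_Inl)
  have yN: "y \<in> U" "y \<in> N" "l \<in> proj_normal \<A> N y" using b y by (auto simp: BP_Inr)
  note r = proj_normal_rep[OF yN(3)]
  obtain i where "i \<in> Basis - D" "coords \<A> (U, \<phi>) y (SOME v. v \<in> l) \<bullet> i \<noteq> 0"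
    using r(2) sub_tangent_iff[OF s yN(1,2) r(1)] by blast
  then show ?thesis using that[of i] b y by (simp add: bdom_iff)
qed

lemma points_BA: "points BA = BP"
proof (intro set_eqI iffI)
  fix b assume "b \<in> points BA"
  then obtain c where c: "c \<in> BA" "b \<in> fst c" by (auto simp: points_def)
  from c(1) show "b \<in> BP"
  proof (cases rule: blup_atlas_cases)
    case (off U \<phi>)
    then show ?thesis using c(2) maxD(4)[OF chart_in_max[OF off(1)]] by (auto simp: BP_Inl)
  next
    case (exc U \<phi> D i)
    then show ?thesis using c(2) by (auto simp: bdom_iff)
  qed
next
  fix b assume b: "b \<in> BP"
  show "b \<in> points BA"
  proof (cases "blowdown b \<in> N")
    case True
    then obtain U \<phi> D where s: "blowdown b \<in> U" "slice U \<phi> D" using slice_exists by blast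
    obtain i where "i \<in> Basis - D" "b \<in> bdom U \<phi> D i" using exceptional_chart[OF s(2) b s(1) True] .
    then show ?thesis using bchart_in_BA[OF s(2), of i] unfolding points_def by (metis (no_types, lifting) UN_I case_prodI2 prod.simps(2))
  next
    case False
    obtain U \<phi> where U: "(U, \<phi>) \<in> \<A>" "blowdown b \<in> U" using point_chart[OF BP_blowdown[OF b]] .
    have "b \<in> Inl ` (U - N)" using BP_off_N[OF b False] U(2) False by blast
    then show ?thesis using off_in_BA[OF U(1)] unfolding points_def by (metis (no_types, lifting) UN_I prod.simps(2))
  qed
qed

lemma bchart_max: "slice U \<phi> D \<Longrightarrow> i \<in> Basis - D \<Longrightarrow> (bdom U \<phi> D i, bmap U \<phi> D i) \<in> max_atlas BA"
  by (rule B.chart_in_max[OF bchart_in_BA])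

lemma off_max: "(U, \<phi>) \<in> \<A> \<Longrightarrow> (Inl ` (U - N), \<phi> \<circ> blowdown) \<in> max_atlas BA"
  by (rule B.chart_in_max[OF off_in_BA])

section \<open>Functions on the blowup and density of the complement of the exceptional
  divisor\<close>

lemma smooth_near_blowdown:
  assumes "smooth_near \<A> f (blowdown b)" "b \<in> BP"
  shows "smooth_near BA (\<lambda>b. f (blowdown b)) b"
proof (cases "blowdown b \<in> N")
  case True
  then obtain U \<phi> D where s: "blowdown b \<in> U" "slice U \<phi> D" using slice_exists by blast
  obtain i where i: "i \<in> Basis - D" "b \<in> bdom U \<phi> D i" using exceptional_chart[OF s(2) assms(2) s(1) True] .
  note U = sliceD(1)[OF s(2)]
  obtain S where S: "open S" "\<phi> (blowdown b) \<in> S" "S \<subseteq> \<phi> ` U" "smooth_on S (f \<circ> inv_into U \<phi>)"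
    using smooth_near_chart[OF assms(1) U s(1)] .
  let ?T = "{u. blowdown_coords D i u \<in> S}"
  have o: "open ?T" by (rule open_blowdown_coords_vimage[OF S(1)])
  have sm: "smooth_on ?T (\<lambda>u. (f \<circ> inv_into U \<phi>) (blowdown_coords D i u))"
    by (rule smooth_on_compose[OF o S(1,4) smooth_on_blowdown_coords[OF o]]) auto
  have "smooth_near BA (\<lambda>b. (f \<circ> inv_into U \<phi>) (blowdown_coords D i (bmap U \<phi> D i b))) b"
    by (rule B.smooth_near_chart_fun[OF bchart_max[OF s(2) i(1)] i(2) o _ sm])
      (use bmap_blowdown[OF s(2) i] S in simp)
  then show ?thesis
  proof (rule B.smooth_near_cong[OF _ B.opn_chart[OF bchart_max[OF s(2) i(1)]] i(2)])
    fix b' assume "b' \<in> bdom U \<phi> D i"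
    then show "(f \<circ> inv_into U \<phi>) (blowdown_coords D i (bmap U \<phi> D i b')) = f (blowdown b')"
      using bmap_blowdown[OF s(2) i(1), of b', symmetric] maxD(2)[OF U] by (simp add: bdom_iff inv_into_f_f)
  qed
next
  case False
  obtain U \<phi> where U: "(U, \<phi>) \<in> \<A>" "blowdown b \<in> U" using point_chart[OF BP_blowdown[OF assms(2)]] .
  have bU: "b \<in> Inl ` (U - N)" using BP_off_N[OF assms(2) False] U(2) False by blast
  obtain S where S: "open S" "\<phi> (blowdown b) \<in> S" "S \<subseteq> \<phi> ` U" "smooth_on S (f \<circ> inv_into U \<phi>)"
    using smooth_near_chart[OF assms(1) chart_in_max[OF U(1)] U(2)] .
  have "smooth_near BA (\<lambda>b. (f \<circ> inv_into U \<phi>) ((\<phi> \<circ> blowdown) b)) b"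
    by (rule B.smooth_near_chart_fun[OF off_max[OF U(1)] bU S(1) _ S(4)]) (use S in simp)
  then show ?thesis
    by (rule B.smooth_near_cong[OF _ B.opn_chart[OF off_max[OF U(1)]] bU])
      (use maxD(2)[OF chart_in_max[OF U(1)]] in \<open>auto simp: inv_into_f_f\<close>)
qed

lemma smooth_near_Inl:
  assumes "smooth_near BA g (Inl x)"
  shows "smooth_near \<A> (\<lambda>x. g (Inl x)) x"
proof -
  have x: "x \<in> points \<A>" "x \<notin> N" using B.smooth_near_point[OF assms] by (auto simp: points_BA BP_Inl)
  obtain U \<phi> where U: "(U, \<phi>) \<in> \<A>" "x \<in> U" using point_chart[OF x(1)] .
  note m = chart_in_max[OF U(1)]
  have xU: "Inl x \<in> Inl ` (U - N)" using U x by blast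
  obtain S where S: "open S" "(\<phi> \<circ> blowdown) (Inl x) \<in> S" "S \<subseteq> (\<phi> \<circ> blowdown) ` (Inl ` (U - N))"
    "smooth_on S (g \<circ> inv_into (Inl ` (U - N)) (\<phi> \<circ> blowdown))"
    using B.smooth_near_chart[OF assms off_max[OF U(1)] xU] .
  have "smooth_on S ((\<lambda>x. g (Inl x)) \<circ> inv_into U \<phi>)"
  proof (rule smooth_on_eq[OF S(4,1)])
    fix z assume "z \<in> S"
    then obtain y where y: "z = \<phi> y" "y \<in> U" "y \<notin> N" using S(3) by auto
    have "inv_into (Inl ` (U - N)) (\<phi> \<circ> blowdown) ((\<phi> \<circ> blowdown) (Inl y)) = (Inl y :: 'm blup)"
      by (rule inv_into_f_f[OF is_chartD(1)[OF off_chart(1)[OF m]]]) (use y in blast)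
    then show "(g \<circ> inv_into (Inl ` (U - N)) (\<phi> \<circ> blowdown)) z = ((\<lambda>x. g (Inl x)) \<circ> inv_into U \<phi>) z"
      using y maxD(2)[OF m] by (simp add: inv_into_f_f)
  qed
  then show ?thesis using smooth_nearI[OF m U(2) S(1)] S(2) by simp
qed

lemma opn_blowdown_vimage:
  assumes W: "opn W"
  shows "B.opn {b \<in> BP. blowdown b \<in> W}"
proof (rule B.openin_mtopI)
  show "{b \<in> BP. blowdown b \<in> W} \<subseteq> points BA" by (auto simp: points_BA)
  fix V \<theta> assume "(V, \<theta>) \<in> BA"
  then show "open (\<theta> ` (V \<inter> {b \<in> BP. blowdown b \<in> W}))"
  proof (cases rule: blup_atlas_cases)
    case (off U \<phi>)
    note m = chart_in_max[OF off(1)]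
    have "V \<inter> {b \<in> BP. blowdown b \<in> W} = Inl ` (U \<inter> (W \<inter> (points \<A> - N)))"
      using off maxD(4)[OF m] by (auto simp: BP_Inl)
    moreover have "\<theta> = \<phi> \<circ> blowdown" using off by simp
    ultimately show ?thesis using openin_imp_open_image[OF openin_Int[OF W opn_off_N] m] by (simp add: image_image)
  next
    case (exc U \<phi> D i)
    have V: "V = bdom U \<phi> D i" "\<theta> = bmap U \<phi> D i"
      using arg_cong[OF exc(3), of fst] arg_cong[OF exc(3), of snd] by simp_all
    have "V \<inter> {b \<in> BP. blowdown b \<in> W} = {b \<in> bdom U \<phi> D i. blowdown b \<in> U \<inter> W}"
      unfolding V by (auto simp: bdom_iff)
    with V show ?thesis
      using bmap_image[OF exc(1,2), of "U \<inter> W"]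
        open_blowdown_coords_vimage[OF openin_imp_open_image[OF W sliceD(1)[OF exc(1)]]] by simp
  qed
qed

lemma opn_Inl_vimage:
  assumes W: "B.opn W"
  shows "opn {x. Inl x \<in> W}"
proof (rule openin_mtopI)
  have "W \<subseteq> BP" using B.opn_subset[OF W] points_BA by simp
  then have WN: "x \<in> points \<A>" "x \<notin> N" if "Inl x \<in> W" for x using that BP_Inl by blast+
  show "{x. Inl x \<in> W} \<subseteq> points \<A>" using WN by blast
  fix U \<phi> assume U: "(U, \<phi>) \<in> \<A>"
  have "Inl ` (U - N) \<inter> W = Inl ` (U \<inter> {x. Inl x \<in> W})" using WN by auto
  then show "open (\<phi> ` (U \<inter> {x. Inl x \<in> W}))"
    using B.openin_imp_open_image_atlas[OF W off_in_BA[OF U]] by (simp add: image_image)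
qed

lemma Inl_dense:
  assumes W: "B.opn W" "b \<in> W"
  obtains x where "Inl x \<in> W"
proof (cases "blowdown b \<in> N")
  case False
  have "b \<in> BP" using B.opn_subset[OF W(1)] W(2) by (auto simp: points_BA)
  then have "b = Inl (blowdown b)" using BP_off_N False by blast
  then show ?thesis using that W(2) by metis
next
  case True
  have b: "b \<in> BP" using B.opn_subset[OF W(1)] W(2) by (auto simp: points_BA)
  obtain U \<phi> D where s: "blowdown b \<in> U" "slice U \<phi> D" using slice_exists[OF True] by blast
  obtain i where i: "i \<in> Basis - D" "b \<in> bdom U \<phi> D i" using exceptional_chart[OF s(2) b s(1) True] .
  let ?S = "bmap U \<phi> D i ` (bdom U \<phi> D i \<inter> W)"
  have "open ?S" by (rule B.openin_imp_open_image[OF W(1) bchart_max[OF s(2) i(1)]])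
  moreover have "bmap U \<phi> D i b \<in> ?S" using i W by blast
  ultimately obtain r where r: "r > 0" "ball (bmap U \<phi> D i b) r \<subseteq> ?S" using openE by blast
  \<comment> \<open>A move by r/2 in the direction i makes the coordinate u_i nonzero and so leaves
    the exceptional divisor.\<close>
  let ?u = "bmap U \<phi> D i b + (r / 2) *\<^sub>R i"
  have "?u \<in> ball (bmap U \<phi> D i b) r" using r(1) i by (simp add: dist_norm)
  then obtain b' where b': "b' \<in> bdom U \<phi> D i" "b' \<in> W" "?u = bmap U \<phi> D i b'" using r(2) by blast
  have "?u \<bullet> i \<noteq> 0" using bmap_zero_iff[OF s(2) i] True i(1) r(1) by (simp add: inner_add_left)
  then have "blowdown b' \<notin> N" using bmap_zero_iff[OF s(2) i(1) b'(1)] b'(3) by simp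
  then have "b' = Inl (blowdown b')" using BP_off_N b'(1) by (simp add: bdom_iff)
  then show ?thesis using that b'(2) by metis
qed

lemma smooth_agree:
  assumes W: "B.opn W" and f: "\<And>b. b \<in> W \<Longrightarrow> smooth_near BA f b" and g: "\<And>b. b \<in> W \<Longrightarrow> smooth_near BA g b"
    and e: "\<And>x. Inl x \<in> W \<Longrightarrow> f (Inl x) = g (Inl x)" and b: "b \<in> W"
  shows "f b = g b"
proof (rule ccontr)
  assume n: "f b \<noteq> g b"
  have o: "B.opn {b \<in> W. f b - g b \<in> - {0}}"
    by (rule B.opn_smooth_preimage[OF W]) (use f g B.smooth_near_minus in auto)
  have "b \<in> {b \<in> W. f b - g b \<in> - {0}}" using n b by simp
  then obtain x where "Inl x \<in> {b \<in> W. f b - g b \<in> - {0}}" using Inl_dense[OF o] by blast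
  then show False using e by auto
qed

text \<open>Local extensions match automatically: on an overlap they agree at the points
  \<open>Inl x\<close>, which are dense, hence everywhere. The diagonal choice
  \<open>G b = f b b\<close> therefore glues them.\<close>

lemma smooth_extension:
  assumes "\<And>b. b \<in> BP \<Longrightarrow> \<exists>W f. B.opn W \<and> b \<in> W \<and> (\<forall>b\<in>W. smooth_near BA f b) \<and> (\<forall>x. Inl x \<in> W \<longrightarrow> f (Inl x) = h x)"
  obtains G where "G \<in> smooth_funs BA" "\<forall>x\<in>points \<A> - N. G (Inl x) = h x"
proof -
  have "\<forall>b. \<exists>W f. b \<in> BP \<longrightarrow> B.opn W \<and> b \<in> W \<and> (\<forall>b\<in>W. smooth_near BA f b) \<and> (\<forall>x. Inl x \<in> W \<longrightarrow> f (Inl x) = h x)"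
    using assms by blast
  then obtain W f where Wf: "\<And>b. b \<in> BP \<Longrightarrow> B.opn (W b) \<and> b \<in> W b \<and> (\<forall>b'\<in>W b. smooth_near BA (f b) b') \<and>
      (\<forall>x. Inl x \<in> W b \<longrightarrow> f b (Inl x) = h x)" by metis
  define G where "G b = f b b" for b
  have G: "G b' = f b b'" if b: "b \<in> BP" and b': "b' \<in> W b" for b b'
  proof -
    have bb: "b' \<in> BP" using B.opn_subset[of "W b"] Wf[OF b] b' by (auto simp: points_BA)
    show ?thesis unfolding G_def
      by (rule smooth_agree[of "W b \<inter> W b'" "f b'" "f b"]) (use Wf[OF b] Wf[OF bb] b' in auto)
  qed
  show ?thesis
  proof (rule that[of G]; (intro ballI)?)
    show "G \<in> smooth_funs BA" unfolding B.smooth_funs_iff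
    proof
      fix b assume "b \<in> points BA"
      then have b: "b \<in> BP" by (simp add: points_BA)
      show "smooth_near BA G b"
        by (rule B.smooth_near_cong[of "f b" b "W b"]) (use Wf[OF b] G[OF b] in auto)
    qed
    fix x assume "x \<in> points \<A> - N"
    then have "Inl x \<in> BP" by (simp add: BP_Inl)
    then show "G (Inl x) = h x" using Wf G_def by metis
  qed
qed

text \<open>Used to push the compact support of a section of the blowup forward to a compact set in
  M.\<close>

lemma continuous_blowdown: "continuous_map (mtop BA) (mtop \<A>) blowdown"
  unfolding continuous_map_def topspace_mtop B.topspace_mtop points_BA
  using opn_blowdown_vimage BP_blowdown by auto

end

section \<open>Lifting vector fields to the blowup\<close>


lemma vector_fieldsD:
  assumes "X \<in> vector_fields \<A>"
  shows "x \<in> points \<A> \<Longrightarrow> X x \<in> tangent_space \<A> x" "x \<notin> points \<A> \<Longrightarrow> X x = (\<lambda>_. 0)"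
    "f \<in> smooth_funs \<A> \<Longrightarrow> (\<lambda>x. X x f) \<in> smooth_funs \<A>"
  using assms by (auto simp: vector_fields_def)

context chart_atlas begin

lemma vector_fields_lin:
  assumes X: "X \<in> vector_fields \<A>" and Y: "Y \<in> vector_fields \<A>" and f: "f \<in> smooth_funs \<A>"
  shows "(\<lambda>x g. f x * X x g + Y x g) \<in> vector_fields \<A>"
  unfolding vector_fields_def
  using vector_fieldsD[OF X] vector_fieldsD[OF Y]
  by (auto intro!: tangent_space_lin smooth_funs_add smooth_funs_mult f)

lemma vector_fields_0: "(\<lambda>x g. 0) \<in> vector_fields \<A>"
  by (auto simp: vector_fields_def tangent_space_0 smooth_funs_const)

end

context submanifold begin

lemma smooth_funs_blowdown:
  assumes "f \<in> smooth_funs \<A>"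
  shows "(\<lambda>b. f (blowdown b)) \<in> smooth_funs BA"
  unfolding B.smooth_funs_iff
  using smooth_near_blowdown smooth_funs_nearD[OF assms] BP_blowdown points_BA by auto

lemma local_descent:
  assumes "g \<in> smooth_funs BA" "x \<in> points \<A>" "x \<notin> N"
  shows "\<exists>f X. f \<in> smooth_funs \<A> \<and> opn X \<and> x \<in> X \<and> (\<forall>y\<in>X. f y = g (Inl y))"
proof -
  have "Inl x \<in> points BA" using assms by (simp add: points_BA BP_Inl)
  then have "smooth_near \<A> (\<lambda>x. g (Inl x)) x" using smooth_near_Inl B.smooth_funs_nearD[OF assms(1)] by blast
  then show ?thesis by (rule extend_germ) blast
qed

text \<open>Off the exceptional divisor every smooth function is near a given point a pullback from
  M, so a tangent vector there is determined by its values on pullbacks.\<close>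

lemma tangent_off_descent:
  assumes v: "v \<in> tangent_space BA (Inl x)" and x: "x \<in> points \<A>" "x \<notin> N"
    and g: "g \<in> smooth_funs BA" and f: "f \<in> smooth_funs \<A>"
    and X: "opn X" "x \<in> X" "\<forall>y\<in>X. f y = g (Inl y)"
  shows "v g = v (\<lambda>b. f (blowdown b))"
proof -
  obtain \<kappa> K Y where b: "\<kappa> \<in> smooth_funs \<A>" "K \<subseteq> X \<inter> (points \<A> - N)"
    "x \<in> Y" "\<And>y. y \<in> Y \<Longrightarrow> \<kappa> y = 1" "\<And>y. y \<notin> K \<Longrightarrow> \<kappa> y = 0"
    using bump[OF openin_Int[OF X(1) opn_off_N], of x] X(2) x by (metis Diff_iff IntI)
  \<comment> \<open>\<open>tangent_local\<close> asks for its identity at all elements of the type,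
    so the pulled-back cutoff is set to 0 outside the blowup.\<close>
  let ?\<kappa> = "\<lambda>b. if b \<in> BP then \<kappa> (blowdown b) else 0"
  have k: "?\<kappa> \<in> smooth_funs BA"
    by (rule B.smooth_funs_cong[OF smooth_funs_blowdown[OF b(1)]]) (simp add: points_BA)
  have "?\<kappa> c * (g c - f (blowdown c)) = 0" for c
  proof (cases "c \<in> BP \<and> blowdown c \<in> K")
    case True
    then have "c = Inl (blowdown c)" using BP_off_N b(2) by blast
    then have "g c = g (Inl (blowdown c))" by simp
    also have "\<dots> = f (blowdown c)" using X(3) b(2) True by auto
    finally show ?thesis by simp
  next
    case False
    then show ?thesis using b(5) by auto
  qed
  then show ?thesis
    using B.tangent_local[OF v g smooth_funs_blowdown[OF f] k] x b(3,4) X(2,3) by (simp add: BP_Inl)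
qed

text \<open>Off the exceptional divisor the two fields agree on every function by descent to M. On
  the divisor they agree because both sides are smooth in the base point and the complement is
  dense.\<close>

lemma vector_field_unique:
  assumes X: "X \<in> vector_fields BA" and X': "X' \<in> vector_fields BA"
    and e: "\<And>x f. x \<in> points \<A> \<Longrightarrow> x \<notin> N \<Longrightarrow> f \<in> smooth_funs \<A> \<Longrightarrow>
      X (Inl x) (\<lambda>b. f (blowdown b)) = X' (Inl x) (\<lambda>b. f (blowdown b))"
  shows "X = X'"
proof (intro ext)
  fix b g
  show "X b g = X' b g"
  proof (cases "b \<in> BP \<and> g \<in> smooth_funs BA")
    case False
    then show ?thesis
    proof (cases "b \<in> BP")
      case True
      then have "g \<notin> smooth_funs BA" using False by blast
      then show ?thesis
        using tangent_spaceD(1)[OF vector_fieldsD(1)[OF X]] tangent_spaceD(1)[OF vector_fieldsD(1)[OF X']] True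
        by (simp add: points_BA)
    qed (simp add: vector_fieldsD(2)[OF X] vector_fieldsD(2)[OF X'] points_BA)
  next
    case True
    then have g: "g \<in> smooth_funs BA" by blast
    show ?thesis
    proof (rule smooth_agree[of BP "\<lambda>b. X b g" "\<lambda>b. X' b g"])
      show "B.opn BP" using B.opn_points by (simp add: points_BA)
      show "smooth_near BA (\<lambda>b. X b g) b" "smooth_near BA (\<lambda>b. X' b g) b" if "b \<in> BP" for b
        using B.smooth_funs_nearD[OF vector_fieldsD(3)[OF X g]] B.smooth_funs_nearD[OF vector_fieldsD(3)[OF X' g]] that
        by (simp_all add: points_BA)
      show "b \<in> BP" using True by blast
      fix x assume xB: "Inl x \<in> BP"
      then have x: "x \<in> points \<A>" "x \<notin> N" by (auto simp: BP_Inl)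
      obtain f W where f: "f \<in> smooth_funs \<A>" "opn W" "x \<in> W" "\<forall>y\<in>W. f y = g (Inl y)"
        using local_descent[OF g x] by blast
      have p: "Inl x \<in> points BA" using xB by (simp add: points_BA)
      show "X (Inl x) g = X' (Inl x) g"
        using tangent_off_descent[OF vector_fieldsD(1)[OF X p] x g f]
          tangent_off_descent[OF vector_fieldsD(1)[OF X' p] x g f] e[OF x f(1)] by simp
    qed
  qed
qed

text \<open>A vector field \<open>Z\<close> along the blowdown map that is tangent to \<open>N\<close> over the exceptional
  divisor lifts: in an affine chart the coordinates of the lift are \<open>Z x\<^sub>j\<close> for \<open>j \<in> D\<close> and
  \<open>j = i\<close>, and \<open>(Z x\<^sub>j - u\<^sub>j Z x\<^sub>i) / u\<^sub>i\<close> otherwise, where the numerator vanishes on \<open>u\<^sub>i = 0\<close>.\<close>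

lemma chart_lift:
  assumes Zt: "\<And>b. b \<in> BP \<Longrightarrow> Z b \<in> tangent_space \<A> (blowdown b)"
    and Zs: "\<And>f. f \<in> smooth_funs \<A> \<Longrightarrow> (\<lambda>b. Z b f) \<in> smooth_funs BA"
    and ZN: "\<And>b. b \<in> BP \<Longrightarrow> blowdown b \<in> N \<Longrightarrow> Z b \<in> sub_tangent_space \<A> N (blowdown b)"
    and g: "g \<in> smooth_funs BA" and b0: "b0 \<in> BP" "blowdown b0 \<in> N"
    and h: "\<And>x f X. x \<in> points \<A> \<Longrightarrow> x \<notin> N \<Longrightarrow> f \<in> smooth_funs \<A> \<Longrightarrow> opn X \<Longrightarrow> x \<in> X \<Longrightarrow>
      \<forall>y\<in>X. f y = g (Inl y) \<Longrightarrow> h x = Z (Inl x) f"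
  shows "\<exists>W f. B.opn W \<and> b0 \<in> W \<and> (\<forall>b\<in>W. smooth_near BA f b) \<and> (\<forall>x. Inl x \<in> W \<longrightarrow> f (Inl x) = h x)"
proof -
  obtain U \<phi> D where s: "blowdown b0 \<in> U" "slice U \<phi> D" using slice_exists[OF b0(2)] by blast
  obtain i where i: "i \<in> Basis - D" "b0 \<in> bdom U \<phi> D i" using exceptional_chart[OF s(2) b0(1) s(1) b0(2)] .
  have iB: "i \<in> Basis" using i by simp
  note U = sliceD(1)[OF s(2)]
  note m = bchart_max[OF s(2) i(1)]
  obtain \<zeta> Y where *: "\<forall>j. \<zeta> j \<in> smooth_funs \<A>" "opn Y" "blowdown b0 \<in> Y" "Y \<subseteq> U" "\<forall>y\<in>Y. \<forall>i. \<zeta> i y = \<phi> y \<bullet> i"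
      "\<forall>y i. \<zeta> i y \<noteq> 0 \<longrightarrow> y \<in> U \<and> \<phi> y \<bullet> i \<noteq> 0"
    by (rule cut_coordinate[OF U s(1)]) (rule that)
  note z = *(1)[rule_format] *(2-4) *(5)[rule_format] *(6)[rule_format]
  let ?bd = "bdom U \<phi> D i" and ?bm = "bmap U \<phi> D i"
  let ?S = "?bm ` ?bd"
  have S: "open ?S" by (rule B.maxD(3)[OF m])
  have inv: "inv_into ?bd ?bm (?bm b) = b" if "b \<in> ?bd" for b by (rule inv_into_f_f[OF B.maxD(2)[OF m] that])
  have bdBP: "?bd \<inter> points BA = ?bd" by (auto simp: bdom_iff points_BA)
  have sm: "smooth_on ?S (f \<circ> inv_into ?bd ?bm)" if "f \<in> smooth_funs BA" for f
    using that bchart_in_BA[OF s(2) i(1)] bdBP by (force simp: smooth_funs_on_def)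
  define A where "A j = (\<lambda>b. Z b (\<zeta> j)) \<circ> inv_into ?bd ?bm" for j
  have A: "smooth_on ?S (A j)" for j unfolding A_def by (rule sm[OF Zs[OF z(1)]])
  define gc where "gc = g \<circ> inv_into ?bd ?bm"
  have gc: "smooth_on ?S gc" unfolding gc_def by (rule sm[OF g])
  define E where "E j u = A j u - (u \<bullet> j) * A i u" for j u
  have E: "smooth_on ?S (E j)" for j unfolding E_def
    by (intro smooth_on_minus smooth_on_mult smooth_on_inner_left smooth_on_id S A)
  define Q where "Q j = (\<lambda>u. if u \<bullet> i = 0 then frechet_derivative (E j) (at u) i else E j u / (u \<bullet> i))" for j
  \<comment> \<open>Where u_i = 0 the vector Z b is tangent to N, and it annihilates the cut normal
    coordinates because they vanish on N.\<close>
  have A0: "A j u = 0" if j: "j \<in> Basis - D" and u: "u \<in> ?S" "u \<bullet> i = 0" for j u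
  proof -
    obtain b where b: "b \<in> ?bd" "u = ?bm b" using u by blast
    have bN: "blowdown b \<in> N" using bmap_zero_iff[OF s(2) i(1) b(1)] u b by simp
    have "\<zeta> j y = 0" if "y \<in> N" for y using z(6)[of j y] sliceD(3)[OF s(2), of y] that j by blast
    then have "Z b (\<zeta> j) = 0" using ZN[of b] bN b(1) z(1) by (auto simp: bdom_iff sub_tangent_space_def)
    then show ?thesis by (simp add: A_def b inv[OF b(1)])
  qed
  have Q: "smooth_on ?S (Q j)" if "j \<in> Basis - D" for j
    unfolding Q_def by (rule hadamard_divide[OF S E iB]) (use A0 that i in \<open>auto simp: E_def\<close>)
  define \<xi> where "\<xi> u j = (if j \<in> D \<or> j = i then A j u else Q j u)" for u j
  define G where "G u = (\<Sum>j\<in>Basis. \<xi> u j * frechet_derivative gc (at u) j)" for u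
  have "smooth_on ?S (\<lambda>u. \<xi> u j)" if "j \<in> Basis" for j
    by (cases "j \<in> D \<or> j = i") (use A Q that in \<open>auto simp: \<xi>_def\<close>)
  then have G: "smooth_on ?S G" unfolding G_def
    by (intro smooth_on_sum smooth_on_mult S smooth_on_frechet_derivative gc)
  \<comment> \<open>Over Y the cut coordinates are the true ones, so that off the exceptional
    divisor \<open>A j\<close> is the j-th component of Z.\<close>
  let ?W = "?bd \<inter> {b \<in> BP. blowdown b \<in> Y}"
  have 1: "B.opn ?W" by (intro openin_Int B.opn_chart[OF m] opn_blowdown_vimage z(2))
  have 2: "b0 \<in> ?W" using i b0 z(3) by blast
  have 3: "smooth_near BA (\<lambda>b. G (?bm b)) b" if "b \<in> ?W" for b
    by (rule B.smooth_near_chart_fun[OF m _ S _ G]) (use that in auto)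
  have 4: "G (?bm (Inl x)) = h x" if "Inl x \<in> ?W" for x
  proof -
    let ?b = "Inl x :: 'm blup" and ?z = "\<phi> x"
    have x: "x \<in> points \<A>" "x \<notin> N" "x \<in> U" "x \<in> Y" "?b \<in> ?bd" using that by (auto simp: BP_Inl bdom_iff)
    have zi: "?z \<bullet> i \<noteq> 0" using x(5) by (simp add: bdom_iff)
    let ?u = "?bm ?b"
    have ui: "?u \<bullet> i = ?z \<bullet> i" using iB by (simp add: bmap_inner)
    have uS: "?u \<in> ?S" using x by blast
    have Zb: "Z ?b \<in> tangent_space \<A> x" using Zt[of ?b] x by (simp add: BP_Inl)
    define w where "w = coords \<A> (U, \<phi>) x (Z ?b)"
    have w: "w \<bullet> j = A j ?u" for j unfolding w_def A_def
      using coords_component[OF U x(3) Zb z(1,2) x(4) z(4), of j j] z(5) inv[OF x(5)] by simp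
    obtain f X where f: "f \<in> smooth_funs \<A>" "opn X" "x \<in> X" "\<forall>y\<in>X. f y = g (Inl y)"
      using local_descent[OF g x(1,2)] by blast
    have hx: "h x = chart_derivative U \<phi> x f w"
      using h[OF x(1,2) f] coords_eq[OF U x(3) Zb f(1)] w_def by simp
    \<comment> \<open>Off the exceptional divisor the affine chart is \<open>?q\<close> applied
      after \<phi>, and \<open>?q'\<close> is its derivative by the quotient rule. The chain rule
      then identifies the value of Z on a local representative of g with \<open>G\<close>.\<close>
    let ?q = "\<lambda>z. \<Sum>j\<in>Basis. (if j \<in> D \<or> j = i then z \<bullet> j else (z \<bullet> j) / (z \<bullet> i)) *\<^sub>R j"
    let ?q' = "\<lambda>v. \<Sum>j\<in>Basis. (if j \<in> D \<or> j = i then v \<bullet> j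
       else ((v \<bullet> j) * (?z \<bullet> i) - (?z \<bullet> j) * (v \<bullet> i)) / ((?z \<bullet> i) * (?z \<bullet> i))) *\<^sub>R j"
    have q: "?bm (Inl y) = ?q (\<phi> y)" for y
      by (rule euclidean_eqI) (simp add: bmap_inner inner_sum_left_Basis)
    have "((\<lambda>z. if j \<in> D \<or> j = i then z \<bullet> j else (z \<bullet> j) / (z \<bullet> i)) has_derivative
      (\<lambda>v. if j \<in> D \<or> j = i then v \<bullet> j
       else ((v \<bullet> j) * (?z \<bullet> i) - (?z \<bullet> j) * (v \<bullet> i)) / ((?z \<bullet> i) * (?z \<bullet> i)))) (at ?z)" for j
    proof (cases "j \<in> D \<or> j = i")
      case True
      then show ?thesis by (auto intro!: derivative_eq_intros)
    next
      case False
      have "((\<lambda>z. z \<bullet> k) has_derivative (\<lambda>v. v \<bullet> k)) (at ?z)" for k :: 'e by (auto intro!: derivative_eq_intros)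
      from has_derivative_divide'[OF this[of j] this[of i] zi] show ?thesis using False by simp
    qed
    then have q': "(?q has_derivative ?q') (at ?z)"
      by (intro has_derivative_sum has_derivative_scaleR_left)
    have gu: "(gc has_derivative frechet_derivative gc (at ?u)) (at (?q ?z))"
      using smooth_on_has_derivative[OF gc uS] q[of x] by simp
    let ?T = "\<phi> ` (U \<inter> (X \<inter> (U \<inter> \<phi> -` {z. z \<bullet> i \<noteq> 0})))"
    have oi: "open {z::'e. z \<bullet> i \<noteq> 0}" by (intro open_Collect_neq continuous_intros)
    have oT: "open ?T" by (intro openin_imp_open_image openin_Int opn_chart_preimage U f(2) oi)
    have eq: "gc (?q z') = (f \<circ> inv_into U \<phi>) z'" if "z' \<in> ?T" for z'
    proof -
      obtain y where y: "z' = \<phi> y" "y \<in> U" "y \<in> X" "\<phi> y \<bullet> i \<noteq> 0" using \<open>z' \<in> ?T\<close> by blast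
      have "y \<notin> N" using sliceD(3)[OF s(2) y(2)] y(4) i(1) by blast
      then have "Inl y \<in> ?bd" using y maxD(4)[OF U] by (auto simp: bdom_iff BP_Inl)
      then have "gc (?q (\<phi> y)) = g (Inl y)" using q[of y] inv[of "Inl y"] by (simp add: gc_def)
      then show ?thesis unfolding y(1) using y(2,3) f(4) maxD(2)[OF U] by (simp add: inv_into_f_f)
    qed
    have "((f \<circ> inv_into U \<phi>) has_derivative (\<lambda>v. frechet_derivative gc (at ?u) (?q' v))) (at ?z)"
      by (rule has_derivative_transform_within_open[OF has_derivative_compose[OF q' gu] oT])
        (use x f(3) zi eq in auto)
    from frechet_derivative_at[OF this, symmetric]
    have "chart_derivative U \<phi> x f w = frechet_derivative gc (at ?u) (?q' w)" by simp
    also have "\<dots> = (\<Sum>j\<in>Basis. (?q' w \<bullet> j) * frechet_derivative gc (at ?u) j)"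
      using frechet_derivative_sum_Basis[OF smooth_on_has_derivative[OF gc uS], of "?q' w"] by simp
    also have "\<dots> = G ?u" unfolding G_def
    proof (rule sum.cong[OF refl])
      fix j :: 'e assume j: "j \<in> Basis"
      have "?q' w \<bullet> j = \<xi> ?u j"
      proof (cases "j \<in> D \<or> j = i")
        case True
        then show ?thesis using j w by (simp add: \<xi>_def inner_sum_left_Basis)
      next
        case False
        then have uj: "?u \<bullet> j = (?z \<bullet> j) / (?z \<bullet> i)" using j by (simp add: bmap_inner)
        have "?q' w \<bullet> j = (A j ?u * (?z \<bullet> i) - (?z \<bullet> j) * A i ?u) / ((?z \<bullet> i) * (?z \<bullet> i))"
          unfolding inner_sum_left_Basis[OF j] using False by (simp add: w)
        also have "\<dots> = E j ?u / (?z \<bullet> i)" unfolding E_def uj using zi by (simp add: field_simps)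
        also have "\<dots> = \<xi> ?u j" using False zi ui by (simp add: \<xi>_def Q_def)
        finally show ?thesis .
      qed
      then show "(?q' w \<bullet> j) * frechet_derivative gc (at ?u) j = \<xi> ?u j * frechet_derivative gc (at ?u) j" by simp
    qed
    finally show ?thesis using hx by simp
  qed
  show ?thesis using 1 2 3 4 by (intro exI[of _ ?W] exI[of _ "\<lambda>b. G (?bm b)"]) blast
qed

text \<open>The lift is built one function at a time. Off the exceptional divisor g is locally the
  pullback of a function f on M, and the value is that of Z on f; \<open>chart_lift\<close> extends
  it smoothly across the divisor. Linearity and the product rule hold off the divisor because Z is a
  derivation, and pass to the divisor by density.\<close>

lemma vector_field_lift:
  assumes Zt: "\<And>b. b \<in> BP \<Longrightarrow> Z b \<in> tangent_space \<A> (blowdown b)"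
    and Zs: "\<And>f. f \<in> smooth_funs \<A> \<Longrightarrow> (\<lambda>b. Z b f) \<in> smooth_funs BA"
    and ZN: "\<And>b. b \<in> BP \<Longrightarrow> blowdown b \<in> N \<Longrightarrow> Z b \<in> sub_tangent_space \<A> N (blowdown b)"
  shows "\<exists>X\<in>vector_fields BA. \<forall>b\<in>BP. \<forall>f\<in>smooth_funs \<A>. X b (\<lambda>b. f (blowdown b)) = Z b f"
proof -
  \<comment> \<open>f represents g near x; by locality of derivations the value of Z on f does not
    depend on the representative.\<close>
  define near where "near g x f \<longleftrightarrow> f \<in> smooth_funs \<A> \<and> (\<exists>X. opn X \<and> x \<in> X \<and> (\<forall>y\<in>X. f y = g (Inl y)))"
    for g :: "'m blup \<Rightarrow> real" and x f
  define h where "h g x = Z (Inl x) (SOME f. near g x f)" for g x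
  have ZI: "Z (Inl x) \<in> tangent_space \<A> x" if "x \<in> points \<A>" "x \<notin> N" for x
    using Zt[of "Inl x"] that by (simp add: BP_Inl)
  have h: "h g x = Z (Inl x) f" if x: "x \<in> points \<A>" "x \<notin> N" and f: "near g x f" for g x f
  proof -
    define f' where "f' = (SOME f. near g x f)"
    have f': "near g x f'" unfolding f'_def using someI[of "near g x", OF f] .
    obtain X X' where X: "opn X" "x \<in> X" "\<forall>y\<in>X. f y = g (Inl y)" "opn X'" "x \<in> X'" "\<forall>y\<in>X'. f' y = g (Inl y)"
      using f f' unfolding near_def by blast
    have "Z (Inl x) f' = Z (Inl x) f"
      by (rule tangent_germ[OF ZI[OF x] _ _ openin_Int[OF X(1,4)]]) (use X f f' in \<open>auto simp: near_def\<close>)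
    then show ?thesis by (simp add: h_def f'_def)
  qed
  have near_ex: "\<exists>f. near g x f" if "g \<in> smooth_funs BA" "x \<in> points \<A>" "x \<notin> N" for g x
    using local_descent[OF that] unfolding near_def by blast
  have ext: "\<exists>G. G \<in> smooth_funs BA \<and> (\<forall>x\<in>points \<A> - N. G (Inl x) = h g x)" if g: "g \<in> smooth_funs BA" for g
  proof -
    have "\<exists>W f. B.opn W \<and> b \<in> W \<and> (\<forall>b\<in>W. smooth_near BA f b) \<and> (\<forall>x. Inl x \<in> W \<longrightarrow> f (Inl x) = h g x)"
      if b: "b \<in> BP" for b
    proof (cases "blowdown b \<in> N")
      case True
      have hl: "h g x = Z (Inl x) f" if "x \<in> points \<A>" "x \<notin> N" "f \<in> smooth_funs \<A>" "opn X" "x \<in> X"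
        "\<forall>y\<in>X. f y = g (Inl y)" for x f X
        by (rule h) (use that near_def in blast)+
      show ?thesis by (rule chart_lift[OF Zt Zs ZN g b True hl])
    next
      case False
      have x0: "blowdown b \<in> points \<A>" by (rule BP_blowdown[OF b])
      obtain f X where f: "f \<in> smooth_funs \<A>" "opn X" "blowdown b \<in> X" "\<forall>y\<in>X. f y = g (Inl y)"
        using local_descent[OF g x0 False] by blast
      let ?W = "{b \<in> BP. blowdown b \<in> X}"
      have "Z (Inl x) f = h g x" if "Inl x \<in> ?W" for x
      proof -
        have "near g x f" using that f unfolding near_def by auto
        then show ?thesis using h[of x g f] that by (simp add: BP_Inl)
      qed
      moreover have "\<forall>b\<in>?W. smooth_near BA (\<lambda>b. Z b f) b"
        using B.smooth_funs_nearD[OF Zs[OF f(1)]] by (simp add: points_BA)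
      ultimately show ?thesis using opn_blowdown_vimage[OF f(2)] b f(3)
        by (intro exI[of _ ?W] exI[of _ "\<lambda>b. Z b f"]) blast
    qed
    then obtain G where "G \<in> smooth_funs BA" "\<forall>x\<in>points \<A> - N. G (Inl x) = h g x"
      by (rule smooth_extension) (assumption | rule that)+
    then show ?thesis by blast
  qed
  define T where "T g = (SOME G. G \<in> smooth_funs BA \<and> (\<forall>x\<in>points \<A> - N. G (Inl x) = h g x))" for g
  have T: "T g \<in> smooth_funs BA" "\<And>x. x \<in> points \<A> \<Longrightarrow> x \<notin> N \<Longrightarrow> T g (Inl x) = h g x" if "g \<in> smooth_funs BA" for g
    using someI_ex[OF ext[OF that]] unfolding T_def by auto
  have agree: "f b = g b" if f: "f \<in> smooth_funs BA" and g: "g \<in> smooth_funs BA" and b: "b \<in> BP"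
    and e: "\<And>x. x \<in> points \<A> \<Longrightarrow> x \<notin> N \<Longrightarrow> f (Inl x) = g (Inl x)" for f g b
    using smooth_agree[of BP f g b] B.opn_points B.smooth_funs_nearD[OF f] B.smooth_funs_nearD[OF g] e b
    by (simp add: points_BA BP_Inl)
  have near_lin: "near (\<lambda>z. c * f z + g z) x (\<lambda>z. c * f' z + g' z)"
    and near_mult: "near (\<lambda>z. f z * g z) x (\<lambda>z. f' z * g' z)" if n: "near f x f'" "near g x g'" for f g x f' g' c
  proof -
    obtain X X' where X: "opn X" "x \<in> X" "\<forall>y\<in>X. f' y = f (Inl y)" "opn X'" "x \<in> X'" "\<forall>y\<in>X'. g' y = g (Inl y)"
      using n unfolding near_def by blast
    have "opn (X \<inter> X')" using X by blast
    then show "near (\<lambda>z. c * f z + g z) x (\<lambda>z. c * f' z + g' z)" "near (\<lambda>z. f z * g z) x (\<lambda>z. f' z * g' z)"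
      using X n unfolding near_def
      by (auto intro!: smooth_funs_add smooth_funs_mult smooth_funs_const exI[of _ "X \<inter> X'"])
  qed
  \<comment> \<open>The value 0 outside the blowup and on functions that are not smooth follows the
    conventions of \<open>vector_fields\<close> and \<open>tangent_space\<close>.\<close>
  define X where "X b g = (if b \<in> BP \<and> g \<in> smooth_funs BA then T g b else 0)" for b g
  have "X \<in> vector_fields BA" unfolding vector_fields_def
  proof (intro CollectI conjI ballI allI impI)
    fix b assume "b \<in> points BA"
    then have b: "b \<in> BP" by (simp add: points_BA)
    have lin: "T (\<lambda>z. c * f z + g z) b = c * T f b + T g b"
      and mult: "T (\<lambda>z. f z * g z) b = f b * T g b + g b * T f b"
      if f: "f \<in> smooth_funs BA" and g: "g \<in> smooth_funs BA" for f g c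
    proof -
      have s: "(\<lambda>z. c * f z + g z) \<in> smooth_funs BA" "(\<lambda>z. f z * g z) \<in> smooth_funs BA"
        using f g by (auto intro!: B.smooth_funs_add B.smooth_funs_mult B.smooth_funs_const)
      have r: "h (\<lambda>z. c * f z + g z) x = c * h f x + h g x"
        "h (\<lambda>z. f z * g z) x = f (Inl x) * h g x + g (Inl x) * h f x" if x: "x \<in> points \<A>" "x \<notin> N" for x
      proof -
        obtain f' g' where n: "near f x f'" "near g x g'" using near_ex f g x by blast
        have n': "f' \<in> smooth_funs \<A>" "g' \<in> smooth_funs \<A>" "f' x = f (Inl x)" "g' x = g (Inl x)"
          using n unfolding near_def by auto
        show "h (\<lambda>z. c * f z + g z) x = c * h f x + h g x"
          unfolding h[OF x n(1)] h[OF x n(2)] h[OF x near_lin[OF n]]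
          by (rule tangent_spaceD(2)[OF ZI[OF x] n'(1,2)])
        show "h (\<lambda>z. f z * g z) x = f (Inl x) * h g x + g (Inl x) * h f x"
          unfolding h[OF x n(1)] h[OF x n(2)] h[OF x near_mult[OF n]] n'(3,4)[symmetric]
          by (rule tangent_spaceD(3)[OF ZI[OF x] n'(1,2)])
      qed
      show "T (\<lambda>z. c * f z + g z) b = c * T f b + T g b"
        by (rule agree[OF T(1)[OF s(1)] _ b])
          (use T[OF f] T[OF g] T(2)[OF s(1)] r in \<open>auto intro!: B.smooth_funs_add B.smooth_funs_mult B.smooth_funs_const\<close>)
      show "T (\<lambda>z. f z * g z) b = f b * T g b + g b * T f b"
        by (rule agree[OF T(1)[OF s(2)] _ b])
          (use f g T[OF f] T[OF g] T(2)[OF s(2)] r in \<open>auto intro!: B.smooth_funs_add B.smooth_funs_mult\<close>)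
    qed
    have s: "(\<lambda>z. c * f z + g z) \<in> smooth_funs BA" "(\<lambda>z. f z * g z) \<in> smooth_funs BA"
      if "f \<in> smooth_funs BA" "g \<in> smooth_funs BA" for f g c
      using that by (auto intro!: B.smooth_funs_add B.smooth_funs_mult B.smooth_funs_const)
    show "X b \<in> tangent_space BA b" unfolding tangent_space_def
      by (auto simp: X_def b s lin mult)
  next
    fix b assume "b \<notin> points BA"
    then show "X b = (\<lambda>_. 0)" by (auto simp: X_def points_BA)
  next
    fix g assume g: "g \<in> smooth_funs BA"
    show "(\<lambda>b. X b g) \<in> smooth_funs BA"
      by (rule B.smooth_funs_cong[OF T(1)[OF g]]) (use g in \<open>auto simp: X_def points_BA\<close>)
  qed
  moreover have "X b (\<lambda>b. f (blowdown b)) = Z b f" if b: "b \<in> BP" and f: "f \<in> smooth_funs \<A>" for b f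
  proof -
    have p: "(\<lambda>b. f (blowdown b)) \<in> smooth_funs BA" by (rule smooth_funs_blowdown[OF f])
    have "T (\<lambda>b. f (blowdown b)) b = Z b f"
    proof (rule agree[OF T(1)[OF p] Zs[OF f] b])
      fix x assume x: "x \<in> points \<A>" "x \<notin> N"
      have "near (\<lambda>b. f (blowdown b)) x f" using f x opn_points unfolding near_def by auto
      from h[OF x this] show "T (\<lambda>b. f (blowdown b)) (Inl x) = Z (Inl x) f" using T(2)[OF p x] by simp
    qed
    then show ?thesis using b p by (simp add: X_def)
  qed
  ultimately show ?thesis by blast
qed

end

section \<open>Sections and the anchor of the blowup\<close>


lemma is_basis_coeff_zero:
  assumes "is_basis r e V" "(\<Sum>k<r. a k *\<^sub>R e k) = 0" "k < r"
  shows "a k = 0"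
proof -
  have inj: "inj_on e {..<r}" and ind: "independent (e ` {..<r})" using assms(1) by (auto simp: is_basis_def)
  let ?u = "\<lambda>v. a (inv_into {..<r} e v)"
  have "(\<Sum>v\<in>e ` {..<r}. ?u v *\<^sub>R v) = (\<Sum>k<r. a k *\<^sub>R e k)"
    by (simp add: sum.reindex[OF inj] inv_into_f_f[OF inj])
  then have "?u (e k) = 0"
    using independentD[OF ind _ order_refl, of ?u "e k"] assms(2,3) by simp
  then show ?thesis using inv_into_f_f[OF inj, of k] assms(3) by simp
qed

lemma is_basis_coeff_unique:
  assumes "is_basis r e V" "(\<Sum>k<r. a k *\<^sub>R e k) = (\<Sum>k<r. b k *\<^sub>R e k)" "k < r"
  shows "a k = b k"
proof -
  have "(\<Sum>k<r. (a k - b k) *\<^sub>R e k) = 0"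
    using assms(2) by (simp add: scaleR_left_diff_distrib sum_subtractf)
  from is_basis_coeff_zero[OF assms(1) this assms(3)] show ?thesis by simp
qed

lemma is_basis_subspace: "is_basis r e V \<Longrightarrow> subspace V"
  by (auto simp: is_basis_def)

lemma is_basis_in: "is_basis r e V \<Longrightarrow> k < r \<Longrightarrow> e k \<in> V"
  by (auto simp: is_basis_def intro: span_base)

text \<open>Built on \<open>chart_atlas\<close>, so that it covers A over M as well as its pullback
  over the blowup.\<close>

locale smooth_bundle = chart_atlas \<A> for \<A> :: "('m, 'e::euclidean_space) chart set" +
  fixes E :: "('m, 'a::real_vector, 'z) vbundle_scheme"
  assumes vbundle: "vector_bundle \<A> E"
begin

abbreviation "lsec \<equiv> local_sections \<A> E"

lemma frame_opn: "(U, e) \<in> frames E \<Longrightarrow> opn U"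
  and frame_basis: "(U, e) \<in> frames E \<Longrightarrow> x \<in> U \<Longrightarrow> is_basis (vrank E) (\<lambda>k. e k x) (fibre E x)"
  using vbundle by (auto simp: vector_bundle_def)

lemma frame_cover:
  assumes "x \<in> points \<A>"
  obtains U e where "(U, e) \<in> frames E" "x \<in> U"
proof -
  have "x \<in> (\<Union>(U, e)\<in>frames E. U)" using vbundle assms by (simp add: vector_bundle_def)
  then show ?thesis using that by auto
qed

lemma frame_transition:
  assumes "(U, e) \<in> frames E" "(U', e') \<in> frames E"
  shows "\<exists>g. (\<forall>k<vrank E. \<forall>l<vrank E. g k l \<in> smooth_funs_on \<A> (U \<inter> U')) \<and>
        (\<forall>l<vrank E. \<forall>x\<in>U \<inter> U'. e' l x = (\<Sum>k<vrank E. g k l x *\<^sub>R e k x))"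
proof -
  have "\<forall>(U, e)\<in>frames E. \<forall>(U', e')\<in>frames E. \<exists>g.
        (\<forall>k<vrank E. \<forall>l<vrank E. g k l \<in> smooth_funs_on \<A> (U \<inter> U')) \<and>
        (\<forall>l<vrank E. \<forall>x\<in>U \<inter> U'. e' l x = (\<Sum>k<vrank E. g k l x *\<^sub>R e k x))"
    using vbundle unfolding vector_bundle_def by (elim conjE)
  from bspec[OF bspec[OF this assms(1), unfolded prod.case] assms(2), unfolded prod.case] show ?thesis .
qed

lemma fibre_subspace: "x \<in> points \<A> \<Longrightarrow> subspace (fibre E x)"
  using frame_cover frame_basis is_basis_subspace by metis

lemma lsec_iff:
  assumes "opn W"
  shows "s \<in> lsec W \<longleftrightarrow> (\<forall>x\<in>W. s x \<in> fibre E x) \<and>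
    (\<forall>(U, e)\<in>frames E. \<exists>a. (\<forall>k<vrank E. \<forall>x\<in>U \<inter> W. smooth_near \<A> (a k) x) \<and>
        (\<forall>x\<in>U \<inter> W. s x = (\<Sum>k<vrank E. a k x *\<^sub>R e k x)))"
proof -
  have "a \<in> smooth_funs_on \<A> (U \<inter> W) \<longleftrightarrow> (\<forall>x\<in>U \<inter> W. smooth_near \<A> a x)" if "(U, e) \<in> frames E" for U e a
    by (rule smooth_funs_on_iff) (use frame_opn[OF that] assms in auto)
  then have "(case c of (U, e) \<Rightarrow> \<exists>a. (\<forall>k<vrank E. a k \<in> smooth_funs_on \<A> (U \<inter> W)) \<and>
        (\<forall>x\<in>U \<inter> W. s x = (\<Sum>k<vrank E. a k x *\<^sub>R e k x))) \<longleftrightarrow>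
      (case c of (U, e) \<Rightarrow> \<exists>a. (\<forall>k<vrank E. \<forall>x\<in>U \<inter> W. smooth_near \<A> (a k) x) \<and>
        (\<forall>x\<in>U \<inter> W. s x = (\<Sum>k<vrank E. a k x *\<^sub>R e k x)))" if "c \<in> frames E" for c
    using that by (cases c) simp
  then show ?thesis unfolding local_sections_def mem_Collect_eq by (intro conj_cong refl ball_cong)
qed

lemma lsec_fibre: "s \<in> lsec W \<Longrightarrow> x \<in> W \<Longrightarrow> s x \<in> fibre E x"
  by (auto simp: local_sections_def)

lemma lsec_frame:
  assumes "opn W" "s \<in> lsec W" "(U, e) \<in> frames E"
  obtains a where "\<forall>k<vrank E. \<forall>x\<in>U \<inter> W. smooth_near \<A> (a k) x"
    "\<forall>x\<in>U \<inter> W. s x = (\<Sum>k<vrank E. a k x *\<^sub>R e k x)"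
proof -
  have "\<forall>(U, e)\<in>frames E. \<exists>a. (\<forall>k<vrank E. \<forall>x\<in>U \<inter> W. smooth_near \<A> (a k) x) \<and>
        (\<forall>x\<in>U \<inter> W. s x = (\<Sum>k<vrank E. a k x *\<^sub>R e k x))"
    using assms(2) lsec_iff[OF assms(1)] by simp
  from bspec[OF this assms(3), unfolded prod.case] show ?thesis using that by blast
qed

lemma frame_lsec:
  assumes "(U, e) \<in> frames E" "k < vrank E"
  shows "e k \<in> lsec U"
  unfolding lsec_iff[OF frame_opn[OF assms(1)]]
proof (intro conjI ballI, goal_cases)
  case (1 x)
  then show ?case using is_basis_in[OF frame_basis[OF assms(1)] assms(2)] by blast
next
  case (2 c)
  obtain V f where c: "c = (V, f)" by (cases c)
  then have Vf: "(V, f) \<in> frames E" using 2 by simp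
  obtain g where g: "\<forall>k<vrank E. \<forall>l<vrank E. g k l \<in> smooth_funs_on \<A> (V \<inter> U)"
    "\<forall>l<vrank E. \<forall>x\<in>V \<inter> U. e l x = (\<Sum>k<vrank E. g k l x *\<^sub>R f k x)"
    using frame_transition[OF Vf assms(1)] by blast
  have o: "opn (V \<inter> U)" using frame_opn Vf assms(1) by blast
  show ?case unfolding c prod.case
    using g assms(2) smooth_funs_on_iff[OF o] by (intro exI[of _ "\<lambda>l. g l k"]) blast
qed

lemma lsec_lin:
  assumes W: "opn W" and s: "s \<in> lsec W" and t: "t \<in> lsec W" and f: "\<And>x. x \<in> W \<Longrightarrow> smooth_near \<A> f x"
  shows "(\<lambda>x. f x *\<^sub>R s x + t x) \<in> lsec W"
  unfolding lsec_iff[OF W]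
proof (intro conjI ballI, goal_cases)
  case (1 x)
  then have "subspace (fibre E x)" using fibre_subspace opn_subset[OF W] by blast
  then show ?case using lsec_fibre[OF s 1] lsec_fibre[OF t 1] by (simp add: subspace_add subspace_scale)
next
  case (2 c)
  obtain U e where c: "c = (U, e)" by (cases c)
  then have U: "(U, e) \<in> frames E" using 2 by simp
  obtain a where a: "\<forall>k<vrank E. \<forall>x\<in>U \<inter> W. smooth_near \<A> (a k) x"
    "\<forall>x\<in>U \<inter> W. s x = (\<Sum>k<vrank E. a k x *\<^sub>R e k x)" using lsec_frame[OF W s U] .
  obtain b where b: "\<forall>k<vrank E. \<forall>x\<in>U \<inter> W. smooth_near \<A> (b k) x"
    "\<forall>x\<in>U \<inter> W. t x = (\<Sum>k<vrank E. b k x *\<^sub>R e k x)" using lsec_frame[OF W t U] .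
  show ?case unfolding c prod.case
  proof (intro exI[of _ "\<lambda>k x. f x * a k x + b k x"] conjI allI impI ballI)
    fix k x assume "k < vrank E" "x \<in> U \<inter> W"
    then show "smooth_near \<A> (\<lambda>x. f x * a k x + b k x) x"
      using a b f by (intro smooth_near_add smooth_near_mult) auto
  next
    fix x assume "x \<in> U \<inter> W"
    then show "f x *\<^sub>R s x + t x = (\<Sum>k<vrank E. (f x * a k x + b k x) *\<^sub>R e k x)"
      using a b by (simp add: scaleR_left_distrib sum.distrib scaleR_sum_right)
  qed
qed

lemma lsec_zero:
  assumes "opn W"
  shows "(\<lambda>_. 0) \<in> lsec W"
  unfolding lsec_iff[OF assms]
proof (intro conjI ballI, goal_cases)
  case (1 x)
  then show ?case using fibre_subspace opn_subset[OF assms] subspace_0 by blast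
next
  case (2 c)
  then show ?case using smooth_near_const opn_subset[OF assms]
    by (cases c) (auto intro!: exI[of _ "\<lambda>_ _. 0"])
qed

lemma lsec_scale:
  assumes "opn W" "s \<in> lsec W" "\<And>x. x \<in> W \<Longrightarrow> smooth_near \<A> f x"
  shows "(\<lambda>x. f x *\<^sub>R s x) \<in> lsec W"
  using lsec_lin[OF assms(1,2) lsec_zero[OF assms(1)] assms(3)] by simp

lemma lsec_mono:
  assumes "opn W" "opn W'" "W' \<subseteq> W" "s \<in> lsec W"
  shows "s \<in> lsec W'"
  unfolding lsec_iff[OF assms(2)]
proof (intro conjI ballI, goal_cases)
  case (1 x)
  then show ?case using lsec_fibre[OF assms(4)] assms(3) by blast
next
  case (2 c)
  obtain U e where c: "c = (U, e)" by (cases c)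
  then have U: "(U, e) \<in> frames E" using 2 by simp
  obtain a where a: "\<forall>k<vrank E. \<forall>x\<in>U \<inter> W. smooth_near \<A> (a k) x"
    "\<forall>x\<in>U \<inter> W. s x = (\<Sum>k<vrank E. a k x *\<^sub>R e k x)" using lsec_frame[OF assms(1,4) U] .
  show ?case unfolding c prod.case using a assms(3) by (intro exI[of _ a]) auto
qed

text \<open>Coefficients in a frame are unique, so those chosen around different points agree on
  overlaps, and the diagonal choice is smooth.\<close>

lemma lsec_glue:
  assumes W: "opn W" and l: "\<And>x. x \<in> W \<Longrightarrow> \<exists>V t. opn V \<and> x \<in> V \<and> t \<in> lsec V \<and> (\<forall>y\<in>V. s y = t y)"
  shows "s \<in> lsec W"
  unfolding lsec_iff[OF W]
proof (intro conjI ballI, goal_cases)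
  case (1 x)
  then show ?case using l lsec_fibre by metis
next
  case (2 c)
  obtain U e where c: "c = (U, e)" by (cases c)
  then have U: "(U, e) \<in> frames E" using 2 by simp
  define Q where "Q V a x \<longleftrightarrow> opn V \<and> x \<in> V \<and> (\<forall>k<vrank E. \<forall>y\<in>U \<inter> V. smooth_near \<A> (a k) y) \<and>
      (\<forall>y\<in>U \<inter> V. s y = (\<Sum>k<vrank E. a k y *\<^sub>R e k y))" for V a x
  have "\<exists>V a. Q V a x" if x: "x \<in> W" for x
  proof -
    obtain V t where V: "opn V" "x \<in> V" "t \<in> lsec V" "\<forall>y\<in>V. s y = t y" using l[OF x] by blast
    obtain a where "\<forall>k<vrank E. \<forall>x\<in>U \<inter> V. smooth_near \<A> (a k) x"
      "\<forall>x\<in>U \<inter> V. t x = (\<Sum>k<vrank E. a k x *\<^sub>R e k x)" using lsec_frame[OF V(1,3) U] .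
    then show ?thesis using V unfolding Q_def by (intro exI[of _ V] exI[of _ a]) auto
  qed
  then obtain V a where "\<And>x. x \<in> W \<Longrightarrow> Q (V x) (a x) x" by metis
  note Va = this[unfolded Q_def]
  show ?case unfolding c prod.case
  proof (intro exI[of _ "\<lambda>k x. a x k x"] conjI allI impI ballI)
    fix k x assume k: "k < vrank E" and x: "x \<in> U \<inter> W"
    show "smooth_near \<A> (\<lambda>x. a x k x) x"
    proof (rule smooth_near_cong[of "a x k" x "U \<inter> W \<inter> V x"])
      show "smooth_near \<A> (a x k) x" using Va x k by blast
      show "opn (U \<inter> W \<inter> V x)" using Va x frame_opn[OF U] W by blast
      show "x \<in> U \<inter> W \<inter> V x" using Va x by blast
      fix y assume y: "y \<in> U \<inter> W \<inter> V x"
      have "s y = (\<Sum>k<vrank E. a x k y *\<^sub>R e k y)" using Va[of x] x y by blast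
      moreover have "s y = (\<Sum>k<vrank E. a y k y *\<^sub>R e k y)" using Va[of y] y by blast
      ultimately show "a x k y = a y k y"
        using is_basis_coeff_unique[OF frame_basis[OF U], of y "\<lambda>k. a x k y" "\<lambda>k. a y k y" k] y k by simp
    qed
  next
    fix x assume "x \<in> U \<inter> W"
    then show "s x = (\<Sum>k<vrank E. a x k x *\<^sub>R e k x)" using Va[of x] by blast
  qed
qed

lemma sections_iff: "s \<in> sections \<A> E \<longleftrightarrow> s \<in> lsec (points \<A>) \<and> (\<forall>x. x \<notin> points \<A> \<longrightarrow> s x = 0)"
  by (simp add: sections_def)

lemma sections_local: "s \<in> sections \<A> E \<Longrightarrow> opn W \<Longrightarrow> s \<in> lsec W"
  using lsec_mono[OF opn_points] opn_subset sections_iff by blast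

lemma sections_lin:
  "s \<in> sections \<A> E \<Longrightarrow> t \<in> sections \<A> E \<Longrightarrow> f \<in> smooth_funs \<A> \<Longrightarrow> (\<lambda>x. f x *\<^sub>R s x + t x) \<in> sections \<A> E"
  unfolding sections_iff using lsec_lin[OF opn_points] smooth_funs_nearD by auto

lemma sections_zero: "(\<lambda>_. 0) \<in> sections \<A> E"
  unfolding sections_iff using lsec_zero[OF opn_points] by simp

end

text \<open>On W the product is a smooth multiple of s, off K it is the zero section; these two open
  sets cover M because K is closed and contained in W.\<close>

lemma (in hausdorff_atlas) cutoff_section:
  assumes "smooth_bundle \<A> E" and k: "\<kappa> \<in> smooth_funs \<A>" "closedin (mtop \<A>) K" "\<And>y. y \<notin> K \<Longrightarrow> \<kappa> y = 0" "K \<subseteq> W"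
    and W: "opn W" and s: "s \<in> local_sections \<A> E W"
  shows "(\<lambda>x. \<kappa> x *\<^sub>R s x) \<in> sections \<A> E"
proof -
  interpret smooth_bundle \<A> E by fact
  show ?thesis unfolding sections_iff
  proof (intro conjI allI impI)
    show "(\<lambda>x. \<kappa> x *\<^sub>R s x) \<in> lsec (points \<A>)"
    proof (rule lsec_glue[OF opn_points])
      fix x assume x: "x \<in> points \<A>"
      show "\<exists>V t. opn V \<and> x \<in> V \<and> t \<in> lsec V \<and> (\<forall>y\<in>V. \<kappa> y *\<^sub>R s y = t y)"
      proof (cases "x \<in> K")
        case True
        have "(\<lambda>x. \<kappa> x *\<^sub>R s x) \<in> lsec W"
          by (rule lsec_scale[OF W s]) (use smooth_funs_nearD[OF k(1)] opn_subset[OF W] in blast)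
        then show ?thesis using W k(4) True by blast
      next
        case False
        have o: "opn (points \<A> - K)" by (rule opn_compl[OF k(2)])
        show ?thesis
          by (rule exI[of _ "points \<A> - K"], rule exI[of _ "\<lambda>_. 0"]) (use o lsec_zero[OF o] x False k(3) in auto)
      qed
    qed
    fix x assume "x \<notin> points \<A>"
    then have "x \<notin> K" using k(4) opn_subset[OF W] by blast
    then show "\<kappa> x *\<^sub>R s x = 0" using k(3) by simp
  qed
qed

lemma (in submanifold) pullback_vector_bundle:
  assumes "vector_bundle \<A> E"
  shows "vector_bundle BA (pullback_bundle \<A> N E)"
proof -
  interpret smooth_bundle \<A> E by standard fact
  let ?p = "\<lambda>U. {b \<in> BP. blowdown b \<in> U}"
  have fr: "frames (pullback_bundle \<A> N E) = {(?p U, \<lambda>k. e k \<circ> blowdown) |U e. (U, e) \<in> frames E}"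
    and r: "vrank (pullback_bundle \<A> N E) = vrank E" and fi: "fibre (pullback_bundle \<A> N E) = fibre E \<circ> blowdown"
    by (simp_all add: pullback_bundle_def)
  have trans: "\<exists>g. (\<forall>k<vrank E. \<forall>l<vrank E. g k l \<in> smooth_funs_on BA (?p U \<inter> ?p U')) \<and>
        (\<forall>l<vrank E. \<forall>x\<in>?p U \<inter> ?p U'. e' l (blowdown x) = (\<Sum>k<vrank E. g k l x *\<^sub>R e k (blowdown x)))"
    if U: "(U, e) \<in> frames E" "(U', e') \<in> frames E" for U e U' e'
  proof -
    obtain g where g: "\<forall>k<vrank E. \<forall>l<vrank E. g k l \<in> smooth_funs_on \<A> (U \<inter> U')"
      "\<forall>l<vrank E. \<forall>x\<in>U \<inter> U'. e' l x = (\<Sum>k<vrank E. g k l x *\<^sub>R e k x)"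
      using frame_transition[OF U] by blast
    have o: "opn (U \<inter> U')" "B.opn (?p U \<inter> ?p U')" using frame_opn U opn_blowdown_vimage by blast+
    show ?thesis
    proof (intro exI[of _ "\<lambda>k l b. g k l (blowdown b)"] conjI allI impI ballI)
      fix k l assume "k < vrank E" "l < vrank E"
      then have "g k l \<in> smooth_funs_on \<A> (U \<inter> U')" using g by blast
      then show "(\<lambda>b. g k l (blowdown b)) \<in> smooth_funs_on BA (?p U \<inter> ?p U')"
        unfolding smooth_funs_on_iff[OF o(1)] B.smooth_funs_on_iff[OF o(2)] using smooth_near_blowdown by blast
    qed (use g in auto)
  qed
  have cov: "(\<Union>(U, e)\<in>frames (pullback_bundle \<A> N E). U) = points BA"
  proof (intro set_eqI iffI)
    fix b assume "b \<in> points BA"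
    then have b: "b \<in> BP" by (simp add: points_BA)
    obtain U e where "(U, e) \<in> frames E" "blowdown b \<in> U" using frame_cover[OF BP_blowdown[OF b]] .
    then show "b \<in> (\<Union>(U, e)\<in>frames (pullback_bundle \<A> N E). U)" using b unfolding fr by auto
  qed (auto simp: fr points_BA)
  show ?thesis unfolding vector_bundle_def
  proof (intro conjI cov)
    show "\<forall>(U, e)\<in>frames (pullback_bundle \<A> N E). openin (mtop BA) U \<and>
        (\<forall>x\<in>U. is_basis (vrank (pullback_bundle \<A> N E)) (\<lambda>k. e k x) (fibre (pullback_bundle \<A> N E) x))"
      unfolding fr r fi using frame_opn frame_basis opn_blowdown_vimage by auto
    show "\<forall>(U, e)\<in>frames (pullback_bundle \<A> N E). \<forall>(U', e')\<in>frames (pullback_bundle \<A> N E). \<exists>g.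
        (\<forall>k<vrank (pullback_bundle \<A> N E). \<forall>l<vrank (pullback_bundle \<A> N E). g k l \<in> smooth_funs_on BA (U \<inter> U')) \<and>
        (\<forall>l<vrank (pullback_bundle \<A> N E). \<forall>x\<in>U \<inter> U'. e' l x = (\<Sum>k<vrank (pullback_bundle \<A> N E). g k l x *\<^sub>R e k x))"
      unfolding fr r using trans by fastforce
  qed
qed

section \<open>Existence and uniqueness of the anchor of the blowup\<close>

locale lie_pair = submanifold \<A> N for \<A> :: "('m, 'e::euclidean_space) chart set" and N :: "'m set" +
  fixes A :: "('m, 'a::real_vector) lie_algebroid" and C :: "'m \<Rightarrow> 'a set"
  assumes lie: "is_lie_algebroid \<A> A" and subalg: "lie_subalgebroid \<A> A N C"
begin

abbreviation "PA \<equiv> pullback_bundle \<A> N A"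
abbreviation "BS \<equiv> blup_sections \<A> N A C"

sublocale E: smooth_bundle \<A> A
  by standard (use lie in \<open>simp add: is_lie_algebroid_def\<close>)

sublocale P: smooth_bundle BA PA
  by standard (rule pullback_vector_bundle[OF E.vbundle])

lemma PA_simps [simp]: "vrank PA = vrank A" "fibre PA b = fibre A (blowdown b)"
  by (simp_all add: pullback_bundle_def)

lemma PA_frame: "(U, e) \<in> frames A \<Longrightarrow> ({b \<in> BP. blowdown b \<in> U}, \<lambda>k. e k \<circ> blowdown) \<in> frames PA"
  by (auto simp: pullback_bundle_def)

lemma PA_frame_cases:
  assumes "c \<in> frames PA"
  obtains U e where "(U, e) \<in> frames A" "c = ({b \<in> BP. blowdown b \<in> U}, \<lambda>k. e k \<circ> blowdown)"
  using assms by (auto simp: pullback_bundle_def)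

lemma pull_lsec:
  assumes W: "opn W" and s: "s \<in> E.lsec W"
  shows "(\<lambda>b. s (blowdown b)) \<in> P.lsec {b \<in> BP. blowdown b \<in> W}"
  unfolding P.lsec_iff[OF opn_blowdown_vimage[OF W]]
proof (intro conjI ballI, goal_cases)
  case (1 b)
  then show ?case using E.lsec_fibre[OF s] by simp
next
  case (2 c)
  then obtain U e where c: "(U, e) \<in> frames A" "c = ({b \<in> BP. blowdown b \<in> U}, \<lambda>k. e k \<circ> blowdown)"
    by (rule PA_frame_cases)
  obtain a where a: "\<forall>k<vrank A. \<forall>x\<in>U \<inter> W. smooth_near \<A> (a k) x"
    "\<forall>x\<in>U \<inter> W. s x = (\<Sum>k<vrank A. a k x *\<^sub>R e k x)" using E.lsec_frame[OF W s c(1)] .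
  show ?case unfolding c(2) prod.case PA_simps
    using a smooth_near_blowdown by (intro exI[of _ "\<lambda>k b. a k (blowdown b)"]) auto
qed

text \<open>Frames of the pullback bundle are pulled-back frames, so off N the coefficients of a
  section descend to M.\<close>

lemma Inl_lsec:
  assumes W: "B.opn W" and s: "\<sigma> \<in> P.lsec W"
  shows "(\<lambda>x. \<sigma> (Inl x)) \<in> E.lsec {x. Inl x \<in> W}"
  unfolding E.lsec_iff[OF opn_Inl_vimage[OF W]]
proof (intro conjI ballI, goal_cases)
  case (1 x)
  then show ?case using P.lsec_fibre[OF s, of "Inl x"] by simp
next
  case (2 c)
  obtain U e where c: "c = (U, e)" by (cases c)
  then have U: "(U, e) \<in> frames A" using 2 by simp
  let ?U = "{b \<in> BP. blowdown b \<in> U}"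
  obtain a where a: "\<forall>k<vrank A. \<forall>b\<in>?U \<inter> W. smooth_near BA (a k) b"
    "\<forall>b\<in>?U \<inter> W. \<sigma> b = (\<Sum>k<vrank A. a k b *\<^sub>R (e k \<circ> blowdown) b)"
    using P.lsec_frame[OF W s PA_frame[OF U]] unfolding PA_simps .
  have in': "Inl x \<in> ?U \<inter> W" if "x \<in> U \<inter> {x. Inl x \<in> W}" for x
    using that B.opn_subset[OF W] points_BA by auto
  show ?case unfolding c prod.case
  proof (intro exI[of _ "\<lambda>k x. a k (Inl x)"] conjI allI impI ballI)
    fix k x assume k: "k < vrank A" and x: "x \<in> U \<inter> {x. Inl x \<in> W}"
    show "smooth_near \<A> (\<lambda>x. a k (Inl x)) x" using smooth_near_Inl a(1) k in'[OF x] by blast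
  next
    fix x assume x: "x \<in> U \<inter> {x. Inl x \<in> W}"
    show "\<sigma> (Inl x) = (\<Sum>k<vrank A. a k (Inl x) *\<^sub>R e k x)" using a(2) in'[OF x] by auto
  qed
qed

lemma anchor_in: "x \<in> points \<A> \<Longrightarrow> u \<in> fibre A x \<Longrightarrow> anchor A x u \<in> tangent_space \<A> x"
  using lie by (auto simp: is_lie_algebroid_def)

lemma anchor_lin:
  "x \<in> points \<A> \<Longrightarrow> u \<in> fibre A x \<Longrightarrow> v \<in> fibre A x \<Longrightarrow>
    anchor A x (c *\<^sub>R u + v) = (\<lambda>f. c * anchor A x u f + anchor A x v f)"
  using lie unfolding is_lie_algebroid_def by blast

lemma anchor_0:
  assumes "x \<in> points \<A>"
  shows "anchor A x 0 = (\<lambda>f. 0)"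
proof -
  have "0 \<in> fibre A x" using E.fibre_subspace[OF assms] subspace_0 by blast
  from anchor_lin[OF assms this this, of 1] show ?thesis by (simp add: fun_eq_iff)
qed

lemma anchor_sum:
  fixes n :: nat
  assumes x: "x \<in> points \<A>" and "\<And>k. k < n \<Longrightarrow> u k \<in> fibre A x"
  shows "anchor A x (\<Sum>k<n. c k *\<^sub>R u k) f = (\<Sum>k<n. c k * anchor A x (u k) f)"
  using assms(2)
proof (induction n)
  case 0
  then show ?case using anchor_0[OF x] by simp
next
  case (Suc n)
  note V = E.fibre_subspace[OF x]
  have "(\<Sum>k<n. c k *\<^sub>R u k) \<in> fibre A x"
    using Suc.prems V by (intro subspace_sum subspace_scale) auto
  then have "anchor A x (c n *\<^sub>R u n + (\<Sum>k<n. c k *\<^sub>R u k)) f = c n * anchor A x (u n) f + anchor A x (\<Sum>k<n. c k *\<^sub>R u k) f"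
    using anchor_lin[OF x Suc.prems[of n]] by simp
  then show ?case using Suc by (simp add: add.commute)
qed

lemma anchor_vf_field: "s \<in> sections \<A> A \<Longrightarrow> anchor_vf \<A> A s \<in> vector_fields \<A>"
  using lie unfolding is_lie_algebroid_def by blast

lemma C_basis:
  assumes "y \<in> N"
  shows "subspace (C y)" "C y \<subseteq> fibre A y"
proof -
  have "vector_subbundle \<A> A N C" using subalg by (simp add: lie_subalgebroid_def)
  then obtain q where "\<forall>y\<in>N. \<exists>W c. opn W \<and> y \<in> W \<and> (\<forall>k<q. c k \<in> E.lsec W) \<and>
      (\<forall>x\<in>W \<inter> N. is_basis q (\<lambda>k. c k x) (C x))"
    unfolding vector_subbundle_def by (elim exE)
  from bspec[OF this assms] obtain W c where c: "opn W" "y \<in> W" "\<forall>k<q. c k \<in> E.lsec W" "is_basis q (\<lambda>k. c k y) (C y)"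
    using assms by (elim exE conjE) auto
  show "subspace (C y)" by (rule is_basis_subspace[OF c(4)])
  have "subspace (fibre A y)" using E.fibre_subspace N_points assms by blast
  moreover have "(\<lambda>k. c k y) ` {..<q} \<subseteq> fibre A y" using c E.lsec_fibre by blast
  ultimately show "C y \<subseteq> fibre A y" using span_minimal[of "(\<lambda>k. c k y) ` {..<q}" "fibre A y"] c(4) unfolding is_basis_def by blast
qed

lemma anchor_C: "y \<in> N \<Longrightarrow> u \<in> C y \<Longrightarrow> anchor A y u \<in> sub_tangent_space \<A> N y"
  using subalg by (auto simp: lie_subalgebroid_def)

lemma BS_iff: "\<sigma> \<in> BS \<longleftrightarrow> \<sigma> \<in> sections BA PA \<and> (\<forall>b\<in>BP. blowdown b \<in> N \<longrightarrow> \<sigma> b \<in> C (blowdown b))"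
  by (auto simp: blup_sections_def Exc_iff)

lemma BS_sections: "\<sigma> \<in> BS \<Longrightarrow> \<sigma> \<in> sections BA PA"
  by (simp add: BS_iff)

lemma BS_outside: "\<sigma> \<in> BS \<Longrightarrow> b \<notin> BP \<Longrightarrow> \<sigma> b = 0"
  by (simp add: BS_iff P.sections_iff points_BA)

lemma BS_fibre: "\<sigma> \<in> BS \<Longrightarrow> b \<in> BP \<Longrightarrow> \<sigma> b \<in> fibre A (blowdown b)"
  using P.lsec_fibre[of \<sigma> "points BA" b] by (simp add: BS_iff P.sections_iff points_BA)

lemma BS_lin: "\<sigma> \<in> BS \<Longrightarrow> \<tau> \<in> BS \<Longrightarrow> f \<in> smooth_funs BA \<Longrightarrow> (\<lambda>b. f b *\<^sub>R \<sigma> b + \<tau> b) \<in> BS"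
  unfolding BS_iff using P.sections_lin C_basis(1) by (simp add: subspace_add subspace_scale)

lemma BS_zero: "(\<lambda>_. 0) \<in> BS"
  unfolding BS_iff using P.sections_zero C_basis(1) subspace_0 by blast

lemma BS_scale: "\<sigma> \<in> BS \<Longrightarrow> f \<in> smooth_funs BA \<Longrightarrow> (\<lambda>b. f b *\<^sub>R \<sigma> b) \<in> BS"
  using BS_lin[OF _ BS_zero] by simp

lemma BS_sum:
  "(\<And>i. i \<in> I \<Longrightarrow> \<sigma> i \<in> BS) \<Longrightarrow> (\<And>i. i \<in> I \<Longrightarrow> f i \<in> smooth_funs BA) \<Longrightarrow> (\<lambda>b. \<Sum>i\<in>I. f i b *\<^sub>R \<sigma> i b) \<in> BS"
proof (induction I rule: infinite_finite_induct)
  case (insert i I)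
  have "(\<lambda>b. f i b *\<^sub>R \<sigma> i b + (\<Sum>i\<in>I. f i b *\<^sub>R \<sigma> i b)) \<in> BS"
    by (rule BS_lin) (use insert in auto)
  then show ?case using insert by simp
qed (auto simp: BS_zero)

text \<open>Smoothness along N is witnessed by s itself as the required extension; only the
  pointwise condition has to be checked.\<close>

lemma rel_sectionsI:
  assumes s: "s \<in> sections \<A> A" and "\<And>y. y \<in> N \<Longrightarrow> s y \<in> C y"
  shows "s \<in> rel_sections \<A> A N C"
  unfolding rel_sections_def sub_sections_def
proof (intro CollectI conjI s allI ballI impI)
  fix y assume "y \<in> N"
  show "\<exists>W. opn W \<and> y \<in> W \<and> (\<exists>t\<in>E.lsec W. \<forall>x\<in>W \<inter> N. (if x \<in> N then s x else 0) = t x)"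
    using opn_points N_points \<open>y \<in> N\<close> E.sections_local[OF s opn_points]
    by (intro exI[of _ "points \<A>"] conjI bexI[of _ s]) auto
qed (use assms in auto)

lemma rel_sectionsD: "s \<in> rel_sections \<A> A N C \<Longrightarrow> s \<in> sections \<A> A"
  "s \<in> rel_sections \<A> A N C \<Longrightarrow> y \<in> N \<Longrightarrow> s y \<in> C y"
  by (auto simp: rel_sections_def sub_sections_def split: if_splits)

lemma blup_section_BS:
  assumes "s \<in> rel_sections \<A> A N C"
  shows "blup_section \<A> N s \<in> BS"
  unfolding BS_iff P.sections_iff
proof (intro conjI allI impI ballI)
  have pp: "{b \<in> BP. blowdown b \<in> points \<A>} = points BA" using BP_blowdown points_BA by auto
  have "(\<lambda>b. s (blowdown b)) \<in> P.lsec (points BA)"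
    using pull_lsec[OF opn_points E.sections_local[OF rel_sectionsD(1)[OF assms] opn_points]] unfolding pp .
  then show "blup_section \<A> N s \<in> P.lsec (points BA)"
    using B.opn_points by (intro P.lsec_glue[OF B.opn_points]) (auto simp: blup_section_def points_BA)
qed (use rel_sectionsD(2)[OF assms] in \<open>auto simp: blup_section_def points_BA\<close>)

text \<open>Relatedness under the blowdown map to the anchor applied to \<sigma>. Unlike
  \<open>is_blup_anchor\<close> it concerns a single section, so existence and uniqueness can be
  treated section by section.\<close>

definition lifts_anchor :: "('m blup \<Rightarrow> 'a) \<Rightarrow> ('m blup \<Rightarrow> 'm blup tangent) \<Rightarrow> bool" where
  "lifts_anchor \<sigma> X \<longleftrightarrow> X \<in> vector_fields BA \<and>
     (\<forall>b\<in>BP. \<forall>f\<in>smooth_funs \<A>. X b (\<lambda>b. f (blowdown b)) = anchor A (blowdown b) (\<sigma> b) f)"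

text \<open>Smoothness of the anchor is given on global sections of A. Near a point \<sigma> is
  therefore expanded in a cut-off frame: each cut frame element is a global section whose anchor
  yields smooth functions on M, and the coefficients are smooth on the blowup.\<close>

lemma anchor_smooth:
  assumes s: "\<sigma> \<in> BS" and f: "f \<in> smooth_funs \<A>"
  shows "(\<lambda>b. anchor A (blowdown b) (\<sigma> b) f) \<in> smooth_funs BA"
  unfolding B.smooth_funs_iff
proof
  fix b assume "b \<in> points BA"
  then have b: "b \<in> BP" by (simp add: points_BA)
  obtain U e where U: "(U, e) \<in> frames A" "blowdown b \<in> U" using E.frame_cover[OF BP_blowdown[OF b]] .
  obtain \<kappa> K X where k: "\<kappa> \<in> smooth_funs \<A>" "closedin (mtop \<A>) K" "K \<subseteq> U"
    "opn X" "blowdown b \<in> X" "X \<subseteq> K" "\<And>y. y \<in> X \<Longrightarrow> \<kappa> y = 1" "\<And>y. y \<notin> K \<Longrightarrow> \<kappa> y = 0"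
    using bump[OF E.frame_opn[OF U(1)] U(2)] by metis
  let ?U = "{b \<in> BP. blowdown b \<in> U}" and ?X = "{b \<in> BP. blowdown b \<in> X}"
  obtain a where a: "\<forall>k<vrank A. \<forall>b\<in>?U \<inter> points BA. smooth_near BA (a k) b"
    "\<forall>b\<in>?U \<inter> points BA. \<sigma> b = (\<Sum>k<vrank A. a k b *\<^sub>R (e k \<circ> blowdown) b)"
    using P.lsec_frame[OF B.opn_points P.sections_local[OF BS_sections[OF s] B.opn_points] PA_frame[OF U(1)]]
    unfolding PA_simps .
  let ?s = "\<lambda>k x. \<kappa> x *\<^sub>R e k x"
  have sec: "?s k \<in> sections \<A> A" if "k < vrank A" for k
    by (rule cutoff_section[OF E.smooth_bundle_axioms k(1,2,8,3) E.frame_opn[OF U(1)] E.frame_lsec[OF U(1) that]])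
  have sm: "(\<lambda>b. anchor_vf \<A> A (?s k) (blowdown b) f) \<in> smooth_funs BA" if "k < vrank A" for k
    using smooth_funs_blowdown[OF vector_fieldsD(3)[OF anchor_vf_field[OF sec[OF that]] f]] .
  have bX: "b \<in> ?X" using b k(5) by blast
  show "smooth_near BA (\<lambda>b. anchor A (blowdown b) (\<sigma> b) f) b"
  proof (rule B.smooth_near_cong[OF _ opn_blowdown_vimage[OF k(4)] bX])
    show "smooth_near BA (\<lambda>b. \<Sum>k<vrank A. a k b * anchor_vf \<A> A (?s k) (blowdown b) f) b"
      using a(1) b U(2) B.smooth_funs_nearD[OF sm]
      by (intro B.smooth_near_sum B.smooth_near_mult) (auto simp: points_BA)
    fix b' assume b': "b' \<in> ?X"
    then have x: "blowdown b' \<in> points \<A>" "blowdown b' \<in> U" using BP_blowdown k(3,6) by auto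
    have "\<sigma> b' = (\<Sum>k<vrank A. a k b' *\<^sub>R ?s k (blowdown b'))"
      using a(2) b' x k(7) by (simp add: points_BA)
    moreover have "?s k (blowdown b') \<in> fibre A (blowdown b')" if "k < vrank A" for k
      using E.lsec_fibre[OF E.sections_local[OF sec[OF that] opn_points] x(1)] .
    ultimately show "(\<Sum>k<vrank A. a k b' * anchor_vf \<A> A (?s k) (blowdown b') f) = anchor A (blowdown b') (\<sigma> b') f"
      using anchor_sum[OF x(1), of "vrank A" "\<lambda>k. ?s k (blowdown b')" "\<lambda>k. a k b'" f] x(1)
      by (simp add: anchor_vf_def)
  qed
qed

text \<open>Over the exceptional divisor \<sigma> takes values in C, which the anchor maps into TN;
  this is the tangency that \<open>vector_field_lift\<close> demands.\<close>

lemma lifts_anchor_ex: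
  assumes "\<sigma> \<in> BS"
  shows "\<exists>X. lifts_anchor \<sigma> X"
proof -
  have "\<exists>X\<in>vector_fields BA. \<forall>b\<in>BP. \<forall>f\<in>smooth_funs \<A>. X b (\<lambda>b. f (blowdown b)) = anchor A (blowdown b) (\<sigma> b) f"
    by (rule vector_field_lift)
      (use anchor_in BP_blowdown BS_fibre[OF assms] anchor_smooth[OF assms] anchor_C assms BS_iff in auto)
  then show ?thesis unfolding lifts_anchor_def by blast
qed

lemma lifts_anchor_unique:
  assumes "lifts_anchor \<sigma> X" "lifts_anchor \<sigma> X'"
  shows "X = X'"
  by (rule vector_field_unique) (use assms in \<open>auto simp: lifts_anchor_def BP_Inl\<close>)

lemma lifts_anchor_lin:
  assumes X: "lifts_anchor \<sigma> X" "lifts_anchor \<tau> Y" and s: "\<sigma> \<in> BS" "\<tau> \<in> BS" and f: "f \<in> smooth_funs BA"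
  shows "lifts_anchor (\<lambda>b. f b *\<^sub>R \<sigma> b + \<tau> b) (\<lambda>b g. f b * X b g + Y b g)"
  using X B.vector_fields_lin[OF _ _ f] anchor_lin BP_blowdown BS_fibre s unfolding lifts_anchor_def by auto

text \<open>For an induced section, relatedness to the anchor vector field is the condition of
  \<open>lifts_anchor\<close>, so uniqueness of lifts resolves the \<open>THE\<close> in
  \<open>lift_vf\<close>.\<close>

lemma lift_vf_eq:
  assumes "s \<in> rel_sections \<A> A N C" "lifts_anchor (blup_section \<A> N s) X"
  shows "lift_vf \<A> N (anchor_vf \<A> A s) = X"
proof -
  have "Y \<in> vector_fields BA \<and> blowdown_related \<A> N Y (anchor_vf \<A> A s) \<longleftrightarrow> lifts_anchor (blup_section \<A> N s) Y" for Y
    unfolding lifts_anchor_def blowdown_related_def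
    using BP_blowdown by (auto simp: comp_def anchor_vf_def blup_section_def)
  then show ?thesis unfolding lift_vf_def using assms(2) lifts_anchor_unique by auto
qed

text \<open>Multiplied by a cutoff supported off N, \<sigma> becomes the section induced by a
  section \<open>t\<close> of A that vanishes on N, and for this one the value of R is prescribed.
  By linearity R \<sigma> agrees with the lift X off the exceptional divisor, hence
  everywhere.\<close>

lemma lifts_anchor_of_blup_anchor:
  assumes R: "is_blup_anchor \<A> N A C R" and s: "\<sigma> \<in> BS"
  shows "lifts_anchor \<sigma> (R \<sigma>)"
proof -
  have Rf: "R \<tau> \<in> vector_fields BA" if "\<tau> \<in> BS" for \<tau> using R that by (auto simp: is_blup_anchor_def)
  have Rlin: "R (\<lambda>b. f b *\<^sub>R \<sigma> b + \<tau> b) = (\<lambda>b g. f b * R \<sigma> b g + R \<tau> b g)"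
    if "\<sigma> \<in> BS" "\<tau> \<in> BS" "f \<in> smooth_funs BA" for \<sigma> \<tau> f using R that by (auto simp: is_blup_anchor_def)
  \<comment> \<open>The zero section is written as 1 times itself plus itself, since linearity is
    available in the combined form.\<close>
  have R0: "R (\<lambda>_. 0) b g = 0" for b g
    using fun_cong[OF fun_cong[OF Rlin[OF BS_zero BS_zero B.smooth_funs_const[of 1]], of b], of g] by simp
  have Rs: "lifts_anchor (blup_section \<A> N s) (R (blup_section \<A> N s))" if r: "s \<in> rel_sections \<A> A N C" for s
  proof -
    obtain X where X: "lifts_anchor (blup_section \<A> N s) X" using lifts_anchor_ex[OF blup_section_BS[OF r]] by blast
    have "R (blup_section \<A> N s) = X" using R r lift_vf_eq[OF r X] by (auto simp: is_blup_anchor_def)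
    then show ?thesis using X by simp
  qed
  obtain X where X: "lifts_anchor \<sigma> X" using lifts_anchor_ex[OF s] by blast
  have "R \<sigma> = X"
  proof (rule vector_field_unique[OF Rf[OF s]])
    show "X \<in> vector_fields BA" using X by (simp add: lifts_anchor_def)
    fix x f assume x: "x \<in> points \<A>" "x \<notin> N" and f: "f \<in> smooth_funs \<A>"
    let ?f = "\<lambda>b. f (blowdown b)"
    have xW: "x \<in> points \<A> - N" using x by blast
    obtain \<kappa> K Y where k: "\<kappa> \<in> smooth_funs \<A>" "closedin (mtop \<A>) K" "K \<subseteq> points \<A> - N"
      "x \<in> Y" "\<And>y. y \<in> Y \<Longrightarrow> \<kappa> y = 1" "\<And>y. y \<notin> K \<Longrightarrow> \<kappa> y = 0"
      using bump[OF opn_off_N xW] by metis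
    let ?k = "\<lambda>b. \<kappa> (blowdown b)"
    have kB: "?k \<in> smooth_funs BA" by (rule smooth_funs_blowdown[OF k(1)])
    define t where "t y = \<kappa> y *\<^sub>R \<sigma> (Inl y)" for y
    have "{x. Inl x \<in> points BA} = points \<A> - N" by (auto simp: points_BA BP_Inl)
    then have l: "(\<lambda>y. \<sigma> (Inl y)) \<in> E.lsec (points \<A> - N)"
      using Inl_lsec[OF B.opn_points P.sections_local[OF BS_sections[OF s] B.opn_points]] by simp
    have "t \<in> sections \<A> A" unfolding t_def[abs_def]
      by (rule cutoff_section[OF E.smooth_bundle_axioms k(1,2) _ k(3) opn_off_N l]) (rule k(6))
    moreover have t0: "t y = 0" if "y \<in> N" for y using that k(3,6) unfolding t_def by auto
    ultimately have t: "t \<in> rel_sections \<A> A N C" using C_basis(1) subspace_0 by (intro rel_sectionsI) auto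
    \<comment> \<open>The summand 0 gives the right-hand side the shape of the linearity
      clause.\<close>
    have bt: "blup_section \<A> N t b = ?k b *\<^sub>R \<sigma> b + 0" for b
    proof (cases "b \<in> BP")
      case True
      show ?thesis
      proof (cases "blowdown b \<in> N")
        case True
        then show ?thesis using t0 k(3) k(6)[of "blowdown b"] by (auto simp: blup_section_def)
      next
        case False
        then have "b = Inl (blowdown b)" using BP_off_N[OF True] by simp
        then have "\<sigma> (Inl (blowdown b)) = \<sigma> b" by simp
        then show ?thesis using True by (simp add: blup_section_def t_def)
      qed
    qed (simp add: blup_section_def BS_outside[OF s])
    have "R (blup_section \<A> N t) = (\<lambda>b g. ?k b * R \<sigma> b g + R (\<lambda>_. 0) b g)"
      unfolding ext[of "blup_section \<A> N t", OF bt] by (rule Rlin[OF s BS_zero kB])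
    then have "R \<sigma> (Inl x) ?f = R (blup_section \<A> N t) (Inl x) ?f"
      using k(4,5) by (simp add: R0)
    also have "\<dots> = anchor A x (blup_section \<A> N t (Inl x)) f"
      using Rs[OF t] f x unfolding lifts_anchor_def by (auto simp: BP_Inl)
    also have "\<dots> = X (Inl x) ?f"
      using X f x k(4,5) unfolding lifts_anchor_def by (auto simp: BP_Inl bt)
    finally show "R \<sigma> (Inl x) ?f = X (Inl x) ?f" .
  qed
  then show ?thesis using X by simp
qed

text \<open>The lifts are chosen section by section; the result is linear because a combination of
  lifts is a lift of the combination, and lifts are unique. Restricting to the sections of the
  blowup gives the extensionality that the function space demands.\<close>

lemma is_blup_anchor_ex: "\<exists>R. is_blup_anchor \<A> N A C R"
proof -
  define R where "R = restrict (\<lambda>\<sigma>. SOME X. lifts_anchor \<sigma> X) BS"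
  have R: "lifts_anchor \<sigma> (R \<sigma>)" if "\<sigma> \<in> BS" for \<sigma>
    using someI_ex[OF lifts_anchor_ex[OF that]] that by (simp add: R_def)
  have "is_blup_anchor \<A> N A C R" unfolding is_blup_anchor_def
  proof (intro conjI ballI)
    show "R \<in> BS \<rightarrow>\<^sub>E vector_fields BA" using R by (auto simp: R_def lifts_anchor_def PiE_def)
    show "R (\<lambda>b. f b *\<^sub>R \<sigma> b + \<tau> b) = (\<lambda>b g. f b * R \<sigma> b g + R \<tau> b g)"
      if "\<sigma> \<in> BS" "\<tau> \<in> BS" "f \<in> smooth_funs BA" for \<sigma> \<tau> f
      by (rule lifts_anchor_unique[OF R[OF BS_lin[OF that]] lifts_anchor_lin[OF R[OF that(1)] R[OF that(2)] that]])
    show "R (blup_section \<A> N s) = lift_vf \<A> N (anchor_vf \<A> A s)" if "s \<in> rel_sections \<A> A N C" for s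
      using lift_vf_eq[OF that R[OF blup_section_BS[OF that]]] by simp
  qed
  then show ?thesis by blast
qed

lemma is_blup_anchor_blup_anchor: "is_blup_anchor \<A> N A C (blup_anchor \<A> N A C)"
proof -
  have "R = R'" if R: "is_blup_anchor \<A> N A C R" "is_blup_anchor \<A> N A C R'" for R R'
  proof
    fix \<sigma>
    show "R \<sigma> = R' \<sigma>"
    proof (cases "\<sigma> \<in> BS")
      case True
      then show ?thesis using lifts_anchor_unique lifts_anchor_of_blup_anchor R by blast
    next
      case False
      then show ?thesis using R by (auto simp: is_blup_anchor_def PiE_def extensional_def)
    qed
  qed
  then have "\<exists>!R. is_blup_anchor \<A> N A C R" using is_blup_anchor_ex by blast
  then show ?thesis unfolding blup_anchor_def by (rule theI')
qed

lemma lifts_blup_anchor: "\<sigma> \<in> BS \<Longrightarrow> lifts_anchor \<sigma> (blup_anchor \<A> N A C \<sigma>)"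
  by (rule lifts_anchor_of_blup_anchor[OF is_blup_anchor_blup_anchor])

lemma blup_anchor_sum:
  fixes n :: nat
  assumes "\<And>k. k < n \<Longrightarrow> f k \<in> smooth_funs BA" "\<And>k. k < n \<Longrightarrow> s k \<in> rel_sections \<A> A N C"
  shows "blup_anchor \<A> N A C (\<lambda>b. \<Sum>k<n. f k b *\<^sub>R blup_section \<A> N (s k) b) =
    (\<lambda>b g. \<Sum>k<n. f k b * lift_vf \<A> N (anchor_vf \<A> A (s k)) b g)"
  using assms
proof (induction n)
  case 0
  have "lifts_anchor (\<lambda>_. 0) (\<lambda>_ _. 0)"
    unfolding lifts_anchor_def using B.vector_fields_0 anchor_0 BP_blowdown by auto
  then show ?case using lifts_anchor_unique[OF lifts_blup_anchor[OF BS_zero]] by simp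
next
  case (Suc n)
  let ?\<tau> = "\<lambda>b. \<Sum>k<n. f k b *\<^sub>R blup_section \<A> N (s k) b"
  have t: "?\<tau> \<in> BS" by (rule BS_sum) (use Suc.prems blup_section_BS in auto)
  have s: "blup_section \<A> N (s n) \<in> BS" "f n \<in> smooth_funs BA" using Suc.prems blup_section_BS by auto
  have "blup_anchor \<A> N A C (\<lambda>b. f n b *\<^sub>R blup_section \<A> N (s n) b + ?\<tau> b)
      = (\<lambda>b g. f n b * blup_anchor \<A> N A C (blup_section \<A> N (s n)) b g + blup_anchor \<A> N A C ?\<tau> b g)"
    by (rule lifts_anchor_unique[OF lifts_blup_anchor[OF BS_lin[OF s(1) t s(2)]]
          lifts_anchor_lin[OF lifts_blup_anchor[OF s(1)] lifts_blup_anchor[OF t] s(1) t s(2)]])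
  moreover have "blup_anchor \<A> N A C (blup_section \<A> N (s n)) = lift_vf \<A> N (anchor_vf \<A> A (s n))"
    using lift_vf_eq[OF _ lifts_blup_anchor[OF s(1)]] Suc.prems by simp
  ultimately show ?case using Suc by (simp add: add.commute)
qed

end

section \<open>The singular foliation\<close>


context smooth_bundle begin

text \<open>Steinitz exchange with smooth coefficients. After t rounds the sections c 0, ..., c (t -
  1) have replaced t frame elements, and \<open>L\<close> indexes those that remain. Each round
  divides by a pivot and shrinks the neighbourhood to where it is nonzero; independence of the
  \<open>c j\<close> at y supplies the pivots.\<close>

lemma frame_exchange:
  fixes q t :: nat
  assumes U: "(U, e) \<in> frames E" "y \<in> U" and W0: "opn W0" "y \<in> W0"
    and c: "\<forall>j<q. c j \<in> lsec W0" and basis: "is_basis q (\<lambda>j. c j y) V" and t: "t \<le> q"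
  shows "\<exists>W L h h'. opn W \<and> y \<in> W \<and> W \<subseteq> U \<inter> W0 \<and> L \<subseteq> {..<vrank E} \<and> card L + t = vrank E \<and>
    (\<forall>x\<in>W. \<forall>k<vrank E. (\<forall>j<t. smooth_near \<A> (h k j) x) \<and> (\<forall>l\<in>L. smooth_near \<A> (h' k l) x) \<and>
      e k x = (\<Sum>j<t. h k j x *\<^sub>R c j x) + (\<Sum>l\<in>L. h' k l x *\<^sub>R e l x))"
  using t
proof (induction t)
  case 0
  have o: "opn (U \<inter> W0)" using frame_opn[OF U(1)] W0(1) by blast
  have "e k x = (\<Sum>l<vrank E. (if k = l then 1 else 0) *\<^sub>R e l x)" if "k < vrank E" for k x
    using that by (simp add: if_distrib[of "\<lambda>a. a *\<^sub>R _"] cong: if_cong)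
  then show ?case using o U(2) W0(2) opn_subset[OF o] smooth_near_const
    by (intro exI[of _ "U \<inter> W0"] exI[of _ "{..<vrank E}"] exI[of _ "\<lambda>_ _ _. 0"]
        exI[of _ "\<lambda>k l _. if k = l then 1 else 0"]) auto
next
  case (Suc t)
  let ?r = "vrank E"
  obtain W L h h' where W: "opn W" "y \<in> W" "W \<subseteq> U \<inter> W0" "L \<subseteq> {..<?r}" "card L + t = ?r"
    and H: "\<forall>x\<in>W. \<forall>k<?r. (\<forall>j<t. smooth_near \<A> (h k j) x) \<and> (\<forall>l\<in>L. smooth_near \<A> (h' k l) x) \<and>
      e k x = (\<Sum>j<t. h k j x *\<^sub>R c j x) + (\<Sum>l\<in>L. h' k l x *\<^sub>R e l x)"
    using Suc.IH[OF Suc_leD[OF Suc.prems]] by (elim exE conjE) (rule that)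
  have tq: "t < q" using Suc.prems by simp
  have HE: "e k x = (\<Sum>j<t. h k j x *\<^sub>R c j x) + (\<Sum>l\<in>L. h' k l x *\<^sub>R e l x)" if "x \<in> W" "k < ?r" for k x
    using H that by blast
  have Hs: "smooth_near \<A> (h k j) x" if "x \<in> W" "k < ?r" "j < t" for k j x using H that by blast
  have Hs': "smooth_near \<A> (h' k l) x" if "x \<in> W" "k < ?r" "l \<in> L" for k l x using H that by blast
  have fin: "finite L" using W(4) finite_subset by blast
  obtain g where g: "\<forall>k<?r. \<forall>x\<in>U \<inter> W0. smooth_near \<A> (g k) x"
    "\<forall>x\<in>U \<inter> W0. c t x = (\<Sum>k<?r. g k x *\<^sub>R e k x)"
    using lsec_frame[OF W0(1) c[rule_format, OF tq] U(1)] .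
  have gs: "smooth_near \<A> (g k) x" if "x \<in> W" "k < ?r" for k x using g(1) W(3) that by blast
  define G where "G j x = (\<Sum>k<?r. g k x * h k j x)" for j x
  define G' where "G' l x = (\<Sum>k<?r. g k x * h' k l x)" for l x
  have sG: "smooth_near \<A> (G j) x" if "x \<in> W" "j < t" for x j
    unfolding G_def using that W(3) opn_subset[OF W(1)]
    by (intro smooth_near_sum smooth_near_mult gs Hs) auto
  have sG': "smooth_near \<A> (G' l) x" if "x \<in> W" "l \<in> L" for x l
    unfolding G'_def using that W(3) opn_subset[OF W(1)]
    by (intro smooth_near_sum smooth_near_mult gs Hs') auto
  have ct: "c t x = (\<Sum>j<t. G j x *\<^sub>R c j x) + (\<Sum>l\<in>L. G' l x *\<^sub>R e l x)" if x: "x \<in> W" for x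
  proof -
    have "c t x = (\<Sum>k<?r. g k x *\<^sub>R e k x)" using g x W(3) by blast
    also have "\<dots> = (\<Sum>k<?r. g k x *\<^sub>R ((\<Sum>j<t. h k j x *\<^sub>R c j x) + (\<Sum>l\<in>L. h' k l x *\<^sub>R e l x)))"
    proof (rule sum.cong[OF refl])
      fix k assume "k \<in> {..<?r}"
      then have "e k x = (\<Sum>j<t. h k j x *\<^sub>R c j x) + (\<Sum>l\<in>L. h' k l x *\<^sub>R e l x)" using HE[OF x] by blast
      then show "g k x *\<^sub>R e k x = g k x *\<^sub>R ((\<Sum>j<t. h k j x *\<^sub>R c j x) + (\<Sum>l\<in>L. h' k l x *\<^sub>R e l x))"
        by (rule arg_cong)
    qed
    also have "\<dots> = (\<Sum>k<?r. \<Sum>j<t. (g k x * h k j x) *\<^sub>R c j x) + (\<Sum>k<?r. \<Sum>l\<in>L. (g k x * h' k l x) *\<^sub>R e l x)"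
      by (simp add: scaleR_right_distrib scaleR_sum_right sum.distrib)
    also have "\<dots> = (\<Sum>j<t. \<Sum>k<?r. (g k x * h k j x) *\<^sub>R c j x) + (\<Sum>l\<in>L. \<Sum>k<?r. (g k x * h' k l x) *\<^sub>R e l x)"
      by (intro arg_cong2[of _ _ _ _ "(+)"] sum.swap)
    finally show ?thesis by (simp add: G_def G'_def scaleR_sum_left)
  qed
  \<comment> \<open>Were every candidate pivot zero at y, c t would be a combination of the earlier
    c j there: a vanishing relation in which c t has coefficient -1.\<close>
  have "\<exists>m\<in>L. G' m y \<noteq> 0"
  proof (rule ccontr)
    assume "\<not> (\<exists>m\<in>L. G' m y \<noteq> 0)"
    then have e: "c t y = (\<Sum>j<t. G j y *\<^sub>R c j y)" using ct[OF W(2)] by simp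
    let ?a = "\<lambda>j. if j < t then G j y else if j = t then - 1 else 0"
    have "(\<Sum>j<q. ?a j *\<^sub>R c j y) = (\<Sum>j<Suc t. ?a j *\<^sub>R c j y)"
      using Suc.prems by (intro sum.mono_neutral_right) auto
    also have "\<dots> = 0" by (simp add: e)
    finally have "?a t = 0" using is_basis_coeff_zero[OF basis, of ?a t] Suc.prems by simp
    then show False by simp
  qed
  then obtain m where m: "m \<in> L" "G' m y \<noteq> 0" by blast
  let ?W = "{x \<in> W. G' m x \<in> - {0}}" and ?L = "L - {m}"
  have oW: "opn ?W" by (rule opn_smooth_preimage[OF W(1)]) (use sG' m in auto)
  let ?R = "\<lambda>x. inverse (G' m x)"
  \<comment> \<open>The expansion of c t is solved for e m, and the result is substituted into the
    expansions of all e k. Column t collects the contributions of c t.\<close>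
  define K where "K k j x = (if j < t then h k j x - h' k m x * (G j x * ?R x) else h' k m x * ?R x)" for k j x
  define K' where "K' k l x = h' k l x - h' k m x * (G' l x * ?R x)" for k l x
  have sR: "smooth_near \<A> ?R x" if "x \<in> ?W" for x using sG'[of x m] m that by (intro smooth_near_inverse) auto
  have sK: "smooth_near \<A> (K k j) x" if "x \<in> ?W" "k < ?r" "j < Suc t" for k j x
  proof (cases "j < t")
    case True
    then have "smooth_near \<A> (\<lambda>x. h k j x - h' k m x * (G j x * ?R x)) x"
      using that m by (intro smooth_near_minus smooth_near_mult sR Hs Hs' sG) auto
    then show ?thesis using True by (simp add: K_def[abs_def])
  next
    case False
    then have "smooth_near \<A> (\<lambda>x. h' k m x * ?R x) x"
      using that m by (intro smooth_near_mult sR Hs') auto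
    then show ?thesis using False by (simp add: K_def[abs_def])
  qed
  have sK': "smooth_near \<A> (K' k l) x" if "x \<in> ?W" "k < ?r" "l \<in> ?L" for k l x
    unfolding K'_def[abs_def] using that m by (intro smooth_near_minus smooth_near_mult sR Hs' sG') auto
  have eq: "e k x = (\<Sum>j<Suc t. K k j x *\<^sub>R c j x) + (\<Sum>l\<in>?L. K' k l x *\<^sub>R e l x)" if x: "x \<in> ?W" and k: "k < ?r" for k x
  proof -
    have nz: "G' m x \<noteq> 0" and xW: "x \<in> W" using x by auto
    let ?P = "\<Sum>j<t. G j x *\<^sub>R c j x" and ?P' = "\<Sum>l\<in>?L. G' l x *\<^sub>R e l x"
    let ?S = "\<Sum>j<t. h k j x *\<^sub>R c j x" and ?S' = "\<Sum>l\<in>?L. h' k l x *\<^sub>R e l x"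
    have "c t x = ?P + (G' m x *\<^sub>R e m x + ?P')" using ct[OF xW] sum.remove[OF fin m(1)] by simp
    then have "G' m x *\<^sub>R e m x = c t x - ?P - ?P'" by simp
    then have em: "e m x = ?R x *\<^sub>R (c t x - ?P - ?P')" using nz by (metis left_inverse scaleR_one scaleR_scaleR)
    have "e k x = ?S + (\<Sum>l\<in>L. h' k l x *\<^sub>R e l x)" by (rule HE[OF xW k])
    also have "\<dots> = ?S + (h' k m x *\<^sub>R e m x + ?S')" using sum.remove[OF fin m(1)] by simp
    also have "\<dots> = (?S - (h' k m x * ?R x) *\<^sub>R ?P) + (h' k m x * ?R x) *\<^sub>R c t x + (?S' - (h' k m x * ?R x) *\<^sub>R ?P')"
      unfolding em by (simp add: algebra_simps)
    also have "?S - (h' k m x * ?R x) *\<^sub>R ?P = (\<Sum>j<t. K k j x *\<^sub>R c j x)"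
      by (simp add: K_def scaleR_sum_right sum_subtractf[symmetric] scaleR_left_diff_distrib mult_ac)
    also have "?S' - (h' k m x * ?R x) *\<^sub>R ?P' = (\<Sum>l\<in>?L. K' k l x *\<^sub>R e l x)"
      by (simp add: K'_def scaleR_sum_right sum_subtractf[symmetric] scaleR_left_diff_distrib mult_ac)
    also have "(h' k m x * ?R x) *\<^sub>R c t x = K k t x *\<^sub>R c t x" by (simp add: K_def)
    finally show ?thesis by simp
  qed
  have "card L > 0" using fin m(1) card_gt_0_iff by blast
  then have card: "card ?L + Suc t = ?r" using W(5) m(1) fin by simp
  show ?case
    using oW W(2-4) m(2) card sK sK' eq
    by (intro exI[of _ ?W] exI[of _ ?L] exI[of _ K] exI[of _ K']) auto
qed

text \<open>A dimension count. With a nonzero coefficient at l, the element e l could be expressed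
  by the c j and the other e k with k in L. These are at most q + card L - 1 = vrank E - 1 vectors,
  yet their span would contain the whole frame.\<close>

lemma frame_exchange_independent:
  assumes U: "(U, e) \<in> frames E" "x \<in> U" and L: "L \<subseteq> {..<vrank E}" "card L + q = vrank E"
    and span: "\<And>k. k < vrank E \<Longrightarrow> e k x = (\<Sum>j<q. a k j *\<^sub>R c j) + (\<Sum>l\<in>L. a' k l *\<^sub>R e l x)"
    and b: "(\<Sum>l\<in>L. \<beta> l *\<^sub>R e l x) \<in> span (c ` {..<q})" and l: "l \<in> L"
  shows "\<beta> l = 0"
proof (rule ccontr)
  assume n: "\<beta> l \<noteq> 0"
  have fin: "finite L" using L(1) finite_subset by blast
  let ?T = "c ` {..<q} \<union> (\<lambda>k. e k x) ` (L - {l})"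
  have cT: "span (c ` {..<q}) \<subseteq> span ?T" by (rule span_mono) simp
  have eT: "e k x \<in> span ?T" if "k \<in> L - {l}" for k using that by (intro span_base) auto
  have "\<beta> l *\<^sub>R e l x = (\<Sum>k\<in>L. \<beta> k *\<^sub>R e k x) - (\<Sum>k\<in>L - {l}. \<beta> k *\<^sub>R e k x)"
    using sum.remove[OF fin l, of "\<lambda>k. \<beta> k *\<^sub>R e k x"] by simp
  also have "\<dots> \<in> span ?T"
  proof (rule span_diff)
    show "(\<Sum>k\<in>L. \<beta> k *\<^sub>R e k x) \<in> span ?T" using b cT by blast
    show "(\<Sum>k\<in>L - {l}. \<beta> k *\<^sub>R e k x) \<in> span ?T" by (intro span_sum span_scale eT)
  qed
  finally have "inverse (\<beta> l) *\<^sub>R (\<beta> l *\<^sub>R e l x) \<in> span ?T" by (rule span_scale)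
  then have "e l x \<in> span ?T" using n by simp
  then have eL: "e k x \<in> span ?T" if "k \<in> L" for k using eT that by (cases "k = l") auto
  have "(\<lambda>k. e k x) ` {..<vrank E} \<subseteq> span ?T"
  proof
    fix v assume "v \<in> (\<lambda>k. e k x) ` {..<vrank E}"
    then obtain k where k: "k < vrank E" "v = e k x" by blast
    have "c j \<in> span ?T" if "j < q" for j using that by (intro span_base) auto
    then show "v \<in> span ?T" unfolding k(2) span[OF k(1)] using eL by (intro span_add span_sum span_scale) auto
  qed
  moreover have "independent ((\<lambda>k. e k x) ` {..<vrank E})" and inj: "inj_on (\<lambda>k. e k x) {..<vrank E}"
    using frame_basis[OF U] by (auto simp: is_basis_def)
  moreover have "finite ?T" using fin by simp
  ultimately have "card ((\<lambda>k. e k x) ` {..<vrank E}) \<le> card ?T" using independent_span_bound by blast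
  then have "vrank E \<le> card ?T" by (simp add: card_image[OF inj])
  also have "\<dots> \<le> card (c ` {..<q}) + card ((\<lambda>k. e k x) ` (L - {l}))" by (rule card_Un_le)
  also have "\<dots> \<le> q + card (L - {l})"
    using card_image_le[of "{..<q}" c] card_image_le[of "L - {l}" "\<lambda>k. e k x"] fin by (intro add_mono) auto
  also have "\<dots> < vrank E"
  proof -
    have "card L > 0" using fin l card_gt_0_iff by blast
    then show ?thesis using L(2) fin l by simp
  qed
  finally show False by simp
qed

end

lemma compact_support_mono:
  assumes "compact_support \<A> s" "{x \<in> points \<A>. t x \<noteq> 0} \<subseteq> mtop \<A> closure_of {x \<in> points \<A>. s x \<noteq> 0}"
  shows "compact_support \<A> t"
proof -
  have "mtop \<A> closure_of {x \<in> points \<A>. t x \<noteq> 0} \<subseteq> mtop \<A> closure_of {x \<in> points \<A>. s x \<noteq> 0}"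
    by (rule closure_of_minimal[OF assms(2)]) simp
  then show ?thesis using closed_compactin[OF assms(1)[unfolded compact_support_def]]
    unfolding compact_support_def by (simp add: closedin_closure_of)
qed

lemma compact_supportI:
  assumes "compactin (mtop \<A>) K" "closedin (mtop \<A>) K" "\<And>x. x \<notin> K \<Longrightarrow> s x = 0"
  shows "compact_support \<A> s"
proof -
  have "mtop \<A> closure_of {x \<in> points \<A>. s x \<noteq> 0} \<subseteq> K"
    by (rule closure_of_minimal[OF _ assms(2)]) (use assms(3) in auto)
  then show ?thesis unfolding compact_support_def by (intro closed_compactin[OF assms(1)]) auto
qed

section \<open>Cutting off and dividing functions on the blowup\<close>

context submanifold begin

text \<open>Frame coefficients of a section are smooth only over the preimage of U; a cutoff on M
  supported in U extends them by zero.\<close>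

lemma blowdown_cutoff:
  assumes k: "\<kappa> \<in> smooth_funs \<A>" "closedin (mtop \<A>) K" "\<And>y. y \<notin> K \<Longrightarrow> \<kappa> y = 0" "K \<subseteq> U"
    and a: "\<And>b. b \<in> BP \<Longrightarrow> blowdown b \<in> U \<Longrightarrow> smooth_near BA a b"
  shows "(\<lambda>b. \<kappa> (blowdown b) * a b) \<in> smooth_funs BA"
  unfolding B.smooth_funs_iff
proof
  fix b assume bp: "b \<in> points BA"
  then have b: "b \<in> BP" by (simp add: points_BA)
  show "smooth_near BA (\<lambda>b. \<kappa> (blowdown b) * a b) b"
  proof (cases "blowdown b \<in> K")
    case True
    then show ?thesis using a b k(4) B.smooth_funs_nearD[OF smooth_funs_blowdown[OF k(1)] bp]
      by (intro B.smooth_near_mult) auto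
  next
    case False
    show ?thesis
      by (rule B.smooth_near_cong[OF B.smooth_near_const[OF bp, of 0] opn_blowdown_vimage[OF opn_compl[OF k(2)]]])
        (use b BP_blowdown False k(3) in auto)
  qed
qed

text \<open>The vanishing condition is stated at the points \<open>Inl x\<close>, where the
  functions from \<open>quotient_extension\<close> are known explicitly. Near a point with f
  nonzero, density supplies points off the exceptional divisor at which f, and so \<sigma>, is
  nonzero; hence the support of f lies in that of \<sigma>.\<close>

lemma compact_smooth_funsI:
  assumes f: "f \<in> smooth_funs BA" and s: "compact_support BA \<sigma>"
    and 0: "\<And>x. Inl x \<in> BP \<Longrightarrow> \<sigma> (Inl x) = 0 \<Longrightarrow> f (Inl x) = 0"
  shows "f \<in> compact_smooth_funs BA"
proof -
  have "{b \<in> points BA. f b \<noteq> 0} \<subseteq> mtop BA closure_of {b \<in> points BA. \<sigma> b \<noteq> 0}"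
  proof
    fix b assume b: "b \<in> {b \<in> points BA. f b \<noteq> 0}"
    show "b \<in> mtop BA closure_of {b \<in> points BA. \<sigma> b \<noteq> 0}"
      unfolding in_closure_of B.topspace_mtop
    proof (intro conjI allI impI)
      show "b \<in> points BA" using b by simp
      fix T assume T: "b \<in> T \<and> B.opn T"
      have "B.opn {b \<in> points BA. f b \<in> - {0}}"
        by (rule B.opn_smooth_preimage[OF B.opn_points]) (use B.smooth_funs_nearD[OF f] in auto)
      then have "B.opn (T \<inter> {b \<in> points BA. f b \<in> - {0}})" using T by blast
      moreover have "b \<in> T \<inter> {b \<in> points BA. f b \<in> - {0}}" using T b by simp
      ultimately obtain x where "Inl x \<in> T \<inter> {b \<in> points BA. f b \<in> - {0}}" by (rule Inl_dense)
      then show "\<exists>y. y \<in> {b \<in> points BA. \<sigma> b \<noteq> 0} \<and> y \<in> T" using 0[of x] by (auto simp: points_BA)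
    qed
  qed
  then show ?thesis using f compact_support_mono[OF s] by (simp add: compact_smooth_funs_def)
qed

text \<open>Dividing by the squared distance \<open>\<rho>\<close> to \<open>N\<close>: a function vanishing on the exceptional
  divisor is the sum of these quotients, each multiplied by the pullback of a normal coordinate.\<close>

lemma quotient_extension:
  assumes s: "slice V \<phi> D" and i: "i \<in> Basis - D" and \<beta>: "\<beta> \<in> smooth_funs BA"
    and K: "closedin (mtop \<A>) K" "K \<subseteq> V"
    and 0: "\<And>b. b \<in> BP \<Longrightarrow> blowdown b \<notin> K \<or> blowdown b \<in> N \<Longrightarrow> \<beta> b = 0"
  defines "\<rho> \<equiv> \<lambda>x. \<Sum>j\<in>Basis - D. (\<phi> x \<bullet> j) * (\<phi> x \<bullet> j)"
  obtains f where "f \<in> smooth_funs BA"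
    "\<forall>x\<in>points \<A> - N. f (Inl x) = \<beta> (Inl x) * ((\<phi> x \<bullet> i) * inverse (\<rho> x))"
proof -
  note V = sliceD(1)[OF s]
  have \<rho>: "\<rho> x \<noteq> 0" if "x \<in> V" "x \<notin> N" for x
  proof -
    obtain j where "j \<in> Basis - D" "\<phi> x \<bullet> j \<noteq> 0" using sliceD(3)[OF s \<open>x \<in> V\<close>] \<open>x \<notin> N\<close> by blast
    then have "\<rho> x > 0" unfolding \<rho>_def by (intro sum_pos2[of _ j]) (auto simp: zero_less_mult_iff not_less_iff_gr_or_eq linorder_neq_iff)
    then show ?thesis by simp
  qed
  show ?thesis
  proof (rule smooth_extension[of "\<lambda>x. \<beta> (Inl x) * ((\<phi> x \<bullet> i) * inverse (\<rho> x))"])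
    fix b assume b: "b \<in> BP"
    consider "blowdown b \<notin> K" | "blowdown b \<in> V" "blowdown b \<notin> N" | "blowdown b \<in> V" "blowdown b \<in> N"
      using K(2) by blast
    then show "\<exists>W f. B.opn W \<and> b \<in> W \<and> (\<forall>b\<in>W. smooth_near BA f b) \<and>
      (\<forall>x. Inl x \<in> W \<longrightarrow> f (Inl x) = \<beta> (Inl x) * ((\<phi> x \<bullet> i) * inverse (\<rho> x)))"
    proof cases
      case 1
      let ?W = "{b \<in> BP. blowdown b \<in> points \<A> - K}"
      have "B.opn ?W" by (rule opn_blowdown_vimage[OF opn_compl[OF K(1)]])
      moreover have "b \<in> ?W" using b 1 BP_blowdown by blast
      moreover have "\<beta> (Inl x) = 0" if "Inl x \<in> ?W" for x using 0[of "Inl x"] that by auto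
      ultimately show ?thesis using B.smooth_near_const[of _ 0] points_BA
        by (intro exI[of _ ?W] exI[of _ "\<lambda>_. 0"]) auto
    next
      case 2
      let ?W = "{b \<in> BP. blowdown b \<in> V \<inter> (points \<A> - N)}"
      let ?f = "\<lambda>b. \<beta> b * ((\<phi> (blowdown b) \<bullet> i) * inverse (\<rho> (blowdown b)))"
      have "B.opn ?W" by (rule opn_blowdown_vimage[OF openin_Int[OF opn_chart[OF V] opn_off_N]])
      moreover have "b \<in> ?W" using b 2 BP_blowdown by blast
      moreover have "smooth_near BA ?f b'" if b': "b' \<in> ?W" for b'
      proof -
        have x: "blowdown b' \<in> V" "blowdown b' \<notin> N" "blowdown b' \<in> points \<A>" using b' by auto
        have c: "smooth_near \<A> (\<lambda>x. \<phi> x \<bullet> j) (blowdown b')" for j by (rule smooth_near_coordinate[OF V x(1)])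
        have "smooth_near \<A> \<rho> (blowdown b')" unfolding \<rho>_def
          by (intro smooth_near_sum smooth_near_mult c x(3))
        then have "smooth_near \<A> (\<lambda>x. (\<phi> x \<bullet> i) * inverse (\<rho> x)) (blowdown b')"
          by (intro smooth_near_mult smooth_near_inverse c \<rho> x)
        then have "smooth_near BA (\<lambda>b. (\<phi> (blowdown b) \<bullet> i) * inverse (\<rho> (blowdown b))) b'"
          by (rule smooth_near_blowdown) (use b' in blast)
        then show ?thesis
          by (rule B.smooth_near_mult[rotated]) (use b' B.smooth_funs_nearD[OF \<beta>] points_BA in auto)
      qed
      ultimately show ?thesis by (intro exI[of _ ?W] exI[of _ ?f]) auto
    next
      case 3
      obtain i0 where i0: "i0 \<in> Basis - D" "b \<in> bdom V \<phi> D i0" using exceptional_chart[OF s b 3] .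
      have i0B: "i0 \<in> Basis" using i0 by simp
      note m = bchart_max[OF s i0(1)]
      let ?bd = "bdom V \<phi> D i0" and ?bm = "bmap V \<phi> D i0"
      let ?S = "?bm ` ?bd"
      have S: "open ?S" by (rule B.maxD(3)[OF m])
      have inv: "inv_into ?bd ?bm (?bm b) = b" if "b \<in> ?bd" for b by (rule inv_into_f_f[OF B.maxD(2)[OF m] that])
      have "?bd \<inter> points BA = ?bd" by (auto simp: bdom_iff points_BA)
      define F where "F = \<beta> \<circ> inv_into ?bd ?bm"
      have F: "smooth_on ?S F" unfolding F_def
        using \<beta> bchart_in_BA[OF s i0(1)] \<open>?bd \<inter> points BA = ?bd\<close> by (force simp: smooth_funs_on_def)
      have F0: "F u = 0" if u: "u \<in> ?S" "u \<bullet> i0 = 0" for u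
      proof -
        obtain b' where b': "b' \<in> ?bd" "u = ?bm b'" using u by blast
        then have "blowdown b' \<in> N" using bmap_zero_iff[OF s i0(1) b'(1)] u by simp
        then show ?thesis using 0[of b'] b' inv[OF b'(1)] by (simp add: F_def bdom_iff)
      qed
      define Q where "Q = (\<lambda>u. if u \<bullet> i0 = 0 then frechet_derivative F (at u) i0 else F u / (u \<bullet> i0))"
      have Q: "smooth_on ?S Q" unfolding Q_def by (rule hadamard_divide[OF S F i0B F0])
      \<comment> \<open>In this chart x_j = u_i0 n_j for the normal coordinates, with n_i0 = 1.
        Hence \<rho> is the square of u_i0 times \<open>?r\<close>, and \<open>?r\<close> is at
        least 1. One factor u_i0 cancels against the numerator x_i, the other is divided off \<beta>
        by Hadamard's lemma.\<close>
      let ?n = "\<lambda>u j. if j = i0 then 1 else u \<bullet> j"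
      let ?r = "\<lambda>u. \<Sum>j\<in>Basis - D. ?n u j * ?n u j"
      have n: "smooth_on ?S (\<lambda>u. ?n u j)" for j
        using smooth_on_inner_left[OF S smooth_on_id[OF S], of j] by (cases "j = i0") auto
      have rpos: "?r u > 0" for u
        using i0(1) by (intro sum_pos2[of _ i0]) auto
      let ?G = "\<lambda>u. Q u * (?n u i * inverse (?r u))"
      have G: "smooth_on ?S ?G"
        by (intro smooth_on_mult smooth_on_inverse smooth_on_sum S Q n) (use rpos less_imp_neq in \<open>metis less_irrefl\<close>)
      have sm: "smooth_near BA (\<lambda>b. ?G (?bm b)) b'" if "b' \<in> ?bd" for b'
        by (rule B.smooth_near_chart_fun[OF m that S _ G]) (use that in blast)
      have eq: "?G (?bm (Inl x)) = \<beta> (Inl x) * ((\<phi> x \<bullet> i) * inverse (\<rho> x))" if x: "Inl x \<in> ?bd" for x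
      proof -
        let ?u = "?bm (Inl x)"
        let ?z = "\<phi> x \<bullet> i0"
        have z: "?z \<noteq> 0" using x by (simp add: bdom_iff)
        have ui: "?u \<bullet> i0 = ?z" using i0B by (simp add: bmap_inner)
        have c: "\<phi> x \<bullet> j = ?z * ?n ?u j" if "j \<in> Basis - D" for j
          using normal_coords_ratio[OF i0(1) x that] by simp
        have "\<rho> x = (\<Sum>j\<in>Basis - D. (?z * ?z) * (?n ?u j * ?n ?u j))" unfolding \<rho>_def
          by (rule sum.cong[OF refl]) (subst c, assumption, subst c, assumption, rule mult.assoc[THEN trans], simp only: mult_ac)
        then have r: "\<rho> x = (?z * ?z) * ?r ?u" by (simp only: sum_distrib_left)
        have Qu: "Q ?u = \<beta> (Inl x) / ?z" using ui z inv[OF x] by (simp add: Q_def F_def)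
        have "\<beta> (Inl x) * ((\<phi> x \<bullet> i) * inverse (\<rho> x)) = \<beta> (Inl x) * ((?z * ?n ?u i) * inverse ((?z * ?z) * ?r ?u))"
          unfolding r c[OF i] by simp
        also have "\<dots> = ?G ?u" unfolding Qu using z rpos[of ?u] by (simp only: field_simps inverse_mult_distrib) (simp add: field_simps)
        finally show ?thesis by simp
      qed
      show ?thesis using B.opn_chart[OF m] i0(2) sm eq
        by (intro exI[of _ ?bd] exI[of _ "\<lambda>b. ?G (?bm b)"]) blast
    qed
  qed (rule that)
qed

end

section \<open>Decomposition into multiples of induced sections, and the two inclusions\<close>

context lie_pair begin

text \<open>Finite sums of multiples of induced sections, built up term by term. Compact support is
  demanded of \<open>s\<close> as well, so that its anchor belongs to the foliation of A.\<close>

inductive decomp :: "('m blup \<Rightarrow> 'a) \<Rightarrow> bool" where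
  decomp_0: "decomp (\<lambda>_. 0)"
| decomp_add: "decomp \<sigma> \<Longrightarrow> f \<in> compact_smooth_funs BA \<Longrightarrow> s \<in> rel_sections \<A> A N C \<Longrightarrow> compact_support \<A> s \<Longrightarrow>
    decomp (\<lambda>b. f b *\<^sub>R blup_section \<A> N s b + \<sigma> b)"

lemma decomp_single:
  assumes "f \<in> compact_smooth_funs BA" "s \<in> rel_sections \<A> A N C" "compact_support \<A> s"
  shows "decomp (\<lambda>b. f b *\<^sub>R blup_section \<A> N s b)"
  using decomp_add[OF decomp_0 assms] by simp

lemma decomp_plus: "decomp \<sigma> \<Longrightarrow> decomp \<tau> \<Longrightarrow> decomp (\<lambda>b. \<sigma> b + \<tau> b)"
proof (induction rule: decomp.induct)
  case (decomp_add \<sigma> f s)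
  have "decomp (\<lambda>b. f b *\<^sub>R blup_section \<A> N s b + (\<sigma> b + \<tau> b))"
    by (rule decomp.decomp_add) (use decomp_add in auto)
  then show ?case by (simp add: add.assoc)
qed simp

lemma decomp_sum: "finite I \<Longrightarrow> (\<And>i. i \<in> I \<Longrightarrow> decomp (\<sigma> i)) \<Longrightarrow> decomp (\<lambda>b. \<Sum>i\<in>I. \<sigma> i b)"
  by (induction I rule: finite_induct) (auto intro: decomp_0 decomp_plus)

text \<open>Frame elements cut off away from N vanish on N, so they induce sections of the blowup.
  The cutoff enters squared: one factor extends the coefficient to B, the other extends the frame
  element to M.\<close>

lemma decomp_local_off:
  assumes y: "y \<in> points \<A>" "y \<notin> N"
  shows "\<exists>\<kappa> X. \<kappa> \<in> smooth_funs \<A> \<and> opn X \<and> y \<in> X \<and> (\<forall>x\<in>X. \<kappa> x = 1) \<and>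
    (\<forall>\<sigma>\<in>BS. compact_support BA \<sigma> \<longrightarrow> decomp (\<lambda>b. \<kappa> (blowdown b) *\<^sub>R \<sigma> b))"
proof -
  obtain U e where U: "(U, e) \<in> frames A" "y \<in> U" using E.frame_cover[OF y(1)] .
  have oU: "opn (U \<inter> (points \<A> - N))" using E.frame_opn[OF U(1)] opn_off_N by blast
  have yU: "y \<in> U \<inter> (points \<A> - N)" using U y by blast
  obtain \<kappa> K X where k: "\<kappa> \<in> smooth_funs \<A>" "compactin (mtop \<A>) K" "closedin (mtop \<A>) K" "K \<subseteq> U \<inter> (points \<A> - N)"
    "opn X" "y \<in> X" "X \<subseteq> K" "\<And>x. x \<in> X \<Longrightarrow> \<kappa> x = 1" "\<And>x. x \<notin> K \<Longrightarrow> \<kappa> x = 0"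
    using bump[OF oU yU] by metis
  have KU: "K \<subseteq> U" using k(4) by blast
  have "decomp (\<lambda>b. (\<kappa> (blowdown b) * \<kappa> (blowdown b)) *\<^sub>R \<sigma> b)" if \<sigma>: "\<sigma> \<in> BS" "compact_support BA \<sigma>" for \<sigma>
  proof -
    let ?U = "{b \<in> BP. blowdown b \<in> U}"
    obtain a where "\<forall>k<vrank A. \<forall>b\<in>?U \<inter> points BA. smooth_near BA (a k) b"
      "\<forall>b\<in>?U \<inter> points BA. \<sigma> b = (\<Sum>k<vrank A. a k b *\<^sub>R (e k \<circ> blowdown) b)"
      using P.lsec_frame[OF B.opn_points P.sections_local[OF BS_sections[OF \<sigma>(1)] B.opn_points] PA_frame[OF U(1)]]
      unfolding PA_simps .
    then have a: "\<And>k b. k < vrank A \<Longrightarrow> b \<in> BP \<Longrightarrow> blowdown b \<in> U \<Longrightarrow> smooth_near BA (a k) b"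
      "\<And>b. b \<in> BP \<Longrightarrow> blowdown b \<in> U \<Longrightarrow> \<sigma> b = (\<Sum>k<vrank A. a k b *\<^sub>R e k (blowdown b))"
      by (auto simp: points_BA)
    let ?s = "\<lambda>k x. \<kappa> x *\<^sub>R e k x" and ?f = "\<lambda>k b. \<kappa> (blowdown b) * a k b"
    have s: "?s k \<in> rel_sections \<A> A N C" "compact_support \<A> (?s k)" if "k < vrank A" for k
    proof -
      have "?s k \<in> sections \<A> A"
        by (rule cutoff_section[OF E.smooth_bundle_axioms k(1,3) k(9) KU E.frame_opn[OF U(1)] E.frame_lsec[OF U(1) that]])
      then show "?s k \<in> rel_sections \<A> A N C"
        by (rule rel_sectionsI) (use k(4,9) C_basis(1) subspace_0 in fastforce)
      show "compact_support \<A> (?s k)" by (rule compact_supportI[OF k(2,3)]) (simp add: k(9))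
    qed
    have f: "?f k \<in> compact_smooth_funs BA" if kk: "k < vrank A" for k
    proof (rule compact_smooth_funsI[OF _ \<sigma>(2)])
      show "?f k \<in> smooth_funs BA" by (rule blowdown_cutoff[OF k(1,3) k(9) KU]) (use a(1) kk in auto)
      fix x assume x: "Inl x \<in> BP" "\<sigma> (Inl x) = 0"
      show "?f k (Inl x) = 0"
      proof (cases "x \<in> U")
        case True
        then show ?thesis using is_basis_coeff_zero[OF E.frame_basis[OF U(1) True], of "\<lambda>k. a k (Inl x)" k] a(2)[OF x(1)] x kk by simp
      next
        case False
        then show ?thesis using k(9) KU by auto
      qed
    qed
    have "decomp (\<lambda>b. \<Sum>k<vrank A. ?f k b *\<^sub>R blup_section \<A> N (?s k) b)"
      by (rule decomp_sum) (use decomp_single f s in auto)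
    moreover have "(\<Sum>k<vrank A. ?f k b *\<^sub>R blup_section \<A> N (?s k) b) = (\<kappa> (blowdown b) * \<kappa> (blowdown b)) *\<^sub>R \<sigma> b" for b
    proof (cases "b \<in> BP \<and> blowdown b \<in> U")
      case True
      then show ?thesis using a(2)[of b] by (simp add: blup_section_def scaleR_sum_right mult_ac)
    next
      case False
      then have "b \<notin> BP \<or> \<kappa> (blowdown b) = 0" using k(9)[of "blowdown b"] KU by blast
      then show ?thesis using BS_outside[OF \<sigma>(1), of b] by (auto simp: blup_section_def)
    qed
    ultimately show ?thesis by simp
  qed
  then show ?thesis using k smooth_funs_mult[OF k(1,1)]
    by (intro exI[of _ "\<lambda>x. \<kappa> x * \<kappa> x"] exI[of _ X]) auto
qed

text \<open>As off N the cutoff enters squared, one factor going to the coefficients and one to the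
  sections \<open>c j\<close> and x_i \<open>e l\<close>. The adapted frame consists of the
  \<open>c j\<close> and the \<open>e l\<close> with l in \<open>L\<close>.\<close>

lemma decomp_local_on:
  assumes y: "y \<in> N"
  shows "\<exists>\<kappa> X. \<kappa> \<in> smooth_funs \<A> \<and> opn X \<and> y \<in> X \<and> (\<forall>x\<in>X. \<kappa> x = 1) \<and>
    (\<forall>\<sigma>\<in>BS. compact_support BA \<sigma> \<longrightarrow> decomp (\<lambda>b. \<kappa> (blowdown b) *\<^sub>R \<sigma> b))"
proof -
  let ?r = "vrank A"
  have yp: "y \<in> points \<A>" using y N_points by blast
  obtain U e where U: "(U, e) \<in> frames A" "y \<in> U" using E.frame_cover[OF yp] .
  have "vector_subbundle \<A> A N C" using subalg by (simp add: lie_subalgebroid_def)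
  then obtain q where "\<forall>y\<in>N. \<exists>W c. opn W \<and> y \<in> W \<and> (\<forall>k<q. c k \<in> E.lsec W) \<and>
      (\<forall>x\<in>W \<inter> N. is_basis q (\<lambda>k. c k x) (C x))"
    unfolding vector_subbundle_def by (elim exE)
  from bspec[OF this y] obtain W0 c where W0: "opn W0" "y \<in> W0" and c: "\<forall>k<q. c k \<in> E.lsec W0"
    and cb: "\<And>x. x \<in> W0 \<Longrightarrow> x \<in> N \<Longrightarrow> is_basis q (\<lambda>k. c k x) (C x)"
    by (elim exE conjE) auto
  obtain W L h h' where W: "opn W" "y \<in> W" "W \<subseteq> U \<inter> W0" "L \<subseteq> {..<?r}" "card L + q = ?r"
    and H: "\<forall>x\<in>W. \<forall>k<?r. (\<forall>j<q. smooth_near \<A> (h k j) x) \<and> (\<forall>l\<in>L. smooth_near \<A> (h' k l) x) \<and>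
      e k x = (\<Sum>j<q. h k j x *\<^sub>R c j x) + (\<Sum>l\<in>L. h' k l x *\<^sub>R e l x)"
    using E.frame_exchange[OF U W0 c cb[OF W0(2) y] order_refl] by (elim exE conjE) (rule that)
  have fL: "finite L" using W(4) finite_subset by blast
  obtain V \<phi> D where V: "y \<in> V" "slice V \<phi> D" using slice_exists[OF y] .
  note Vm = sliceD(1)[OF V(2)]
  have oWV: "opn (W \<inter> V)" "y \<in> W \<inter> V" using W V opn_chart[OF Vm] by auto
  obtain \<kappa> K X where k: "\<kappa> \<in> smooth_funs \<A>" "compactin (mtop \<A>) K" "closedin (mtop \<A>) K" "K \<subseteq> W \<inter> V"
    "opn X" "y \<in> X" "X \<subseteq> K" "\<And>x. x \<in> X \<Longrightarrow> \<kappa> x = 1" "\<And>x. x \<notin> K \<Longrightarrow> \<kappa> x = 0"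
    using bump[OF oWV] by metis
  have KW: "K \<subseteq> W" and KV: "K \<subseteq> V" using k(4) by auto
  have decomp: "decomp (\<lambda>b. (\<kappa> (blowdown b) * \<kappa> (blowdown b)) *\<^sub>R \<sigma> b)" if \<sigma>: "\<sigma> \<in> BS" "compact_support BA \<sigma>" for \<sigma>
  proof -
    let ?U = "{b \<in> BP. blowdown b \<in> U}"
    obtain a where "\<forall>k<?r. \<forall>b\<in>?U \<inter> points BA. smooth_near BA (a k) b"
      "\<forall>b\<in>?U \<inter> points BA. \<sigma> b = (\<Sum>k<?r. a k b *\<^sub>R (e k \<circ> blowdown) b)"
      using P.lsec_frame[OF B.opn_points P.sections_local[OF BS_sections[OF \<sigma>(1)] B.opn_points] PA_frame[OF U(1)]]
      unfolding PA_simps .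
    then have a: "\<And>k b. k < ?r \<Longrightarrow> b \<in> BP \<Longrightarrow> blowdown b \<in> W \<Longrightarrow> smooth_near BA (a k) b"
      "\<And>b. b \<in> BP \<Longrightarrow> blowdown b \<in> W \<Longrightarrow> \<sigma> b = (\<Sum>k<?r. a k b *\<^sub>R e k (blowdown b))"
      using W(3) by (auto simp: points_BA)
    \<comment> \<open>The coefficients vanish where \<sigma> does; this is how compact support
      passes from \<sigma> to the coefficient functions.\<close>
    have a0: "a k b = 0" if "k < ?r" "b \<in> BP" "blowdown b \<in> W" "\<sigma> b = 0" for k b
      using is_basis_coeff_zero[OF E.frame_basis[OF U(1)], of "blowdown b" "\<lambda>k. a k b" k] a(2)[of b] that W(3) by auto
    define \<alpha> where "\<alpha> j b = (\<Sum>k<?r. a k b * h k j (blowdown b))" for j b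
    define \<beta> where "\<beta> l b = (\<Sum>k<?r. a k b * h' k l (blowdown b))" for l b
    have Hs: "smooth_near \<A> (h k j) x" if "x \<in> W" "k < ?r" "j < q" for k j x using H that by blast
    have Hs': "smooth_near \<A> (h' k l) x" if "x \<in> W" "k < ?r" "l \<in> L" for k l x using H that by blast
    have sa: "smooth_near BA (\<alpha> j) b" if "j < q" "b \<in> BP" "blowdown b \<in> W" for j b
      unfolding \<alpha>_def using that by (intro B.smooth_near_sum B.smooth_near_mult a smooth_near_blowdown Hs) (auto simp: points_BA)
    have sb: "smooth_near BA (\<beta> l) b" if "l \<in> L" "b \<in> BP" "blowdown b \<in> W" for l b
      unfolding \<beta>_def using that by (intro B.smooth_near_sum B.smooth_near_mult a smooth_near_blowdown Hs') (auto simp: points_BA)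
    have \<sigma>eq: "\<sigma> b = (\<Sum>j<q. \<alpha> j b *\<^sub>R c j (blowdown b)) + (\<Sum>l\<in>L. \<beta> l b *\<^sub>R e l (blowdown b))"
      if b: "b \<in> BP" "blowdown b \<in> W" for b
    proof -
      let ?x = "blowdown b"
      have "\<sigma> b = (\<Sum>k<?r. a k b *\<^sub>R e k ?x)" by (rule a(2)[OF b])
      also have "\<dots> = (\<Sum>k<?r. a k b *\<^sub>R ((\<Sum>j<q. h k j ?x *\<^sub>R c j ?x) + (\<Sum>l\<in>L. h' k l ?x *\<^sub>R e l ?x)))"
      proof (rule sum.cong[OF refl])
        fix k assume "k \<in> {..<?r}"
        then have "e k ?x = (\<Sum>j<q. h k j ?x *\<^sub>R c j ?x) + (\<Sum>l\<in>L. h' k l ?x *\<^sub>R e l ?x)" using H b(2) by blast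
        then show "a k b *\<^sub>R e k ?x = a k b *\<^sub>R ((\<Sum>j<q. h k j ?x *\<^sub>R c j ?x) + (\<Sum>l\<in>L. h' k l ?x *\<^sub>R e l ?x))"
          by (rule arg_cong)
      qed
      also have "\<dots> = (\<Sum>k<?r. \<Sum>j<q. (a k b * h k j ?x) *\<^sub>R c j ?x) + (\<Sum>k<?r. \<Sum>l\<in>L. (a k b * h' k l ?x) *\<^sub>R e l ?x)"
        by (simp add: scaleR_right_distrib scaleR_sum_right sum.distrib)
      also have "\<dots> = (\<Sum>j<q. \<Sum>k<?r. (a k b * h k j ?x) *\<^sub>R c j ?x) + (\<Sum>l\<in>L. \<Sum>k<?r. (a k b * h' k l ?x) *\<^sub>R e l ?x)"
        by (intro arg_cong2[of _ _ _ _ "(+)"] sum.swap)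
      finally show ?thesis by (simp add: \<alpha>_def \<beta>_def scaleR_sum_left)
    qed
    \<comment> \<open>On the exceptional divisor \<sigma> lies in C, so its part along the
      \<open>e l\<close> lies in the span of the \<open>c j\<close>, from which the
      \<open>e l\<close> are independent.\<close>
    have \<beta>N: "\<beta> l b = 0" if l: "l \<in> L" and b: "b \<in> BP" "blowdown b \<in> W" "blowdown b \<in> N" for l b
    proof -
      let ?x = "blowdown b"
      have x: "?x \<in> U" "?x \<in> W0" using b(2) W(3) by auto
      have Cs: "C ?x = span ((\<lambda>j. c j ?x) ` {..<q})" using cb[OF x(2) b(3)] by (simp add: is_basis_def)
      have "\<sigma> b \<in> C ?x" using \<sigma>(1) b by (simp add: BS_iff)
      moreover have "(\<Sum>j<q. \<alpha> j b *\<^sub>R c j ?x) \<in> C ?x" unfolding Cs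
        by (intro span_sum span_scale span_base) auto
      ultimately have "\<sigma> b - (\<Sum>j<q. \<alpha> j b *\<^sub>R c j ?x) \<in> C ?x" unfolding Cs by (rule span_diff)
      then have sp: "(\<Sum>l\<in>L. \<beta> l b *\<^sub>R e l ?x) \<in> span ((\<lambda>j. c j ?x) ` {..<q})" using \<sigma>eq[OF b(1,2)] Cs by simp
      have "e k ?x = (\<Sum>j<q. h k j ?x *\<^sub>R c j ?x) + (\<Sum>l\<in>L. h' k l ?x *\<^sub>R e l ?x)" if "k < ?r" for k
        using H b(2) that by blast
      from E.frame_exchange_independent[OF U(1) x(1) W(4,5) this sp l] show ?thesis .
    qed
    let ?FA = "\<lambda>j b. \<kappa> (blowdown b) * \<alpha> j b" and ?FB = "\<lambda>l b. \<kappa> (blowdown b) * \<beta> l b"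
    have FA: "?FA j \<in> smooth_funs BA" if "j < q" for j by (rule blowdown_cutoff[OF k(1,3) k(9) KW sa[OF that]])
    have FB: "?FB l \<in> smooth_funs BA" if "l \<in> L" for l by (rule blowdown_cutoff[OF k(1,3) k(9) KW sb[OF that]])
    have FB0: "?FB l b = 0" if "l \<in> L" "b \<in> BP" "blowdown b \<notin> K \<or> blowdown b \<in> N" for l b
      using k(9)[of "blowdown b"] \<beta>N[of l b] that KW by (cases "blowdown b \<in> K") auto
    have zero: "?FA j (Inl x) = 0" "?FB l (Inl x) = 0" if x: "Inl x \<in> BP" "\<sigma> (Inl x) = 0" for j l x
      using a0[of _ "Inl x"] x k(9)[of x] KW by (cases "x \<in> K"; auto simp: \<alpha>_def \<beta>_def)+
    let ?\<rho> = "\<lambda>x. \<Sum>j\<in>Basis - D. (\<phi> x \<bullet> j) * (\<phi> x \<bullet> j)"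
    define Q where "Q l i f \<longleftrightarrow> f \<in> smooth_funs BA \<and>
      (\<forall>x\<in>points \<A> - N. f (Inl x) = ?FB l (Inl x) * ((\<phi> x \<bullet> i) * inverse (?\<rho> x)))" for l i f
    have "\<exists>f. Q l i f" if "l \<in> L" "i \<in> Basis - D" for l i
      unfolding Q_def by (rule quotient_extension[OF V(2) that(2) FB[OF that(1)] k(3) KV FB0[OF that(1)]]) blast+
    then obtain f where "\<And>l i. l \<in> L \<Longrightarrow> i \<in> Basis - D \<Longrightarrow> Q l i (f l i)" by metis
    note f = this[unfolded Q_def]
    \<comment> \<open>\<open>?s j\<close> takes values in C along N because \<open>c j\<close> does;
      \<open>?t l i\<close> vanishes on N because of the normal coordinate in it.\<close>
    let ?s = "\<lambda>j x. \<kappa> x *\<^sub>R c j x" and ?t = "\<lambda>l i x. (\<kappa> x * (\<phi> x \<bullet> i)) *\<^sub>R e l x"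
    have s: "?s j \<in> rel_sections \<A> A N C" "compact_support \<A> (?s j)" if "j < q" for j
    proof -
      have KW0: "K \<subseteq> W0" using KW W(3) by blast
      have "?s j \<in> sections \<A> A"
        by (rule cutoff_section[OF E.smooth_bundle_axioms k(1,3) k(9) KW0 W0(1) c[rule_format, OF that]])
      then show "?s j \<in> rel_sections \<A> A N C"
      proof (rule rel_sectionsI)
        fix z assume z: "z \<in> N"
        show "?s j z \<in> C z"
        proof (cases "z \<in> K")
          case True
          then have "c j z \<in> C z" using is_basis_in[OF cb that] z KW0 by blast
          then show ?thesis using C_basis(1)[OF z] by (simp add: subspace_scale)
        qed (use k(9) C_basis(1)[OF z] subspace_0 in auto)
      qed
      show "compact_support \<A> (?s j)" by (rule compact_supportI[OF k(2,3)]) (simp add: k(9))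
    qed
    have t: "?t l i \<in> rel_sections \<A> A N C" "compact_support \<A> (?t l i)" if l: "l \<in> L" and i: "i \<in> Basis - D" for l i
    proof -
      have KU: "K \<subseteq> U" using KW W(3) by blast
      have l': "l < ?r" using l W(4) by auto
      have m: "(\<lambda>x. \<kappa> x * (\<phi> x \<bullet> i)) \<in> smooth_funs \<A>"
        by (rule cutoff[OF k(1,3) k(9)]) (use smooth_near_coordinate[OF Vm] KV in auto)
      have "?t l i \<in> sections \<A> A"
        by (rule cutoff_section[OF E.smooth_bundle_axioms m k(3) _ KU E.frame_opn[OF U(1)] E.frame_lsec[OF U(1) l']])
          (simp add: k(9))
      moreover have t0: "?t l i z = 0" if "z \<in> N" for z
        using that k(9)[of z] sliceD(3)[OF V(2), of z] KV i by (cases "z \<in> K") auto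
      ultimately show "?t l i \<in> rel_sections \<A> A N C"
        by (intro rel_sectionsI) (simp_all only: t0 subspace_0[OF C_basis(1)])
      show "compact_support \<A> (?t l i)" by (rule compact_supportI[OF k(2,3)]) (simp add: k(9))
    qed
    have cA: "?FA j \<in> compact_smooth_funs BA" if "j < q" for j
      by (rule compact_smooth_funsI[OF FA[OF that] \<sigma>(2)]) (rule zero)
    have cf: "f l i \<in> compact_smooth_funs BA" if "l \<in> L" "i \<in> Basis - D" for l i
      by (rule compact_smooth_funsI[OF _ \<sigma>(2)]) (use f[OF that] zero in \<open>auto simp: BP_Inl\<close>)
    have "decomp (\<lambda>b. (\<Sum>j<q. ?FA j b *\<^sub>R blup_section \<A> N (?s j) b) +
        (\<Sum>l\<in>L. \<Sum>i\<in>Basis - D. f l i b *\<^sub>R blup_section \<A> N (?t l i) b))"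
    proof (rule decomp_plus)
      show "decomp (\<lambda>b. \<Sum>j<q. ?FA j b *\<^sub>R blup_section \<A> N (?s j) b)"
        by (rule decomp_sum, simp, rule decomp_single[OF cA s]) auto
      show "decomp (\<lambda>b. \<Sum>l\<in>L. \<Sum>i\<in>Basis - D. f l i b *\<^sub>R blup_section \<A> N (?t l i) b)"
        by (rule decomp_sum[OF fL], rule decomp_sum, simp, rule decomp_single[OF cf t]) auto
    qed
    moreover have "(\<Sum>j<q. ?FA j b *\<^sub>R blup_section \<A> N (?s j) b) +
        (\<Sum>l\<in>L. \<Sum>i\<in>Basis - D. f l i b *\<^sub>R blup_section \<A> N (?t l i) b) = (\<kappa> (blowdown b) * \<kappa> (blowdown b)) *\<^sub>R \<sigma> b" for b
    proof (cases "b \<in> BP \<and> blowdown b \<in> K")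
      case True
      let ?x = "blowdown b"
      have b: "b \<in> BP" "?x \<in> W" "?x \<in> V" using True KW KV by auto
      \<comment> \<open>Off N the weights x_i x_i / \<rho> add up to 1. On N the normal coordinates
        and \<beta> vanish, so both sides are 0.\<close>
      have "(\<Sum>i\<in>Basis - D. f l i b *\<^sub>R blup_section \<A> N (?t l i) b) = (\<kappa> ?x * \<kappa> ?x * \<beta> l b) *\<^sub>R e l ?x" if l: "l \<in> L" for l
      proof (cases "?x \<in> N")
        case xN: True
        have "\<phi> ?x \<bullet> i = 0" if "i \<in> Basis - D" for i using sliceD(3)[OF V(2) b(3)] xN that by blast
        then have "\<forall>i\<in>Basis - D. f l i b *\<^sub>R blup_section \<A> N (?t l i) b = 0"
          by (simp add: blup_section_def)
        then have "(\<Sum>i\<in>Basis - D. f l i b *\<^sub>R blup_section \<A> N (?t l i) b) = 0" by (rule sum.neutral)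
        then show ?thesis using \<beta>N[OF l b(1,2) xN] by (simp only: mult_zero_right scaleR_zero_left)
      next
        case False
        have bI: "b = Inl ?x" by (rule BP_off_N[OF b(1) False])
        have xp: "?x \<in> points \<A> - N" using BP_blowdown[OF b(1)] False by blast
        have "\<not> (\<forall>i\<in>Basis - D. \<phi> ?x \<bullet> i = 0)" using sliceD(3)[OF V(2) b(3)] False by blast
        then have \<rho>: "?\<rho> ?x \<noteq> 0" by (subst sum_nonneg_eq_0_iff) auto
        have "f l i b = ?FB l b * ((\<phi> ?x \<bullet> i) * inverse (?\<rho> ?x))" if "i \<in> Basis - D" for i
        proof -
          have "f l i (Inl ?x) = ?FB l (Inl ?x) * ((\<phi> ?x \<bullet> i) * inverse (?\<rho> ?x))" using f[OF l that] xp by blast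
          then show ?thesis by (simp only: bI[symmetric])
        qed
        then have "(\<Sum>i\<in>Basis - D. f l i b *\<^sub>R blup_section \<A> N (?t l i) b) =
          (\<Sum>i\<in>Basis - D. ((\<kappa> ?x * \<kappa> ?x * \<beta> l b * inverse (?\<rho> ?x)) * ((\<phi> ?x \<bullet> i) * (\<phi> ?x \<bullet> i))) *\<^sub>R e l ?x)"
          using b(1) by (intro sum.cong refl) (simp add: blup_section_def mult_ac)
        also have "\<dots> = ((\<kappa> ?x * \<kappa> ?x * \<beta> l b * inverse (?\<rho> ?x)) * ?\<rho> ?x) *\<^sub>R e l ?x"
          by (simp only: scaleR_sum_left[symmetric] sum_distrib_left[symmetric])
        also have "\<dots> = (\<kappa> ?x * \<kappa> ?x * \<beta> l b) *\<^sub>R e l ?x" using \<rho> by simp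
        finally show ?thesis .
      qed
      then show ?thesis unfolding \<sigma>eq[OF b(1,2)] using b(1)
        by (simp add: blup_section_def scaleR_right_distrib scaleR_sum_right mult_ac)
    next
      case False
      then have 0: "b \<notin> BP \<or> \<kappa> (blowdown b) = 0" using k(9)[of "blowdown b"] by blast
      then have "blup_section \<A> N (?s j) b = 0" "blup_section \<A> N (?t l i) b = 0" for j l i
        by (auto simp: blup_section_def)
      moreover have "(\<kappa> (blowdown b) * \<kappa> (blowdown b)) *\<^sub>R \<sigma> b = 0" using 0 BS_outside[OF \<sigma>(1), of b] by auto
      ultimately show ?thesis by (simp only: scaleR_zero_right sum.neutral_const add_0)
    qed
    ultimately show ?thesis by simp
  qed
  then show ?thesis using k smooth_funs_mult[OF k(1,1)]
    by (intro exI[of _ "\<lambda>x. \<kappa> x * \<kappa> x"] exI[of _ X]) auto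
qed

text \<open>The image of the support in M is compact and is covered by finitely many open sets on
  each of which a cutoff is 1. Then 1 minus the product of the functions 1 - \<kappa> is 1 on the
  support, and the corresponding multiples of \<sigma> decompose by induction over the finite
  set.\<close>

lemma decomp_compact:
  assumes \<sigma>: "\<sigma> \<in> BS" "compact_support BA \<sigma>"
  shows "decomp \<sigma>"
proof -
  define Q where "Q y \<kappa> X \<longleftrightarrow> \<kappa> \<in> smooth_funs \<A> \<and> opn X \<and> y \<in> X \<and> (\<forall>x\<in>X. \<kappa> x = 1) \<and>
    (\<forall>\<sigma>\<in>BS. compact_support BA \<sigma> \<longrightarrow> decomp (\<lambda>b. \<kappa> (blowdown b) *\<^sub>R \<sigma> b))" for y \<kappa> X
  have "\<exists>\<kappa> X. Q y \<kappa> X" if "y \<in> points \<A>" for y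
  proof (cases "y \<in> N")
    case True
    then show ?thesis unfolding Q_def by (rule decomp_local_on)
  next
    case False
    then show ?thesis unfolding Q_def by (rule decomp_local_off[OF that])
  qed
  then obtain \<kappa> X where "\<And>y. y \<in> points \<A> \<Longrightarrow> Q y (\<kappa> y) (X y)" by metis
  note Q = this[unfolded Q_def]
  have k: "\<kappa> y \<in> smooth_funs \<A>" and X: "opn (X y)" "y \<in> X y" and k1: "\<forall>x\<in>X y. \<kappa> y x = 1"
    and kd: "\<forall>\<sigma>\<in>BS. compact_support BA \<sigma> \<longrightarrow> decomp (\<lambda>b. \<kappa> y (blowdown b) *\<^sub>R \<sigma> b)"
    if "y \<in> points \<A>" for y
    using Q[OF that] by - (elim conjE, assumption)+
  let ?K = "blowdown ` (mtop BA closure_of {b \<in> points BA. \<sigma> b \<noteq> 0})"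
  have K: "compactin (mtop \<A>) ?K"
    by (rule image_compactin[OF \<sigma>(2)[unfolded compact_support_def] continuous_blowdown])
  then have Kp: "?K \<subseteq> points \<A>" using compactin_subset_topspace topspace_mtop by blast
  have cov: "?K \<subseteq> \<Union>(X ` ?K)" using X(2) Kp by blast
  have "\<And>U. U \<in> X ` ?K \<Longrightarrow> opn U" using X(1) Kp by blast
  from compactinD[OF K this cov] obtain \<F> where \<F>: "finite \<F>" "\<F> \<subseteq> X ` ?K" "?K \<subseteq> \<Union>\<F>" by blast
  from finite_subset_image[OF \<F>(1,2)] obtain F where "F \<subseteq> ?K" "finite F" "\<F> = X ` F" by blast
  then have F: "finite F" "F \<subseteq> ?K" "?K \<subseteq> \<Union>(X ` F)" using \<F>(3) by simp_all
  let ?P = "\<lambda>F b. \<Prod>y\<in>F. 1 - \<kappa> y (blowdown b)"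
  have part: "decomp (\<lambda>b. (1 - ?P G b) *\<^sub>R \<sigma> b)" if "finite G" "G \<subseteq> points \<A>" for G
    using that
  proof (induction G rule: finite_induct)
    case empty
    then show ?case by (simp add: decomp_0)
  next
    case (insert z G)
    have Ps: "?P G \<in> smooth_funs BA" unfolding B.smooth_funs_iff
    proof
      fix b assume b: "b \<in> points BA"
      have "smooth_near BA (\<lambda>b. \<kappa> y (blowdown b)) b" if "y \<in> G" for y
        using B.smooth_funs_nearD[OF smooth_funs_blowdown[OF k] b] that insert.prems by blast
      then show "smooth_near BA (?P G) b"
        by (intro B.smooth_near_prod B.smooth_near_minus B.smooth_near_const b)
    qed
    have cs: "compact_support BA (\<lambda>b. ?P G b *\<^sub>R \<sigma> b)"
    proof (rule compact_support_mono[OF \<sigma>(2)])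
      have "{b \<in> points BA. ?P G b *\<^sub>R \<sigma> b \<noteq> 0} \<subseteq> {b \<in> points BA. \<sigma> b \<noteq> 0}" by auto
      also have "\<dots> \<subseteq> mtop BA closure_of {b \<in> points BA. \<sigma> b \<noteq> 0}"
        by (rule closure_of_subset) (auto simp: B.topspace_mtop)
      finally show "{b \<in> points BA. ?P G b *\<^sub>R \<sigma> b \<noteq> 0} \<subseteq> mtop BA closure_of {b \<in> points BA. \<sigma> b \<noteq> 0}" .
    qed
    have zG: "z \<in> points \<A>" "G \<subseteq> points \<A>" using insert.prems by auto
    \<comment> \<open>With P the product over \<open>G\<close>, 1 - (1 - \<kappa> z) P = \<kappa> z
      P + (1 - P). The local decomposition at z is applied to P \<sigma>, which is again a compactly
      supported section of the blowup.\<close>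
    from bspec[OF kd[OF zG(1)] BS_scale[OF \<sigma>(1) Ps], THEN mp, OF cs]
    have "decomp (\<lambda>b. \<kappa> z (blowdown b) *\<^sub>R (?P G b *\<^sub>R \<sigma> b) + (1 - ?P G b) *\<^sub>R \<sigma> b)"
      by (rule decomp_plus[OF _ insert.IH[OF zG(2)]])
    moreover have "\<kappa> z (blowdown b) *\<^sub>R (?P G b *\<^sub>R \<sigma> b) + (1 - ?P G b) *\<^sub>R \<sigma> b = (1 - ?P (insert z G) b) *\<^sub>R \<sigma> b" for b
      using insert(1,2) by (simp add: algebra_simps)
    ultimately show ?case by simp
  qed
  have "(1 - ?P F b) *\<^sub>R \<sigma> b = \<sigma> b" for b
  proof (cases "\<sigma> b = 0")
    case False
    then have b: "b \<in> {b \<in> points BA. \<sigma> b \<noteq> 0}" using BS_outside[OF \<sigma>(1)] points_BA by auto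
    have "{b \<in> points BA. \<sigma> b \<noteq> 0} \<subseteq> mtop BA closure_of {b \<in> points BA. \<sigma> b \<noteq> 0}"
      by (rule closure_of_subset) (auto simp: B.topspace_mtop)
    then have "blowdown b \<in> ?K" using b by blast
    then obtain y where y: "y \<in> F" "blowdown b \<in> X y" using F(3) by blast
    then have "\<kappa> y (blowdown b) = 1" using k1[of y] F(2) Kp by blast
    then have "?P F b = 0" using y(1) F(1) by (intro prod_zero) auto
    then show ?thesis by simp
  qed simp
  then show ?thesis using part[OF F(1)] F(2) Kp by (simp add: subset_trans)
qed

definition foliation_lifts :: "('m blup \<Rightarrow> 'm blup tangent) set" where
  "foliation_lifts = {lift_vf \<A> N Y |Y. Y \<in> foliation \<A> A \<and>
         (\<exists>c\<in>sub_sections \<A> A N C. \<forall>y\<in>N. Y y = anchor A y (c y))}"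

lemma lift_in_foliation_lifts:
  assumes "s \<in> rel_sections \<A> A N C" "compact_support \<A> s"
  shows "lift_vf \<A> N (anchor_vf \<A> A s) \<in> foliation_lifts"
proof -
  let ?c = "\<lambda>x. if x \<in> N then s x else 0"
  have "anchor_vf \<A> A s \<in> foliation \<A> A" using rel_sectionsD(1)[OF assms(1)] assms(2) by (auto simp: foliation_def)
  moreover have "?c \<in> sub_sections \<A> A N C" using assms(1) by (simp add: rel_sections_def)
  moreover have "\<forall>y\<in>N. anchor_vf \<A> A s y = anchor A y (?c y)" using N_points by (auto simp: anchor_vf_def)
  ultimately show ?thesis unfolding foliation_lifts_def
    by (intro CollectI exI[of _ "anchor_vf \<A> A s"] conjI refl bexI[of _ ?c])
qed

lemma decomp_anchor_span:
  "decomp \<sigma> \<Longrightarrow> \<sigma> \<in> BS \<and> blup_anchor \<A> N A C \<sigma> \<in> span_over (compact_smooth_funs BA) foliation_lifts"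
proof (induction rule: decomp.induct)
  case decomp_0
  \<comment> \<open>The zero section corresponds to the empty sum, whose terms may be
    arbitrary.\<close>
  have "blup_anchor \<A> N A C (\<lambda>_. 0) = (\<lambda>x g. \<Sum>k<(0::nat). undefined k x * undefined k x g)"
    using blup_anchor_sum[of 0] by simp
  then show ?case unfolding span_over_def using BS_zero by (intro conjI CollectI) (rule BS_zero, blast)
next
  case (decomp_add \<sigma> f s)
  note s = blup_section_BS[OF decomp_add(3)]
  have \<sigma>: "\<sigma> \<in> BS" using decomp_add.IH by simp
  have f: "f \<in> smooth_funs BA" using decomp_add(2) by (simp add: compact_smooth_funs_def)
  obtain n :: nat and F X where n: "blup_anchor \<A> N A C \<sigma> = (\<lambda>x g. \<Sum>k<n. F k x * X k x g)"
    "\<forall>k<n. F k \<in> compact_smooth_funs BA \<and> X k \<in> foliation_lifts"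
    using decomp_add.IH unfolding span_over_def by blast
  let ?F = "F(n := f)" and ?X = "X(n := lift_vf \<A> N (anchor_vf \<A> A s))"
  have "blup_anchor \<A> N A C (\<lambda>b. f b *\<^sub>R blup_section \<A> N s b + \<sigma> b)
      = (\<lambda>b g. f b * blup_anchor \<A> N A C (blup_section \<A> N s) b g + blup_anchor \<A> N A C \<sigma> b g)"
    by (rule lifts_anchor_unique[OF lifts_blup_anchor[OF BS_lin[OF s \<sigma> f]]
          lifts_anchor_lin[OF lifts_blup_anchor[OF s] lifts_blup_anchor[OF \<sigma>] s \<sigma> f]])
  also have "\<dots> = (\<lambda>x g. \<Sum>k<Suc n. ?F k x * ?X k x g)"
    using lift_vf_eq[OF decomp_add(3) lifts_blup_anchor[OF s]] by (simp add: n(1) add.commute)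
  finally have "blup_anchor \<A> N A C (\<lambda>b. f b *\<^sub>R blup_section \<A> N s b + \<sigma> b) = (\<lambda>x g. \<Sum>k<Suc n. ?F k x * ?X k x g)" .
  moreover have "\<forall>k<Suc n. ?F k \<in> compact_smooth_funs BA \<and> ?X k \<in> foliation_lifts"
    using n(2) decomp_add(2) lift_in_foliation_lifts[OF decomp_add(3,4)] by (auto simp: less_Suc_eq)
  ultimately have "blup_anchor \<A> N A C (\<lambda>b. f b *\<^sub>R blup_section \<A> N s b + \<sigma> b) \<in>
      span_over (compact_smooth_funs BA) foliation_lifts" unfolding span_over_def by blast
  then show ?case using BS_lin[OF s \<sigma> f] by simp
qed

lemma foliation_lift_rel_section:
  assumes ker: "\<And>y v. y \<in> N \<Longrightarrow> v \<in> fibre A y \<Longrightarrow> anchor A y v = (\<lambda>_. 0) \<Longrightarrow> v \<in> C y"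
    and X: "X \<in> foliation_lifts"
  shows "\<exists>s. s \<in> rel_sections \<A> A N C \<and> X = lift_vf \<A> N (anchor_vf \<A> A s)"
proof -
  obtain s c where s: "s \<in> sections \<A> A" "X = lift_vf \<A> N (anchor_vf \<A> A s)"
    and c: "c \<in> sub_sections \<A> A N C" "\<forall>y\<in>N. anchor_vf \<A> A s y = anchor A y (c y)"
    using X unfolding foliation_lifts_def foliation_def by blast
  have "s y \<in> C y" if y: "y \<in> N" for y
  proof -
    have p: "y \<in> points \<A>" using y N_points by blast
    have cy: "c y \<in> C y" using c(1) y by (simp add: sub_sections_def)
    then have cf: "c y \<in> fibre A y" using C_basis(2)[OF y] by blast
    have sf: "s y \<in> fibre A y" using E.lsec_fibre[OF E.sections_local[OF s(1) opn_points] p] .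
    have "anchor_vf \<A> A s y = anchor A y (c y)" using c(2) y by blast
    then have "anchor A y (s y) = anchor A y (c y)" using p by (simp add: anchor_vf_def)
    then have "anchor A y ((- 1) *\<^sub>R c y + s y) = (\<lambda>_. 0)" using anchor_lin[OF p cf sf, of "- 1"] by simp
    moreover have "(- 1) *\<^sub>R c y + s y \<in> fibre A y" using E.fibre_subspace[OF p] cf sf by (intro subspace_add subspace_scale)
    ultimately have "(- 1) *\<^sub>R c y + s y \<in> C y" by (intro ker[OF y])
    from subspace_add[OF C_basis(1)[OF y] this cy] have "((- 1) *\<^sub>R c y + s y) + c y \<in> C y" .
    then show ?thesis by simp
  qed
  then show ?thesis using rel_sectionsI[OF s(1)] s(2) by blast
qed

lemma blup_foliation_eq:
  assumes ker: "\<And>y v. y \<in> N \<Longrightarrow> v \<in> fibre A y \<Longrightarrow> anchor A y v = (\<lambda>_. 0) \<Longrightarrow> v \<in> C y"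
  shows "blup_foliation \<A> N A C = span_over (compact_smooth_funs BA) foliation_lifts"
proof (intro set_eqI iffI)
  fix Y assume "Y \<in> blup_foliation \<A> N A C"
  then show "Y \<in> span_over (compact_smooth_funs BA) foliation_lifts"
    using decomp_anchor_span decomp_compact by (auto simp: blup_foliation_def)
next
  fix Y assume "Y \<in> span_over (compact_smooth_funs BA) foliation_lifts"
  then obtain n :: nat and f X where Y: "Y = (\<lambda>x g. \<Sum>k<n. f k x * X k x g)"
    "\<forall>k<n. f k \<in> compact_smooth_funs BA \<and> X k \<in> foliation_lifts" unfolding span_over_def by blast
  have "\<forall>k. \<exists>s. k < n \<longrightarrow> s \<in> rel_sections \<A> A N C \<and> X k = lift_vf \<A> N (anchor_vf \<A> A s)"
    using foliation_lift_rel_section[OF ker] Y(2) by blast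
  then obtain s where s: "\<And>k. k < n \<Longrightarrow> s k \<in> rel_sections \<A> A N C \<and> X k = lift_vf \<A> N (anchor_vf \<A> A (s k))" by metis
  let ?\<sigma> = "\<lambda>b. \<Sum>k<n. f k b *\<^sub>R blup_section \<A> N (s k) b"
  have f: "f k \<in> smooth_funs BA" if "k < n" for k using Y(2) that by (auto simp: compact_smooth_funs_def)
  have "Y = blup_anchor \<A> N A C ?\<sigma>" using blup_anchor_sum[of n f s] f s Y(1) by simp
  moreover have "?\<sigma> \<in> BS" by (rule BS_sum) (use s f blup_section_BS in auto)
  \<comment> \<open>Where the sum is nonzero some coefficient is, so the finite union of the
    supports of the f k, which is closed and compact, contains the support of the sum.\<close>
  moreover have "compact_support BA ?\<sigma>" unfolding compact_support_def
  proof (rule closed_compactin)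
    let ?T = "\<Union>k\<in>{..<n}. mtop BA closure_of {b \<in> points BA. f k b \<noteq> 0}"
    show "compactin (mtop BA) ?T"
      using Y(2) by (intro compactin_Union) (auto simp: compact_smooth_funs_def compact_support_def)
    show "closedin (mtop BA) (mtop BA closure_of {b \<in> points BA. ?\<sigma> b \<noteq> 0})" by simp
    show "mtop BA closure_of {b \<in> points BA. ?\<sigma> b \<noteq> 0} \<subseteq> ?T"
    proof (rule closure_of_minimal)
      show "closedin (mtop BA) ?T" by (intro closedin_Union) auto
      show "{b \<in> points BA. ?\<sigma> b \<noteq> 0} \<subseteq> ?T"
      proof
        fix b assume b: "b \<in> {b \<in> points BA. ?\<sigma> b \<noteq> 0}"
        then obtain k where k: "k < n" "f k b \<noteq> 0" by (metis (mono_tags, lifting) lessThan_iff mem_Collect_eq scaleR_eq_0_iff sum.neutral)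
        have "{b \<in> points BA. f k b \<noteq> 0} \<subseteq> mtop BA closure_of {b \<in> points BA. f k b \<noteq> 0}"
          by (rule closure_of_subset) (auto simp: B.topspace_mtop)
        then show "b \<in> ?T" using b k by blast
      qed
    qed
  qed
  ultimately show "Y \<in> blup_foliation \<A> N A C" unfolding blup_foliation_def by blast
qed

end

theorem proposition5p3:
  fixes \<A> :: "('m, 'e::euclidean_space) chart set"
    and N :: "'m set"
    and A :: "('m, 'a::real_vector) lie_algebroid"
    and C :: "'m \<Rightarrow> 'a set"
  assumes "smooth_manifold \<A>"
    and "closed_embedded_submanifold \<A> N"
    and "is_lie_algebroid \<A> A"
    and "lie_subalgebroid \<A> A N C"
    and "\<And>y v. y \<in> N \<Longrightarrow> v \<in> fibre A y \<Longrightarrow> anchor A y v = (\<lambda>_. 0) \<Longrightarrow> v \<in> C y"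
  shows "blup_foliation \<A> N A C =
    span_over (compact_smooth_funs (blup_atlas \<A> N))
      {lift_vf \<A> N Y |Y. Y \<in> foliation \<A> A \<and>
         (\<exists>c\<in>sub_sections \<A> A N C. \<forall>y\<in>N. Y y = anchor A y (c y))}"
proof -
  interpret lie_pair \<A> N A C
  proof
    show "is_chart c" if "c \<in> \<A>" for c using assms(1) that by (simp add: smooth_manifold_def)
    show "compatible c c'" if "c \<in> \<A>" "c' \<in> \<A>" for c c' using assms(1) that by (simp add: smooth_manifold_def)
    show "Hausdorff_space (mtop \<A>)" using assms(1) by (simp add: smooth_manifold_def)
  qed (fact assms(2-4))+
  show ?thesis using blup_foliation_eq[OF assms(5)] unfolding foliation_lifts_def .
qed

end
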